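(* Let $X$ be a locally compact Hausdorff space with Borel $\sigma$-algebra $\Omega$, let $E$ be a KB-space, and let $\pi\colon C_0(X)\to\mathcal L_{\mathrm r}(E)$ be a positive representation of $C_0(X)$ on $E$. Then $\pi$ has a unique generating regular positive spectral measure $P$ on $\Omega$; that is, there is exactly one regular positive spectral measure $P\colon\Omega\to\mathcal L_{\mathrm r}(E)$ such that $\pi$ is the restriction to $C_0(X)$ of the representation $\pi_P\colon\mathcal B(X)\to\mathcal L_{\mathrm r}(E)$ generated by $P$.
   Context: All vector spaces are real. $C_0(X)$ is the Banach lattice algebra of real-valued continuous functions on $X$ vanishing at infinity, and $\mathcal B(X)$ is the Banach lattice algebra of bounded Borel measurable real-valued functions on $X$ (supremum norm, pointwise order and multiplication). For a Banach lattice $E$ with norm dual $E'$, $\mathcal L(E)$ denotes the bounded linear operators on $E$, and $\mathcal L_{\mathrm r}(E)\subset\mathcal L(E)$ the regular operators (differences of two positive linear operators). A KB-space is a Banach lattice in which every non-negative increasing norm bounded sequence is norm convergent. A positive representation of an ordered algebra $A$ on $E$ is an algebra homomorphism $\pi\colon A\to\mathcal L(E)$ such that $\pi(a)$ is a positive operator for every $a\geq 0$ in $A$; boundedness is not required, and $\pi$ need not be unital or non-degenerate. A positive spectral measure on $\Omega$ is a map $P\colon\Omega\to\mathcal L_{\mathrm r}(E)$ such that: each $P(\Delta)$ is a positive projection; $P(\emptyset)=0$; $P(\Delta_1\cap\Delta_2)=P(\Delta_1)P(\Delta_2)$ for all $\Delta_1,\Delta_2\in\Omega$; and for pairwise disjoint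 $\Delta_n\in\Omega$ ($n\geq1$) and $x\in E$ one has $P(\bigcup_n\Delta_n)x=\sum_n P(\Delta_n)x$ with norm convergence. ($P(X)$ need not be the identity.) For $x\in E$, $x'\in E'$ put $\mu_{x,x'}(\Delta)=\langle P(\Delta)x,x'\rangle$, a finite signed measure. $P$ is regular if every $\mu_{x,x'}$ is a regular finite signed Borel measure, i.e. a difference of two finite positive measures on $\Omega$ that are outer regular (by open sets) on all Borel sets and inner regular (by compact sets) on all open sets. The representation generated by $P$ is the unique bounded linear map $\pi_P\colon\mathcal B(X)\to(\mathcal L(E),\|\cdot\|)$ with $\pi_P(\chi_\Delta)=P(\Delta)$ for all $\Delta\in\Omega$; it is a positive representation with values in $\mathcal L_{\mathrm r}(E)$, and it satisfies $\langle\pi_P(\phi)x,x'\rangle=\int_X\phi\,d\mu_{x,x'}$ for $\phi\in\mathcal B(X)$, $x\in E$, $x'\in E'$. *)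

theory Defs
  imports "HOL-Analysis.Analysis" "HOL-Library.Lattice_Algebras"
begin

section \<open>Banach lattices and KB-spaces\<close>

class banach_lattice = banach + ordered_real_vector + lattice_ab_group_add_abs +
  assumes norm_lattice_mono: "\<bar>x\<bar> \<le> \<bar>y\<bar> \<Longrightarrow> norm x \<le> norm y"

class kb_space = banach_lattice +
  assumes bounded_mono_convergent:
    "(\<And>n. 0 \<le> u n) \<Longrightarrow> (\<And>m n. m \<le> n \<Longrightarrow> u m \<le> u n) \<Longrightarrow>
       bounded (range u) \<Longrightarrow> convergent u"

definition positive_operator :: "('e::banach_lattice \<Rightarrow> 'e) \<Rightarrow> bool" where
  "positive_operator T \<longleftrightarrow> linear T \<and> (\<forall>x\<ge>0. 0 \<le> T x)"

definition regular_operators :: "('e::banach_lattice \<Rightarrow>\<^sub>L 'e) set" where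
  "regular_operators = {T. \<exists>R S. positive_operator R \<and> positive_operator S \<and>
     (\<forall>x. blinfun_apply T x = R x - S x)}"

section \<open>Function algebras on a topological space\<close>

text \<open>The space is an abstract topology, so that its carrier is \<^term>\<open>topspace X\<close>, not a whole type.
  A real-valued function on the carrier is encoded as a function on the type that is \<open>0\<close> off the
  carrier. This makes the encoding unique and compatible with the pointwise operations.\<close>

definition borel_of :: "'a topology \<Rightarrow> 'a measure" where
  "borel_of X = sigma (topspace X) {U. openin X U}"

definition C0 :: "'a topology \<Rightarrow> ('a \<Rightarrow> real) set" where
  "C0 X = {f. continuous_map X euclideanreal f \<and> (\<forall>x. x \<notin> topspace X \<longrightarrow> f x = 0) \<and>
     (\<forall>\<epsilon>>0. \<exists>K. compactin X K \<and> (\<forall>x \<in> topspace X - K. \<bar>f x\<bar> < \<epsilon>))}"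

definition bounded_borel :: "'a topology \<Rightarrow> ('a \<Rightarrow> real) set" where
  "bounded_borel X = {f. f \<in> borel_measurable (borel_of X) \<and> (\<forall>x. x \<notin> topspace X \<longrightarrow> f x = 0) \<and>
     bounded (f ` topspace X)}"

text \<open>As \<open>f\<close> vanishes off the carrier, the supremum over the type is the supremum norm
  over the carrier, with value \<open>0\<close> when the carrier is empty.\<close>

definition sup_norm :: "('a \<Rightarrow> real) \<Rightarrow> real" where
  "sup_norm f = (SUP x. \<bar>f x\<bar>)"

definition linear_map_on :: "('a \<Rightarrow> real) set \<Rightarrow> (('a \<Rightarrow> real) \<Rightarrow> 'b::real_vector) \<Rightarrow> bool" where
  "linear_map_on A \<rho> \<longleftrightarrow>
     (\<forall>f\<in>A. \<forall>g\<in>A. \<rho> (\<lambda>x. f x + g x) = \<rho> f + \<rho> g) \<and>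
     (\<forall>c. \<forall>f\<in>A. \<rho> (\<lambda>x. c * f x) = c *\<^sub>R \<rho> f)"

definition positive_representation ::
  "('a \<Rightarrow> real) set \<Rightarrow> (('a \<Rightarrow> real) \<Rightarrow> ('e::banach_lattice \<Rightarrow>\<^sub>L 'e)) \<Rightarrow> bool" where
  "positive_representation A \<rho> \<longleftrightarrow>
     linear_map_on A \<rho> \<and>
     (\<forall>f\<in>A. \<forall>g\<in>A. \<rho> (\<lambda>x. f x * g x) = \<rho> f o\<^sub>L \<rho> g) \<and>
     (\<forall>f\<in>A. (\<forall>x. 0 \<le> f x) \<longrightarrow> positive_operator (blinfun_apply (\<rho> f)))"

section \<open>Positive spectral measures\<close>

text \<open>A map on the Borel sets is encoded as an extensional function, that is, with a fixed arbitrary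
  value on all other sets. Hence equality of such maps is equality on the Borel sets.\<close>

definition positive_spectral_measure ::
  "'a topology \<Rightarrow> ('a set \<Rightarrow> ('e::banach_lattice \<Rightarrow>\<^sub>L 'e)) \<Rightarrow> bool" where
  "positive_spectral_measure X P \<longleftrightarrow>
     P \<in> sets (borel_of X) \<rightarrow>\<^sub>E regular_operators \<and>
     (\<forall>\<Delta> \<in> sets (borel_of X). positive_operator (blinfun_apply (P \<Delta>)) \<and> P \<Delta> o\<^sub>L P \<Delta> = P \<Delta>) \<and>
     P {} = 0 \<and>
     (\<forall>\<Delta>\<^sub>1 \<in> sets (borel_of X). \<forall>\<Delta>\<^sub>2 \<in> sets (borel_of X). P (\<Delta>\<^sub>1 \<inter> \<Delta>\<^sub>2) = P \<Delta>\<^sub>1 o\<^sub>L P \<Delta>\<^sub>2) \<and>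
     (\<forall>\<Delta> :: nat \<Rightarrow> 'a set. range \<Delta> \<subseteq> sets (borel_of X) \<longrightarrow> disjoint_family \<Delta> \<longrightarrow>
        (\<forall>x. (\<lambda>n. blinfun_apply (P (\<Delta> n)) x) sums blinfun_apply (P (\<Union>n. \<Delta> n)) x))"

definition finite_regular_measure :: "'a topology \<Rightarrow> 'a measure \<Rightarrow> bool" where
  "finite_regular_measure X M \<longleftrightarrow>
     sets M = sets (borel_of X) \<and> finite_measure M \<and>
     (\<forall>A \<in> sets M. emeasure M A = (INF U \<in> {U. openin X U \<and> A \<subseteq> U}. emeasure M U)) \<and>
     (\<forall>U. openin X U \<longrightarrow> emeasure M U = (SUP K \<in> {K. compactin X K \<and> K \<subseteq> U}. emeasure M K))"

definition regular_signed_measure :: "'a topology \<Rightarrow> ('a set \<Rightarrow> real) \<Rightarrow> bool" where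
  "regular_signed_measure X \<mu> \<longleftrightarrow>
     (\<exists>M N. finite_regular_measure X M \<and> finite_regular_measure X N \<and>
        (\<forall>\<Delta> \<in> sets (borel_of X). \<mu> \<Delta> = measure M \<Delta> - measure N \<Delta>))"

definition regular_spectral_measure ::
  "'a topology \<Rightarrow> ('a set \<Rightarrow> ('e::banach_lattice \<Rightarrow>\<^sub>L 'e)) \<Rightarrow> bool" where
  "regular_spectral_measure X P \<longleftrightarrow>
     (\<forall>(x::'e) (x' :: 'e \<Rightarrow>\<^sub>L real).
        regular_signed_measure X (\<lambda>\<Delta>. blinfun_apply x' (blinfun_apply (P \<Delta>) x)))"

text \<open>The representation of the bounded Borel functions generated by \<open>P\<close>, again as an
  extensional function.\<close>

definition generated_representation ::
  "'a topology \<Rightarrow> ('a set \<Rightarrow> ('e::banach_lattice \<Rightarrow>\<^sub>L 'e)) \<Rightarrow> ('a \<Rightarrow> real) \<Rightarrow> ('e \<Rightarrow>\<^sub>L 'e)" where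
  "generated_representation X P = (THE \<rho>.
     \<rho> \<in> extensional (bounded_borel X) \<and>
     linear_map_on (bounded_borel X) \<rho> \<and>
     (\<exists>C. \<forall>f \<in> bounded_borel X. norm (\<rho> f) \<le> C * sup_norm f) \<and>
     (\<forall>\<Delta> \<in> sets (borel_of X). \<rho> (indicator \<Delta>) = P \<Delta>))"

end

theory Submission
  imports Defs
begin

text \<open>For \<open>x \<ge> 0\<close> the map \<open>f \<mapsto> \<pi> f x\<close> is positive and bounded on the functions with values in the unit
  interval, and in a KB-space a norm bounded upward directed set of positive elements has a supremum
  that lies in its norm closure. So the classical construction of the Riesz measure works in \<open>E\<close>
  itself: an open set \<open>U\<close> gets the supremum of \<open>\<pi> f x\<close> over \<open>0 \<le> f \<le> \<chi>\<^sub>U\<close>, and a Borel set gets the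
  infimum over the open sets around it. Compact inner approximation up to small norm takes the place
  of measurability; it also gives the regularity of all scalar measures. The Riesz measure is linear
  in \<open>x\<close> and yields the operators \<open>P A\<close>. Multiplicativity holds on open sets since \<open>h = \<surd>h \<cdot> \<surd>h\<close>, and
  extends to Borel sets because a countably additive map is determined by its values on open sets.
  For uniqueness, regularity and Urysohn functions give \<open>x' (P U x) \<le> x' (Q U x)\<close> for open \<open>U\<close> and
  positive \<open>x'\<close>, and positive functionals separate the points of \<open>E\<close> by the Hahn-Banach theorem.\<close>

section \<open>Banach lattices\<close>

text \<open>Gluing the scalar Riesz measures of \<open>f \<mapsto> x' (\<pi> f x)\<close> would at
  first give operators into the bidual only; working inside \<open>E\<close> avoids this detour. The
  price is that elements of \<open>E\<close> cannot be compared with a number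
  \<open>\<epsilon>\<close>. Every approximation therefore has the form \<open>a \<le> b + r\<close>
  with a remainder \<open>r\<close> of small norm, and norm closedness of the positive cone removes
  \<open>r\<close> (\<open>le_if_small_perturbation\<close>). When two suprema or infima meet in one
  inequality, they are removed one at a time, with the other one moved to the opposite side. The KB
  property speaks of norm bounded sequences, whereas no bound for \<open>\<pi> f\<close> in terms of
  \<open>f\<close> is given. Such a bound on functions with values in the unit interval is derived
  from positivity; it makes the directed sets of values norm bounded and later bounds the operators
  \<open>P A\<close>. That \<open>P\<close> generates \<open>\<pi>\<close> is seen by cutting a
  function into thin horizontal slices: \<open>\<pi>\<close> and the integral are both squeezed
  between the same values on open level sets.\<close>

lemma norm_mono_nonneg:
  fixes x y :: "'e::banach_lattice"
  assumes "0 \<le> x" "x \<le> y"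
  shows "norm x \<le> norm y"
  using assms by (intro norm_lattice_mono) (metis abs_of_nonneg order_trans)

lemma norm_abs_lattice [simp]: "norm \<bar>x::'e::banach_lattice\<bar> = norm x"
  by (intro antisym norm_lattice_mono) auto

lemma pprt_le_abs: "pprt x \<le> \<bar>x::'e::lattice_ab_group_add_abs\<bar>"
  unfolding pprt_def by (intro le_supI abs_ge_self abs_ge_zero)

lemma norm_pprt_le: "norm (pprt x) \<le> norm (x::'e::banach_lattice)"
  by (metis norm_abs_lattice norm_mono_nonneg pprt_le_abs zero_le_pprt)

lemma pprt_diff_pprt_uminus: "pprt x - pprt (- x) = (x::'e::lattice_ab_group_add_abs)"
  by (simp add: pprt_neg flip: prts)

text \<open>From \<open>- x \<le> r\<close> follows \<open>pprt (- x) \<le> pprt r\<close>, so the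
  negative part of \<open>x\<close> has norm below every \<open>\<epsilon>\<close>. This is norm
  closedness of the positive cone, in the form in which remainders occur later.\<close>

lemma nonneg_if_small_perturbation:
  fixes x :: "'e::banach_lattice"
  assumes "\<And>\<epsilon>. 0 < \<epsilon> \<Longrightarrow> \<exists>r. 0 \<le> x + r \<and> norm r < \<epsilon>"
  shows "0 \<le> x"
proof -
  have "norm (pprt (- x)) \<le> \<epsilon>" if "0 < \<epsilon>" for \<epsilon>
  proof -
    obtain r where r: "0 \<le> x + r" "norm r < \<epsilon>" using assms[OF \<open>0 < \<epsilon>\<close>] by blast
    have "pprt (- x) \<le> pprt r"
      using r(1) diff_le_eq[of 0 x r] by (intro pprt_mono) (simp add: add.commute)
    then show ?thesis
      using norm_mono_nonneg[of "pprt (- x)" "pprt r"] norm_pprt_le[of r] r(2) by simp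
  qed
  then have "norm (pprt (- x)) \<le> 0" by (rule field_le_epsilon) simp
  then show ?thesis by (simp flip: le_zero_iff_zero_pprt)
qed

lemma le_if_small_perturbation:
  fixes x y :: "'e::banach_lattice"
  assumes "\<And>\<epsilon>. 0 < \<epsilon> \<Longrightarrow> \<exists>r. x \<le> y + r \<and> norm r < \<epsilon>"
  shows "x \<le> y"
proof -
  have "0 \<le> y - x"
    by (rule nonneg_if_small_perturbation) (use assms in \<open>force simp: algebra_simps\<close>)
  then show ?thesis by simp
qed

lemma tendsto_nonneg_lattice:
  fixes u :: "nat \<Rightarrow> 'e::banach_lattice"
  assumes "u \<longlonglongrightarrow> x" "\<And>n. N \<le> n \<Longrightarrow> 0 \<le> u n"
  shows "0 \<le> x"
proof (rule nonneg_if_small_perturbation)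
  fix \<epsilon> :: real assume "0 < \<epsilon>"
  then obtain M where "\<And>n. M \<le> n \<Longrightarrow> norm (u n - x) < \<epsilon>"
    using LIMSEQ_D[OF assms(1)] by blast
  then have "norm (u (max M N) - x) < \<epsilon>" by simp
  then show "\<exists>r. 0 \<le> x + r \<and> norm r < \<epsilon>"
    using assms(2)[of "max M N"] by (intro exI[of _ "u (max M N) - x"]) simp
qed

lemma tendsto_le_lattice:
  fixes u v :: "nat \<Rightarrow> 'e::banach_lattice"
  assumes "u \<longlonglongrightarrow> x" "v \<longlonglongrightarrow> y" "\<And>n. N \<le> n \<Longrightarrow> u n \<le> v n"
  shows "x \<le> y"
  using tendsto_nonneg_lattice[OF tendsto_diff[OF assms(2,1)], of N] assms(3) by simp

text \<open>If no element of \<open>S\<close> dominated the elements of \<open>S\<close> above it up to \<open>\<epsilon>\<close>, then one could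
  select an increasing sequence in \<open>S\<close> with steps of norm at least \<open>\<epsilon>\<close>.\<close>

lemma kb_directed_lub:
  fixes S :: "'e::kb_space set"
  assumes ne: "S \<noteq> {}" and dir: "\<And>x y. x \<in> S \<Longrightarrow> y \<in> S \<Longrightarrow> \<exists>z\<in>S. x \<le> z \<and> y \<le> z"
    and nn: "\<And>x. x \<in> S \<Longrightarrow> 0 \<le> x" and bd: "bounded S"
  obtains s where "\<And>y. y \<in> S \<Longrightarrow> y \<le> s" "\<And>\<epsilon>. 0 < \<epsilon> \<Longrightarrow> \<exists>y\<in>S. norm (s - y) < \<epsilon>"
proof -
  have conv: "convergent u" if "\<And>n. u n \<in> S" "\<And>n. u n \<le> u (Suc n)" for u :: "nat \<Rightarrow> 'e"
  proof (rule bounded_mono_convergent)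
    show "0 \<le> u n" for n using that nn by blast
    show "u m \<le> u n" if "m \<le> n" for m n
      by (rule lift_Suc_mono_le[of u, OF _ \<open>m \<le> n\<close>]) (use \<open>\<And>n. u n \<le> u (Suc n)\<close> in auto)
    show "bounded (range u)" using that by (intro bounded_subset[OF bd]) auto
  qed
  have good: "\<exists>y\<in>S. \<forall>z\<in>S. y \<le> z \<longrightarrow> norm (z - y) < \<epsilon>" if "0 < \<epsilon>" for \<epsilon>
  proof (rule ccontr)
    assume "\<not> ?thesis"
    then have "\<forall>y. \<exists>z. y \<in> S \<longrightarrow> z \<in> S \<and> y \<le> z \<and> \<epsilon> \<le> norm (z - y)" by (auto simp: not_less)
    then obtain h where h: "\<And>y. y \<in> S \<Longrightarrow> h y \<in> S \<and> y \<le> h y \<and> \<epsilon> \<le> norm (h y - y)" by metis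
    obtain y0 where "y0 \<in> S" using ne by blast
    define u where "u n = (h ^^ n) y0" for n
    have uS: "u n \<in> S" for n by (induction n) (use h \<open>y0 \<in> S\<close> in \<open>auto simp: u_def\<close>)
    have us: "u (Suc n) = h (u n)" for n by (simp add: u_def)
    have "convergent u" by (rule conv) (use uS us h in auto)
    then have "Cauchy u" by (rule convergent_Cauchy)
    then obtain M where "\<And>m n. M \<le> m \<Longrightarrow> M \<le> n \<Longrightarrow> norm (u m - u n) < \<epsilon>"
      using CauchyD \<open>0 < \<epsilon>\<close> by blast
    from this[of "Suc M" M] show False using h[OF uS[of M]] us[of M] by simp
  qed
  have good_up: "norm (z - y') < \<epsilon>"
    if "\<forall>z\<in>S. y \<le> z \<longrightarrow> norm (z - y) < \<epsilon>" "y \<le> y'" "y' \<le> z" "z \<in> S" for y y' z \<epsilon>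
  proof -
    have "norm (z - y') \<le> norm (z - y)" using that by (intro norm_mono_nonneg) auto
    then show ?thesis using that by fastforce
  qed
  have "\<exists>y. y \<in> S \<and> (\<forall>z\<in>S. y \<le> z \<longrightarrow> norm (z - y) < 1 / Suc n)" for n
    using good[of "1 / Suc n"] by (simp add: Bex_def)
  then obtain g where g: "\<And>n::nat. g n \<in> S"
      "\<And>n z. z \<in> S \<Longrightarrow> g n \<le> z \<Longrightarrow> norm (z - g n) < 1 / Suc n"
    by metis
  obtain j where j: "\<And>x y. x \<in> S \<Longrightarrow> y \<in> S \<Longrightarrow> j x y \<in> S \<and> x \<le> j x y \<and> y \<le> j x y"
    using dir by metis
  \<comment> \<open>The increasing sequence \<open>u\<close> absorbs every \<open>g n\<close>, so no
    element of \<open>S\<close> above \<open>u n\<close> is farther from it than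
    \<open>1 / (n + 1)\<close>. Its limit is the supremum.\<close>
  define u where "u = rec_nat (g 0) (\<lambda>n v. j v (g (Suc n)))"
  have u: "u 0 = g 0" "\<And>n. u (Suc n) = j (u n) (g (Suc n))" by (auto simp: u_def)
  have uS: "u n \<in> S" for n by (induction n) (use u g j in auto)
  have gu: "g n \<le> u n" for n by (cases n) (use u g j uS in auto)
  have "convergent u" by (rule conv) (use uS u j g in auto)
  then obtain s where s: "u \<longlonglongrightarrow> s" by (auto simp: convergent_def)
  show thesis
  proof
    show "\<exists>y\<in>S. norm (s - y) < \<epsilon>" if "0 < \<epsilon>" for \<epsilon>
      using LIMSEQ_D[OF s that] uS by (metis norm_minus_commute order_refl)
    show "y \<le> s" if "y \<in> S" for y
    proof -
      \<comment> \<open>\<open>w\<close> stays above \<open>y\<close> and within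
        \<open>1 / (n + 1)\<close> of \<open>u\<close>, so it also tends to
        \<open>s\<close>.\<close>
      define w where "w n = j y (u n)" for n
      have w: "w n \<in> S" "y \<le> w n" "u n \<le> w n" for n using j[OF that uS] by (auto simp: w_def)
      have "norm (w n - u n) < 1 / Suc n" for n
        using good_up[of "g n" "1 / Suc n" "u n" "w n"] g gu w by blast
      then have "(\<lambda>n. w n - u n) \<longlonglongrightarrow> 0"
        by (intro Lim_null_comparison[OF _ LIMSEQ_inverse_real_of_nat])
          (auto intro!: always_eventually less_imp_le simp: inverse_eq_divide)
      from tendsto_add[OF this s] have "w \<longlonglongrightarrow> s" by simp
      then show ?thesis using w by (intro tendsto_le_lattice[OF tendsto_const, of w s 0]) auto
    qed
  qed
qed

text \<open>Reflection \<open>y \<mapsto> b - y\<close> turns the part of \<open>S\<close> below a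
  fixed \<open>b\<close> into an upward directed set between \<open>0\<close> and \<open>b\<close>,
  which is norm bounded by \<open>norm b\<close>.\<close>

lemma kb_directed_glb:
  fixes S :: "'e::kb_space set"
  assumes ne: "S \<noteq> {}" and dir: "\<And>x y. x \<in> S \<Longrightarrow> y \<in> S \<Longrightarrow> \<exists>z\<in>S. z \<le> x \<and> z \<le> y"
    and nn: "\<And>x. x \<in> S \<Longrightarrow> 0 \<le> x"
  obtains s where "\<And>y. y \<in> S \<Longrightarrow> s \<le> y" "\<And>\<epsilon>. 0 < \<epsilon> \<Longrightarrow> \<exists>y\<in>S. norm (y - s) < \<epsilon>"
proof -
  obtain b where b: "b \<in> S" using ne by blast
  define T where "T = (\<lambda>y. b - y) ` {y \<in> S. y \<le> b}"
  have T1: "T \<noteq> {}" using b by (auto simp: T_def)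
  have T2: "\<exists>z\<in>T. x \<le> z \<and> y \<le> z" if xy: "x \<in> T" "y \<in> T" for x y
  proof -
    obtain x' y' where "x = b - x'" "x' \<in> S" "x' \<le> b" "y = b - y'" "y' \<in> S" "y' \<le> b"
      using xy unfolding T_def by blast
    moreover obtain z where "z \<in> S" "z \<le> x'" "z \<le> y'" using dir calculation by blast
    ultimately show ?thesis by (intro bexI[of _ "b - z"]) (auto simp: T_def)
  qed
  have T3: "0 \<le> x" if "x \<in> T" for x using that by (auto simp: T_def)
  have T4: "bounded T"
    unfolding bounded_iff by (rule exI[of _ "norm b"]) (auto simp: T_def nn intro!: norm_mono_nonneg)
  obtain t where t: "\<And>y. y \<in> T \<Longrightarrow> y \<le> t" "\<And>\<epsilon>. 0 < \<epsilon> \<Longrightarrow> \<exists>y\<in>T. norm (t - y) < \<epsilon>"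
    using kb_directed_lub[OF T1 T2 T3 T4] by blast
  show thesis
  proof
    show "b - t \<le> y" if "y \<in> S" for y
    proof -
      obtain z where "z \<in> S" "z \<le> y" "z \<le> b" using dir b \<open>y \<in> S\<close> by blast
      then have "b - z \<le> t" by (intro t) (auto simp: T_def)
      then have "b - t \<le> z" by (simp add: diff_le_eq add.commute)
      then show ?thesis using \<open>z \<le> y\<close> by (rule order_trans)
    qed
    show "\<exists>y\<in>S. norm (y - (b - t)) < \<epsilon>" if e: "0 < \<epsilon>" for \<epsilon>
    proof -
      obtain y where "y \<in> S" "norm (t - (b - y)) < \<epsilon>" using t(2)[OF e] by (auto simp: T_def)
      then show ?thesis by (intro bexI[of _ y]) (auto simp: algebra_simps)
    qed
  qed
qed

section \<open>Functionals on Banach lattices\<close>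

definition sublinear :: "('a::real_vector \<Rightarrow> real) \<Rightarrow> bool" where
  "sublinear q \<longleftrightarrow> (\<forall>x y. q (x + y) \<le> q x + q y) \<and> (\<forall>c x. 0 \<le> c \<longrightarrow> q (c *\<^sub>R x) = c * q x)"

lemma sublinear_zero: "sublinear q \<Longrightarrow> q 0 = 0"
  unfolding sublinear_def by (metis mult_zero_left order_refl scaleR_zero_left)

lemma sublinear_uminus:
  assumes "sublinear q"
  shows "- q (- x) \<le> q x"
proof -
  have "q (x + - x) \<le> q x + q (- x)" using assms unfolding sublinear_def by blast
  then show ?thesis using sublinear_zero[OF assms] by simp
qed

text \<open>The infimum of \<open>q (y + t z) - t q z\<close> over \<open>t \<ge> 0\<close> lowers \<open>q\<close>. If \<open>q\<close> is minimal, then it does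
  so for no \<open>z\<close>, and thus \<open>q\<close> is odd.\<close>

lemma sublinear_lower:
  fixes q :: "'a::real_vector \<Rightarrow> real"
  assumes q: "sublinear q"
  obtains r where "sublinear r" "\<And>x. r x \<le> q x" "r (- z) \<le> - q z"
proof -
  define h where "h y t = q (y + t *\<^sub>R z) - t * q z" for y t
  define r where "r y = (INF t\<in>{0..}. h y t)" for y
  have sub: "\<And>x y. q (x + y) \<le> q x + q y" and hom: "\<And>c x. 0 \<le> c \<Longrightarrow> q (c *\<^sub>R x) = c * q x"
    using q by (auto simp: sublinear_def)
  have lower: "- q (- y) \<le> h y t" if "0 \<le> t" for y t
    using sub[of "y + t *\<^sub>R z" "- y"] hom[OF that, of z] by (simp add: h_def)
  have bdd: "bdd_below (h y ` {0..})" for y using lower by (auto intro!: bdd_belowI)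
  have r_le: "r y \<le> h y t" if "0 \<le> t" for y t
    unfolding r_def by (rule cINF_lower[OF bdd]) (use that in auto)
  have le_r: "c \<le> r y" if "\<And>t. 0 \<le> t \<Longrightarrow> c \<le> h y t" for c y
    unfolding r_def by (rule cINF_greatest) (use that in auto)
  show thesis
  proof
    show "r x \<le> q x" for x using r_le[of 0 x] by (simp add: h_def)
    \<comment> \<open>At \<open>- z\<close>, the choice \<open>t = 1\<close> gives
      \<open>q 0 - q z\<close>.\<close>
    show "r (- z) \<le> - q z" using r_le[of 1 "- z"] sublinear_zero[OF q] by (simp add: h_def)
    have add: "r (x + y) \<le> r x + r y" for x y
    proof -
      have "r (x + y) - h x s \<le> h y t" if "0 \<le> s" "0 \<le> t" for s t
        using r_le[of "s + t" "x + y"] sub[of "x + s *\<^sub>R z" "y + t *\<^sub>R z"] that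
        by (simp add: h_def algebra_simps)
      then have "r (x + y) - h x s \<le> r y" if "0 \<le> s" for s using le_r that by blast
      then have "r (x + y) - r y \<le> h x s" if "0 \<le> s" for s using that by (simp add: algebra_simps)
      then show ?thesis using le_r[of "r (x + y) - r y" x] by simp
    qed
    have hom_le: "c * r x \<le> r (c *\<^sub>R x)" if "0 < c" for c x
    proof (rule le_r)
      fix t :: real assume t: "0 \<le> t"
      have "h (c *\<^sub>R x) t = c * h x (t / c)"
        using hom[of c "x + (t / c) *\<^sub>R z"] that by (simp add: h_def algebra_simps)
      then show "c * r x \<le> h (c *\<^sub>R x) t" using r_le[of "t / c" x] that t by simp
    qed
    have hom': "r (c *\<^sub>R x) = c * r x" if "0 < c" for c x
    proof (rule antisym)
      show "r (c *\<^sub>R x) \<le> c * r x"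
        using hom_le[of "inverse c" "c *\<^sub>R x"] that by (simp add: field_simps)
    qed (rule hom_le[OF that])
    have "r 0 = 0"
    proof (rule antisym)
      show "r 0 \<le> 0" using r_le[of 0 0] sublinear_zero[OF q] by (simp add: h_def)
      show "0 \<le> r 0" by (rule le_r) (simp add: h_def hom)
    qed
    then show "sublinear r"
      unfolding sublinear_def using add hom' by (metis less_eq_real_def mult_zero_left scaleR_zero_left)
  qed
qed

text \<open>The pointwise infimum works: \<open>- p (- x)\<close> bounds all \<open>q x\<close> from
  below, because \<open>q\<close> is sublinear and \<open>q \<le> p\<close>. For subadditivity, two
  members \<open>q\<close> and \<open>r\<close> of the chain are replaced by the smaller of
  them.\<close>

lemma sublinear_chain_lower_bound:
  fixes p :: "'a::real_vector \<Rightarrow> real"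
  assumes ne: "C \<noteq> {}" and C: "\<And>q. q \<in> C \<Longrightarrow> sublinear q \<and> q \<le> p"
    and chain: "\<And>q r. q \<in> C \<Longrightarrow> r \<in> C \<Longrightarrow> q \<le> r \<or> r \<le> q"
  obtains u where "sublinear u" "\<And>q. q \<in> C \<Longrightarrow> u \<le> q"
proof -
  define u where "u x = (INF q\<in>C. q x)" for x
  have bdd: "bdd_below ((\<lambda>q. q x) ` C)" for x
  proof (rule bdd_belowI)
    fix y assume "y \<in> (\<lambda>q. q x) ` C"
    then obtain q where "q \<in> C" "y = q x" by blast
    then show "- p (- x) \<le> y" using C[of q] sublinear_uminus[of q x] le_funD[of q p "- x"] by simp
  qed
  have u_le: "u x \<le> q x" if "q \<in> C" for q x unfolding u_def by (rule cINF_lower[OF bdd that])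
  have le_u: "c \<le> u x" if "\<And>q. q \<in> C \<Longrightarrow> c \<le> q x" for c x
    unfolding u_def by (rule cINF_greatest[OF ne that])
  show thesis
  proof
    show "u \<le> q" if "q \<in> C" for q using u_le that by (auto simp: le_fun_def)
    have "u (x + y) \<le> u x + u y" for x y
    proof -
      have *: "u (x + y) - q x \<le> r y" if qr: "q \<in> C" "r \<in> C" for q r
      proof -
        obtain s where s: "s \<in> C" "s \<le> q" "s \<le> r" using chain[OF qr] qr by blast
        have "s (x + y) \<le> s x + s y" using C[OF s(1)] by (simp add: sublinear_def)
        then show ?thesis
          using u_le[OF s(1), of "x + y"] le_funD[OF s(2), of x] le_funD[OF s(3), of y] by linarith
      qed
      have "u (x + y) - u y \<le> q x" if "q \<in> C" for q using le_u[of "u (x + y) - q x" y] *[OF that] by simp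
      then show ?thesis using le_u[of "u (x + y) - u y" x] by simp
    qed
    moreover have "u (c *\<^sub>R x) = c * u x" if "0 \<le> c" for c x
    proof (cases "c = 0")
      case True
      have "(\<lambda>q. q (0::'a)) ` C = {0}" using ne C by (auto simp: sublinear_zero image_iff)
      then show ?thesis using True by (simp add: u_def)
    next
      case False
      have hom_le: "d * u y \<le> u (d *\<^sub>R y)" if "0 < d" for d y
      proof (rule le_u)
        fix q assume q: "q \<in> C"
        have "d * u y \<le> d * q y" using u_le[OF q] that by simp
        then show "d * u y \<le> q (d *\<^sub>R y)" using C[OF q] that by (simp add: sublinear_def)
      qed
      show ?thesis
        using hom_le[of c x] hom_le[of "inverse c" "c *\<^sub>R x"] that False by (simp add: field_simps)
    qed
    ultimately show "sublinear u" by (simp add: sublinear_def)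
  qed
qed

text \<open>Lowering \<open>p\<close> at \<open>z\<close> in advance forces
  \<open>m (- z) \<le> - p z\<close> for every \<open>m\<close> below \<open>p'\<close>, which gives
  \<open>f z = p z\<close> in the end. Zorn's lemma then provides a minimal sublinear functional; it
  is odd by \<open>sublinear_lower\<close>, and an odd sublinear functional is linear. No extension
  from a subspace occurs.\<close>

lemma hahn_banach_sublinear:
  fixes p :: "'a::real_vector \<Rightarrow> real"
  assumes p: "sublinear p"
  obtains f where "linear f" "\<And>x. f x \<le> p x" "f z = p z"
proof -
  obtain p' where p': "sublinear p'" "\<And>x. p' x \<le> p x" "p' (- z) \<le> - p z"
    using sublinear_lower[OF p] by blast
  define A where "A = {q. sublinear q \<and> q \<le> p'}"
  \<comment> \<open>The order is reversed: maximal for \<open>P\<close> means pointwise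
    minimal.\<close>
  define P where "P = (\<lambda>q r :: 'a \<Rightarrow> real. r \<le> q)"
  have po: "partial_order_on A (relation_of P A)"
    by (rule partial_order_on_relation_ofI) (auto simp: P_def)
  have "\<exists>m\<in>A. \<forall>q\<in>A. P m q \<longrightarrow> q = m"
  proof (rule predicate_Zorn[OF po])
    fix C assume "C \<in> Chains (relation_of P A)"
    then have C: "\<And>q. q \<in> C \<Longrightarrow> sublinear q \<and> q \<le> p'" "\<And>q r. q \<in> C \<Longrightarrow> r \<in> C \<Longrightarrow> q \<le> r \<or> r \<le> q"
      by (auto simp: Chains_def relation_of_def A_def P_def)
    show "\<exists>u\<in>A. \<forall>q\<in>C. P q u"
    proof (cases "C = {}")
      case True
      then show ?thesis using p' by (auto simp: A_def)
    next
      case False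
      then obtain u where u: "sublinear u" "\<And>q. q \<in> C \<Longrightarrow> u \<le> q"
        using sublinear_chain_lower_bound[OF _ C] by blast
      moreover have "u \<le> p'" using False u C by (meson order_trans ex_in_conv)
      ultimately show ?thesis by (auto simp: A_def P_def)
    qed
  qed
  then obtain m where m: "sublinear m" "m \<le> p'" and min: "\<And>q. sublinear q \<Longrightarrow> q \<le> m \<Longrightarrow> q = m"
    unfolding A_def P_def by (metis (mono_tags, lifting) mem_Collect_eq order_trans)
  have neg: "m (- x) = - m x" for x
  proof -
    obtain r where r: "sublinear r" "\<And>y. r y \<le> m y" "r (- x) \<le> - m x"
      using sublinear_lower[OF m(1)] by blast
    then have "r = m" by (intro min) (auto simp: le_fun_def)
    then show ?thesis using r(3) sublinear_uminus[OF m(1), of "x"] by simp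
  qed
  have sub: "\<And>x y. m (x + y) \<le> m x + m y" and hom: "\<And>c x. 0 \<le> c \<Longrightarrow> m (c *\<^sub>R x) = c * m x"
    using m by (auto simp: sublinear_def)
  have lin: "linear m"
  proof (rule linearI)
    show "m (x + y) = m x + m y" for x y
      using sub[of x y] sub[of "- x" "- y"] neg[of x] neg[of y] neg[of "x + y"] by simp
    show "m (c *\<^sub>R x) = c *\<^sub>R m x" for c x
      using hom[of c x] hom[of "- c" x] neg[of "c *\<^sub>R x"] by (cases "0 \<le> c") auto
  qed
  show thesis
  proof
    show "linear m" by (rule lin)
    show le: "m x \<le> p x" for x using m(2) p'(2)[of x] by (auto simp: le_fun_def intro: order_trans)
    have "m (- z) \<le> - p z" using m(2) p'(3) by (auto simp: le_fun_def intro: order_trans)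
    then show "m z = p z" using le[of z] neg[of z] by simp
  qed
qed

text \<open>A linear functional dominated by the norm of the positive part is positive.\<close>

lemma positive_functional_detects:
  fixes x :: "'e::banach_lattice"
  assumes "\<not> x \<le> 0"
  obtains f :: "'e \<Rightarrow>\<^sub>L real" where "\<And>y. 0 \<le> y \<Longrightarrow> 0 \<le> blinfun_apply f y" "0 < blinfun_apply f x"
proof -
  define p where "p y = norm (pprt y)" for y :: 'e
  have "sublinear p"
    unfolding sublinear_def
  proof (intro conjI allI impI)
    fix y z :: 'e
    have "pprt (y + z) \<le> pprt y + pprt z" by (simp add: pprt_def add_mono)
    then show "p (y + z) \<le> p y + p z"
      unfolding p_def by (meson norm_mono_nonneg norm_triangle_ineq order_trans zero_le_pprt)
  next
    fix c :: real and y :: 'e assume c: "0 \<le> c"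
    have "pprt (c *\<^sub>R y) = c *\<^sub>R pprt y"
    proof (cases "c = 0")
      case False
      have le: "pprt (d *\<^sub>R w) \<le> d *\<^sub>R pprt w" if "0 < d" for d :: real and w :: 'e
        using that unfolding pprt_def
        by (intro sup_least scaleR_left_mono) (auto intro: scaleR_nonneg_nonneg)
      have "c *\<^sub>R pprt (inverse c *\<^sub>R (c *\<^sub>R y)) \<le> c *\<^sub>R (inverse c *\<^sub>R pprt (c *\<^sub>R y))"
        using c False by (intro scaleR_left_mono le) auto
      then show ?thesis using le[of c y] c False by (intro antisym) auto
    qed simp
    then show "p (c *\<^sub>R y) = c * p y" using c by (simp add: p_def)
  qed
  then obtain f where f: "linear f" "\<And>y. f y \<le> p y" "f x = p x" using hahn_banach_sublinear by blast
  have pos: "0 \<le> f y" if "0 \<le> y" for y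
    using f(2)[of "- y"] linear_neg[OF f(1), of y] that by (simp add: p_def)
  have "bounded_linear f"
  proof (rule bounded_linear_intro[where K = 1])
    show "norm (f y) \<le> norm y * 1" for y
      using f(2)[of y] f(2)[of "- y"] linear_neg[OF f(1), of y] norm_pprt_le[of y] norm_pprt_le[of "- y"]
      by (simp add: p_def)
  qed (auto simp: linear_add[OF f(1)] linear_scale[OF f(1)])
  moreover have "0 < f x" using assms by (simp add: f(3) p_def flip: le_zero_iff_zero_pprt)
  ultimately show thesis using pos by (intro that[of "Blinfun f"]) (auto simp: bounded_linear_Blinfun_apply)
qed

lemma positive_functionals_separate:
  fixes x y :: "'e::banach_lattice"
  assumes "\<And>f :: 'e \<Rightarrow>\<^sub>L real. (\<And>z. 0 \<le> z \<Longrightarrow> 0 \<le> blinfun_apply f z) \<Longrightarrow> blinfun_apply f x = blinfun_apply f y"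
  shows "x = y"
proof (rule antisym)
  show "x \<le> y"
  proof (rule ccontr)
    assume "\<not> x \<le> y"
    then obtain f :: "'e \<Rightarrow>\<^sub>L real" where "\<And>z. 0 \<le> z \<Longrightarrow> 0 \<le> blinfun_apply f z" "0 < blinfun_apply f (x - y)"
      using positive_functional_detects[of "x - y"] by auto
    then show False using assms[of f] by (simp add: blinfun.diff_right)
  qed
  show "y \<le> x"
  proof (rule ccontr)
    assume "\<not> y \<le> x"
    then obtain f :: "'e \<Rightarrow>\<^sub>L real" where "\<And>z. 0 \<le> z \<Longrightarrow> 0 \<le> blinfun_apply f z" "0 < blinfun_apply f (y - x)"
      using positive_functional_detects[of "y - x"] by auto
    then show False using assms[of f] by (simp add: blinfun.diff_right)
  qed
qed

text \<open>Riesz-Kantorovich formula for the positive part of \<open>f\<close>, restricted to the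
  cone. Additivity rests on the Riesz decomposition property.\<close>

lemma functional_positive_part:
  fixes f :: "'e::banach_lattice \<Rightarrow>\<^sub>L real"
  obtains g where "\<And>x. 0 \<le> x \<Longrightarrow> 0 \<le> g x" "\<And>x. 0 \<le> x \<Longrightarrow> blinfun_apply f x \<le> g x"
    "\<And>x y. 0 \<le> x \<Longrightarrow> 0 \<le> y \<Longrightarrow> g (x + y) = g x + g y"
    "\<And>x. 0 \<le> x \<Longrightarrow> g x \<le> norm f * norm x"
proof -
  define g where "g x = (SUP z\<in>{0..x}. blinfun_apply f z)" for x
  have le: "blinfun_apply f z \<le> norm f * norm x" if "0 \<le> z" "z \<le> x" for z x
    using norm_blinfun[of f z] norm_mono_nonneg[OF that] mult_left_mono[of "norm z" "norm x" "norm f"] by simp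
  have bdd: "bdd_above (blinfun_apply f ` {0..x})" for x using le by (auto intro!: bdd_aboveI)
  have up: "blinfun_apply f z \<le> g x" if "0 \<le> z" "z \<le> x" for z x
    unfolding g_def by (rule cSUP_upper[OF _ bdd]) (use that in auto)
  have least: "g x \<le> c" if "0 \<le> x" "\<And>z. 0 \<le> z \<Longrightarrow> z \<le> x \<Longrightarrow> blinfun_apply f z \<le> c" for x c
    unfolding g_def by (rule cSUP_least) (use that in auto)
  show thesis
  proof
    show "0 \<le> g x" if "0 \<le> x" for x using up[of 0 x] that by simp
    show "blinfun_apply f x \<le> g x" if "0 \<le> x" for x using up that by simp
    show "g x \<le> norm f * norm x" if "0 \<le> x" for x using least le that by blast
    show "g (x + y) = g x + g y" if xy: "0 \<le> x" "0 \<le> y" for x y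
    proof (rule antisym)
      show "g (x + y) \<le> g x + g y"
      proof (rule least)
        fix z assume z: "0 \<le> z" "z \<le> x + y"
        \<comment> \<open>Riesz decomposition of \<open>z\<close> below \<open>x + y\<close>: the
          pieces \<open>inf z x\<close> and \<open>z - inf z x\<close> lie below \<open>x\<close>
          and \<open>y\<close>.\<close>
        have "z - inf z x = sup 0 (z - x)"
          by (simp add: diff_inf_eq_sup add_sup_distrib_left)
        then have "0 \<le> z - inf z x" "z - inf z x \<le> y" using z xy by (auto simp: algebra_simps)
        then have "blinfun_apply f (inf z x) + blinfun_apply f (z - inf z x) \<le> g x + g y"
          using z xy by (intro add_mono up) auto
        moreover have "inf z x + (z - inf z x) = z" by (metis add.commute diff_add_cancel)
        ultimately show "blinfun_apply f z \<le> g x + g y" by (metis blinfun.add_right)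
      qed (use xy in simp)
      have "blinfun_apply f v + blinfun_apply f w \<le> g (x + y)" if "0 \<le> v" "v \<le> x" "0 \<le> w" "w \<le> y" for v w
        using up[of "v + w" "x + y"] that by (simp add: blinfun.add_right add_mono)
      then have "blinfun_apply f v \<le> g (x + y) - g y" if "0 \<le> v" "v \<le> x" for v
        using least[OF xy(2), of "g (x + y) - blinfun_apply f v"] that by (force simp: algebra_simps)
      then have "g x \<le> g (x + y) - g y" by (intro least xy)
      then show "g x + g y \<le> g (x + y)" by simp
    qed
  qed
qed

section \<open>Continuous functions vanishing at infinity\<close>

lemma C0_D:
  assumes "f \<in> C0 X"
  shows "continuous_map X euclideanreal f" "x \<notin> topspace X \<Longrightarrow> f x = 0"
    "0 < \<epsilon> \<Longrightarrow> \<exists>K. compactin X K \<and> (\<forall>x\<in>topspace X - K. \<bar>f x\<bar> < \<epsilon>)"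
  using assms by (auto simp: C0_def)

text \<open>Continuity of \<open>F\<close> at \<open>0\<close> transfers vanishing at infinity, and
  \<open>F 0 = 0\<close> also keeps the value \<open>0\<close> off the carrier. Scaling, truncation,
  square roots and normalised parts are all instances.\<close>

lemma C0_compose:
  fixes F :: "real \<Rightarrow> real"
  assumes f: "f \<in> C0 X" and F: "continuous_on UNIV F" "F 0 = 0"
  shows "(\<lambda>x. F (f x)) \<in> C0 X"
  unfolding C0_def
proof (intro CollectI conjI allI impI)
  have "continuous_map X euclideanreal (F \<circ> f)"
    using F(1) by (intro continuous_map_compose[OF C0_D(1)[OF f]]) auto
  then show "continuous_map X euclideanreal (\<lambda>x. F (f x))" by (simp add: o_def)
  show "F (f x) = 0" if "x \<notin> topspace X" for x using C0_D(2)[OF f that] F by simp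
  fix \<epsilon> :: real assume "0 < \<epsilon>"
  then obtain \<delta> where \<delta>: "0 < \<delta>" "\<And>y. \<bar>y\<bar> < \<delta> \<Longrightarrow> \<bar>F y\<bar> < \<epsilon>"
    using F unfolding continuous_on_iff by (metis UNIV_I diff_zero dist_real_def)
  obtain K where "compactin X K" "\<forall>x\<in>topspace X - K. \<bar>f x\<bar> < \<delta>" using C0_D(3)[OF f \<delta>(1)] by blast
  then show "\<exists>K. compactin X K \<and> (\<forall>x\<in>topspace X - K. \<bar>F (f x)\<bar> < \<epsilon>)" using \<delta>(2) by blast
qed

lemma C0_add:
  assumes f: "f \<in> C0 X" and g: "g \<in> C0 X"
  shows "(\<lambda>x. f x + g x) \<in> C0 X"
  unfolding C0_def
proof (intro CollectI conjI allI impI)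
  show "continuous_map X euclideanreal (\<lambda>x. f x + g x)"
    by (intro continuous_map_add C0_D(1)[OF f] C0_D(1)[OF g])
  show "f x + g x = 0" if "x \<notin> topspace X" for x using C0_D(2)[OF f that] C0_D(2)[OF g that] by simp
  fix \<epsilon> :: real assume "0 < \<epsilon>"
  then have "0 < \<epsilon> / 2" by simp
  then obtain K L where K: "compactin X K" "\<forall>x\<in>topspace X - K. \<bar>f x\<bar> < \<epsilon> / 2"
      and L: "compactin X L" "\<forall>x\<in>topspace X - L. \<bar>g x\<bar> < \<epsilon> / 2"
    using C0_D(3)[OF f] C0_D(3)[OF g] by metis
  have "\<bar>f x + g x\<bar> < \<epsilon>" if "x \<in> topspace X - (K \<union> L)" for x
    using K(2)[rule_format, of x] L(2)[rule_format, of x] that by auto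
  then show "\<exists>K. compactin X K \<and> (\<forall>x\<in>topspace X - K. \<bar>f x + g x\<bar> < \<epsilon>)"
    using compactin_Un[OF K(1) L(1)] by blast
qed

lemma C0_scale: "f \<in> C0 X \<Longrightarrow> (\<lambda>x. c * f x) \<in> C0 X"
  by (rule C0_compose[where F = "\<lambda>y. c * y"]) (auto intro!: continuous_intros)

lemma C0_zero: "(\<lambda>x. 0) \<in> C0 X"
  by (auto simp: C0_def intro: exI[of _ "{}"])

lemma C0_diff: "f \<in> C0 X \<Longrightarrow> g \<in> C0 X \<Longrightarrow> (\<lambda>x. f x - g x) \<in> C0 X"
  using C0_add[OF _ C0_scale[of g X "- 1"]] by auto

lemma C0_mult:
  assumes f: "f \<in> C0 X" and g: "g \<in> C0 X"
  shows "(\<lambda>x. f x * g x) \<in> C0 X"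
proof -
  have sq: "(\<lambda>x. (h x)\<^sup>2) \<in> C0 X" if "h \<in> C0 X" for h
    by (rule C0_compose[OF that, where F = "\<lambda>y. y\<^sup>2"]) (auto intro!: continuous_intros)
  \<comment> \<open>Polarization reduces products to squares, which are compositions.\<close>
  have "(\<lambda>x. (1/2) * (((f x + g x)\<^sup>2 - (f x)\<^sup>2) - (g x)\<^sup>2)) \<in> C0 X"
    by (intro C0_scale C0_diff sq C0_add f g)
  then show ?thesis by (simp add: power2_sum)
qed

lemma C0_max:
  assumes f: "f \<in> C0 X" and g: "g \<in> C0 X"
  shows "(\<lambda>x. max (f x) (g x)) \<in> C0 X"
proof -
  have "(\<lambda>x. (1/2) * ((f x + g x) + \<bar>f x - g x\<bar>)) \<in> C0 X"
    by (intro C0_scale C0_add f g C0_compose[where F = abs] C0_diff) (auto intro!: continuous_intros)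
  then show ?thesis by (rule back_subst[of "\<lambda>h. h \<in> C0 X"]) (auto simp: max_def)
qed

lemma C0_uniform_limit:
  assumes "\<And>n. g n \<in> C0 X" "uniform_limit UNIV g f sequentially"
  shows "f \<in> C0 X"
proof -
  have ev: "\<forall>\<^sub>F n in sequentially. \<forall>x. \<bar>g n x - f x\<bar> < \<epsilon>" if "0 < \<epsilon>" for \<epsilon>
    using assms(2) that by (auto simp: uniform_limit_iff dist_real_def)
  have "continuous_map X Met_TC.mtopology f"
  proof (rule Met_TC.continuous_map_uniform_limit[where F = sequentially and f = g])
    show "\<forall>\<^sub>F n in sequentially. continuous_map X Met_TC.mtopology (g n)"
      using C0_D(1)[OF assms(1)] by (simp add: mtopology_is_euclidean)
    show "\<forall>\<^sub>F n in sequentially. \<forall>x\<in>topspace X. f x \<in> UNIV \<and> dist (g n x) (f x) < \<epsilon>" if "0 < \<epsilon>" for \<epsilon>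
      using ev[OF that] by eventually_elim (auto simp: dist_real_def)
  qed simp
  moreover have "f x = 0" if "x \<notin> topspace X" for x
  proof -
    have "(\<lambda>n. g n x) \<longlonglongrightarrow> f x" by (rule tendsto_uniform_limitI[OF assms(2)]) simp
    then show ?thesis using C0_D(2)[OF assms(1) that] by (simp add: LIMSEQ_const_iff)
  qed
  moreover have "\<exists>K. compactin X K \<and> (\<forall>x\<in>topspace X - K. \<bar>f x\<bar> < \<epsilon>)" if e: "0 < \<epsilon>" for \<epsilon>
  proof -
    have "0 < \<epsilon> / 2" using e by simp
    then obtain n where n: "\<And>x. \<bar>g n x - f x\<bar> < \<epsilon> / 2"
      using ev unfolding eventually_sequentially by blast
    obtain K where K: "compactin X K" "\<And>x. x \<in> topspace X - K \<Longrightarrow> \<bar>g n x\<bar> < \<epsilon> / 2"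
      using C0_D(3)[OF assms(1)[of n], of "\<epsilon> / 2"] e by auto
    have "\<bar>f x\<bar> < \<epsilon>" if "x \<in> topspace X - K" for x using n[of x] K(2)[OF that] by linarith
    then show ?thesis using K(1) by blast
  qed
  ultimately show ?thesis by (auto simp: C0_def mtopology_is_euclidean)
qed

lemma C0_sum: "(\<And>i. i \<in> I \<Longrightarrow> f i \<in> C0 X) \<Longrightarrow> (\<lambda>x. \<Sum>i\<in>I. f i x) \<in> C0 X"
  by (induction I rule: infinite_finite_induct) (auto intro: C0_add C0_zero)

lemma C0_level_compactin:
  assumes f: "f \<in> C0 X" and "0 < \<epsilon>"
  shows "compactin X {x \<in> topspace X. \<epsilon> \<le> f x}"
proof -
  obtain K where K: "compactin X K" "\<And>x. x \<in> topspace X - K \<Longrightarrow> \<bar>f x\<bar> < \<epsilon>"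
    using C0_D(3)[OF f \<open>0 < \<epsilon>\<close>] by blast
  have "closedin X {x \<in> topspace X. f x \<in> {\<epsilon>..}}"
    by (rule closedin_continuous_map_preimage[OF C0_D(1)[OF f]]) simp
  moreover have "{x \<in> topspace X. f x \<in> {\<epsilon>..}} \<subseteq> K" using K(2) by force
  ultimately show ?thesis using closed_compactin[OF K(1)] by (simp add: atLeast_def)
qed

lemma C0_level_openin: "f \<in> C0 X \<Longrightarrow> openin X {x \<in> topspace X. c < f x}"
  using openin_continuous_map_preimage[OF C0_D(1), of f X "{c<..}"] by simp

lemma C0_bounded:
  assumes f: "f \<in> C0 X"
  obtains B where "0 < B" "\<And>x. \<bar>f x\<bar> \<le> B"
proof -
  obtain K where K: "compactin X K" "\<And>x. x \<in> topspace X - K \<Longrightarrow> \<bar>f x\<bar> < 1"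
    using C0_D(3)[OF f, of 1] by auto
  have "compact (f ` K)" using image_compactin[OF K(1) C0_D(1)[OF f]] by simp
  then obtain B where "\<And>x. x \<in> K \<Longrightarrow> \<bar>f x\<bar> \<le> B"
    using compact_imp_bounded[of "f ` K"] by (auto simp: bounded_iff)
  then have "\<bar>f x\<bar> \<le> max B 1" for x
    using K(2)[of x] C0_D(2)[OF f, of x] by (cases "x \<in> K"; cases "x \<in> topspace X") (auto simp: le_max_iff_disj)
  then show thesis by (intro that[of "max B 1"]) auto
qed

text \<open>Compact support inside \<open>U\<close> is not demanded, and \<open>U\<close> may be any
  set. The same notion thus serves for open sets and for the compact carriers of truncated
  functions.\<close>

definition subunit :: "'a topology \<Rightarrow> 'a set \<Rightarrow> ('a \<Rightarrow> real) set" where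
  "subunit X U = {f \<in> C0 X. \<forall>x. 0 \<le> f x \<and> f x \<le> indicator U x}"

lemma subunitD:
  assumes "f \<in> subunit X U"
  shows "f \<in> C0 X" "0 \<le> f x" "f x \<le> 1" "x \<notin> U \<Longrightarrow> f x = 0"
proof -
  have "0 \<le> f x" "f x \<le> indicator U x" and "f \<in> C0 X" using assms by (auto simp: subunit_def)
  then show "f \<in> C0 X" "0 \<le> f x" "f x \<le> 1" "x \<notin> U \<Longrightarrow> f x = 0"
    by (cases "x \<in> U"; simp)+
qed

lemma subunitI:
  "f \<in> C0 X \<Longrightarrow> (\<And>x. 0 \<le> f x) \<Longrightarrow> (\<And>x. f x \<le> 1) \<Longrightarrow> (\<And>x. x \<notin> U \<Longrightarrow> f x = 0) \<Longrightarrow> f \<in> subunit X U"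
  by (auto simp: subunit_def indicator_def)

lemma subunit_mono: "U \<subseteq> V \<Longrightarrow> subunit X U \<subseteq> subunit X V"
  by (auto intro!: subunitI dest: subunitD)

lemma subunit_topspace: "f \<in> C0 X \<Longrightarrow> (\<And>x. 0 \<le> f x) \<Longrightarrow> (\<And>x. f x \<le> 1) \<Longrightarrow> f \<in> subunit X (topspace X)"
  by (auto intro!: subunitI dest: C0_D)

lemma subunit_zero: "(\<lambda>x. 0) \<in> subunit X U"
  by (auto intro: subunitI C0_zero)

lemma subunit_max:
  assumes "f \<in> subunit X U" "g \<in> subunit X U"
  shows "(\<lambda>x. max (f x) (g x)) \<in> subunit X U"
  using subunitD[OF assms(1)] subunitD[OF assms(2)] by (intro subunitI C0_max) (auto simp: le_max_iff_disj)

lemma subunit_add_disjoint: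
  assumes f: "f \<in> subunit X U" and g: "g \<in> subunit X V" and "U \<inter> V = {}"
  shows "(\<lambda>x. f x + g x) \<in> subunit X (U \<union> V)"
proof (rule subunitI)
  show "f x + g x \<le> 1" for x
    using subunitD(3,4)[OF f, of x] subunitD(3,4)[OF g, of x] \<open>U \<inter> V = {}\<close>
    by (cases "x \<in> U"; cases "x \<in> V") auto
qed (use subunitD[OF f] subunitD[OF g] in \<open>auto intro: C0_add\<close>)

text \<open>The sets \<open>K - U\<close> and \<open>K - V\<close> are compact and disjoint.
  Removing disjoint open neighbourhoods \<open>S\<close> and \<open>T\<close> of them from
  \<open>K\<close> leaves the two pieces. This takes the place of a partition of unity.\<close>

lemma compactin_Un_split:
  assumes H: "Hausdorff_space X" and K: "compactin X K" "K \<subseteq> U \<union> V" and U: "openin X U" and V: "openin X V"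
  obtains A B where "compactin X A" "compactin X B" "A \<subseteq> U" "B \<subseteq> V" "K = A \<union> B"
proof -
  have diff: "compactin X (K - W)" if "openin X W" for W
  proof -
    have "K - W = (topspace X - W) \<inter> K" using compactin_subset_topspace[OF K(1)] by auto
    then show ?thesis using closed_Int_compactin[OF _ K(1)] that by (metis closedin_diff closedin_topspace)
  qed
  have "disjnt (K - U) (K - V)" using K(2) by (auto simp: disjnt_def)
  then obtain S T where ST: "openin X S" "openin X T" "K - U \<subseteq> S" "K - V \<subseteq> T" "disjnt S T"
    using Hausdorff_space_compact_separation[OF H diff[OF U] diff[OF V]] by blast
  show thesis
    by (rule that[OF diff[OF ST(1)] diff[OF ST(2)]]) (use ST in \<open>auto simp: disjnt_iff\<close>)
qed

locale lc_hausdorff =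
  fixes X :: "'a topology"
  assumes lc: "locally_compact_space X" and haus: "Hausdorff_space X"
begin

text \<open>Complete regularity alone gives no control at infinity. The function is therefore made
  to vanish off \<open>V \<inter> U\<close>, where the neighbourhood \<open>V\<close> of
  \<open>K\<close> lies in a compact \<open>L\<close>; then \<open>L\<close> witnesses vanishing at
  infinity.\<close>

lemma urysohn_subunit:
  assumes K: "compactin X K" "K \<subseteq> U" and U: "openin X U"
  obtains f where "f \<in> subunit X U" "\<And>x. x \<in> K \<Longrightarrow> f x = 1"
proof -
  obtain V L where VL: "openin X V" "compactin X L" "K \<subseteq> V" "V \<subseteq> L"
    using locally_compact_space_compact_closed_compact[of X] lc haus K(1) by blast
  have "completely_regular_space X"
    using lc haus locally_compact_Hausdorff_imp_regular_space locally_compact_regular_imp_completely_regular_space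
    by blast
  moreover have "closedin X (topspace X - (V \<inter> U))" using VL(1) U by blast
  moreover have "disjnt K (topspace X - (V \<inter> U))" using K VL by (auto simp: disjnt_iff)
  ultimately obtain f where f: "continuous_map X (subtopology euclidean {0..1::real}) f"
      "f ` (topspace X - (V \<inter> U)) \<subseteq> {0}" "f ` K \<subseteq> {1}"
    using Urysohn_completely_regular_compact_closed[of 0 1 X K "topspace X - (V \<inter> U)"] K(1) by auto
  define g where "g x = (if x \<in> topspace X then f x else 0)" for x
  have g01: "0 \<le> g x" "g x \<le> 1" for x
    using f(1) by (auto simp: g_def continuous_map_in_subtopology Pi_iff)
  have g0: "g x = 0" if "x \<notin> V \<inter> U" for x using f(2) that by (auto simp: g_def)
  have "continuous_map X euclideanreal g"
    using continuous_map_eq[OF continuous_map_into_fulltopology[OF f(1)], of g] by (simp add: g_def)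
  then have "g \<in> C0 X"
    unfolding C0_def
  proof (intro CollectI conjI allI impI)
    show "g x = 0" if "x \<notin> topspace X" for x using that by (simp add: g_def)
    show "\<exists>K. compactin X K \<and> (\<forall>x\<in>topspace X - K. \<bar>g x\<bar> < \<epsilon>)" if "0 < \<epsilon>" for \<epsilon>
      using VL g0 that by (intro exI[of _ L]) fastforce
  qed
  then show thesis
    using g01 g0 f(3) compactin_subset_topspace[OF K(1)]
    by (intro that[of g] subunitI) (auto simp: g_def subset_iff)
qed

end

section \<open>Borel sets and bounded Borel functions\<close>

lemma space_borel_of [simp]: "space (borel_of X) = topspace X"
  unfolding borel_of_def by (rule space_measure_of) (auto dest: openin_subset)

lemma sets_borel_of: "sets (borel_of X) = sigma_sets (topspace X) {U. openin X U}"
  unfolding borel_of_def by (rule sets_measure_of) (auto dest: openin_subset)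

lemma openin_borel_of: "openin X U \<Longrightarrow> U \<in> sets (borel_of X)"
  by (simp add: sets_borel_of sigma_sets.Basic)

lemma closedin_borel_of: "closedin X C \<Longrightarrow> C \<in> sets (borel_of X)"
  using sets.Diff[OF sets.top[of "borel_of X"] openin_borel_of[of X "topspace X - C"]]
  by (auto simp: closedin_def double_diff)

lemma compactin_borel_of: "Hausdorff_space X \<Longrightarrow> compactin X K \<Longrightarrow> K \<in> sets (borel_of X)"
  by (rule closedin_borel_of) (rule compactin_imp_closedin)

lemma borel_of_subset_topspace: "A \<in> sets (borel_of X) \<Longrightarrow> A \<subseteq> topspace X"
  using sets.sets_into_space by fastforce

lemma continuous_map_borel_measurable:
  "continuous_map X euclideanreal f \<Longrightarrow> f \<in> borel_measurable (borel_of X)"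
proof (rule borel_measurableI)
  fix S :: "real set" assume "continuous_map X euclideanreal f" "open S"
  then have "openin X {x \<in> topspace X. f x \<in> S}" by (simp add: openin_continuous_map_preimage)
  then show "f -` S \<inter> space (borel_of X) \<in> sets (borel_of X)"
    by (auto dest!: openin_borel_of simp: vimage_def Int_def conj_commute)
qed

lemma C0_subset_bounded_borel: "C0 X \<subseteq> bounded_borel X"
proof
  fix f assume f: "f \<in> C0 X"
  obtain B where "\<And>x. \<bar>f x\<bar> \<le> B" using C0_bounded[OF f] by blast
  then show "f \<in> bounded_borel X"
    using C0_D[OF f] by (auto simp: bounded_borel_def bounded_iff intro: continuous_map_borel_measurable)
qed

lemma bounded_borel_bound:
  assumes "f \<in> bounded_borel X"
  obtains B where "0 < B" "\<And>x. \<bar>f x\<bar> \<le> B"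
proof -
  obtain B where B: "0 < B" "\<forall>x\<in>topspace X. \<bar>f x\<bar> \<le> B" and z: "\<And>x. x \<notin> topspace X \<Longrightarrow> f x = 0"
    using assms by (auto simp: bounded_borel_def bounded_pos)
  have "\<bar>f x\<bar> \<le> B" for x using B z[of x] by (cases "x \<in> topspace X") auto
  then show thesis using that B by blast
qed

lemma bounded_borelI:
  assumes "f \<in> borel_measurable (borel_of X)" "\<And>x. x \<notin> topspace X \<Longrightarrow> f x = 0" "\<And>x. \<bar>f x\<bar> \<le> B"
  shows "f \<in> bounded_borel X"
  using assms by (auto simp: bounded_borel_def bounded_iff)

lemma bounded_borelD:
  assumes "f \<in> bounded_borel X"
  shows "f \<in> borel_measurable (borel_of X)" "x \<notin> topspace X \<Longrightarrow> f x = 0"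
  using assms by (auto simp: bounded_borel_def)

lemma bounded_borel_add:
  assumes f: "f \<in> bounded_borel X" and g: "g \<in> bounded_borel X"
  shows "(\<lambda>x. f x + g x) \<in> bounded_borel X"
proof -
  obtain A B where "\<And>x. \<bar>f x\<bar> \<le> A" "\<And>x. \<bar>g x\<bar> \<le> B"
    using bounded_borel_bound[OF f] bounded_borel_bound[OF g] by metis
  then have "\<bar>f x + g x\<bar> \<le> A + B" for x by (meson abs_triangle_ineq add_mono order_trans)
  then show ?thesis using bounded_borelD[OF f] bounded_borelD[OF g] by (intro bounded_borelI) auto
qed

lemma bounded_borel_scale:
  assumes f: "f \<in> bounded_borel X"
  shows "(\<lambda>x. c * f x) \<in> bounded_borel X"
proof -
  obtain B where "\<And>x. \<bar>f x\<bar> \<le> B" using bounded_borel_bound[OF f] by metis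
  then have "\<bar>c * f x\<bar> \<le> \<bar>c\<bar> * B" for x by (simp add: abs_mult mult_left_mono)
  then show ?thesis using bounded_borelD[OF f] by (intro bounded_borelI) auto
qed

lemma bounded_borel_diff: "f \<in> bounded_borel X \<Longrightarrow> g \<in> bounded_borel X \<Longrightarrow> (\<lambda>x. f x - g x) \<in> bounded_borel X"
  using bounded_borel_add[OF _ bounded_borel_scale[of g X "- 1"]] by auto

lemma bounded_borel_indicator: "A \<in> sets (borel_of X) \<Longrightarrow> indicator A \<in> bounded_borel X"
  by (rule bounded_borelI[where B = 1])
    (auto simp: indicator_def split: if_splits dest: borel_of_subset_topspace)

lemma bounded_borel_zero: "(\<lambda>x. 0) \<in> bounded_borel X"
  by (rule bounded_borelI[where B = 0]) auto

section \<open>A Riesz representation theorem with values in a KB-space\<close>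

lemma sum_half_powers_le_1: "(\<Sum>n<N. (1/2::real) ^ Suc n) \<le> 1"
proof -
  have "(\<Sum>n<N. (1/2::real) ^ Suc n) = 1 - (1/2) ^ N" by (induction N) auto
  then show ?thesis by simp
qed

text \<open>Later \<open>\<phi> f\<close> is \<open>\<pi> f x\<close> for a fixed
  \<open>x \<ge> 0\<close>, with \<open>C * norm x\<close> in the role of \<open>C\<close>. The
  bound on unit functions makes the directed sets of values norm bounded, as the KB property
  demands.\<close>

locale kb_riesz = lc_hausdorff X for X :: "'a topology" +
  fixes \<phi> :: "('a \<Rightarrow> real) \<Rightarrow> 'e::kb_space" and C :: real
  assumes phi_add: "\<And>f g. f \<in> C0 X \<Longrightarrow> g \<in> C0 X \<Longrightarrow> \<phi> (\<lambda>x. f x + g x) = \<phi> f + \<phi> g"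
    and phi_scale: "\<And>c f. f \<in> C0 X \<Longrightarrow> \<phi> (\<lambda>x. c * f x) = c *\<^sub>R \<phi> f"
    and phi_nonneg: "\<And>f. f \<in> C0 X \<Longrightarrow> (\<And>x. 0 \<le> f x) \<Longrightarrow> 0 \<le> \<phi> f"
    and phi_bound: "\<And>f. f \<in> subunit X (topspace X) \<Longrightarrow> norm (\<phi> f) \<le> C"
begin

section \<open>Values on open sets, and tight sets\<close>

lemma phi_mono:
  assumes "f \<in> C0 X" "g \<in> C0 X" "\<And>x. f x \<le> g x"
  shows "\<phi> f \<le> \<phi> g"
  using phi_add[OF assms(1) C0_diff[OF assms(2,1)]] phi_nonneg[OF C0_diff[OF assms(2,1)]] assms(3) by simp

text \<open>The second clause stands in for leastness and says more, namely that the supremum is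
  approximated in norm. Leastness follows from it because the cone is closed.\<close>

definition open_val :: "'a set \<Rightarrow> 'e" where
  "open_val U = (SOME s. (\<forall>f\<in>subunit X U. \<phi> f \<le> s) \<and> (\<forall>\<epsilon>>0. \<exists>f\<in>subunit X U. norm (s - \<phi> f) < \<epsilon>))"

lemma subunit_bound: "f \<in> subunit X U \<Longrightarrow> norm (\<phi> f) \<le> C"
  by (rule phi_bound) (auto intro: subunit_topspace dest: subunitD)

lemma bound_nonneg: "0 \<le> C"
  using subunit_bound[OF subunit_zero] norm_ge_zero by (rule order_trans[rotated])

lemma open_val:
  shows phi_le_open_val: "f \<in> subunit X U \<Longrightarrow> \<phi> f \<le> open_val U"
    and open_val_approx: "0 < \<epsilon> \<Longrightarrow> \<exists>f\<in>subunit X U. norm (open_val U - \<phi> f) < \<epsilon>"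
proof -
  obtain s where "\<And>y. y \<in> \<phi> ` subunit X U \<Longrightarrow> y \<le> s"
      "\<And>\<epsilon>. 0 < \<epsilon> \<Longrightarrow> \<exists>y\<in>\<phi> ` subunit X U. norm (s - y) < \<epsilon>"
  proof (rule kb_directed_lub)
    show "\<phi> ` subunit X U \<noteq> {}" using subunit_zero by auto
    show "\<exists>z\<in>\<phi> ` subunit X U. x \<le> z \<and> y \<le> z" if xy: "x \<in> \<phi> ` subunit X U" "y \<in> \<phi> ` subunit X U" for x y
    proof -
      obtain f g where fg: "x = \<phi> f" "f \<in> subunit X U" "y = \<phi> g" "g \<in> subunit X U" using xy by blast
      then show ?thesis
        using subunit_max[OF fg(2,4)]
        by (intro bexI[of _ "\<phi> (\<lambda>x. max (f x) (g x))"]) (auto intro!: phi_mono C0_max dest: subunitD)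
    qed
    show "0 \<le> x" if "x \<in> \<phi> ` subunit X U" for x using that by (auto intro!: phi_nonneg dest: subunitD)
    show "bounded (\<phi> ` subunit X U)" using subunit_bound by (auto simp: bounded_iff)
  qed blast
  then have "\<exists>s. (\<forall>f\<in>subunit X U. \<phi> f \<le> s) \<and> (\<forall>\<epsilon>>0. \<exists>f\<in>subunit X U. norm (s - \<phi> f) < \<epsilon>)" by auto
  from someI_ex[OF this]
  show "f \<in> subunit X U \<Longrightarrow> \<phi> f \<le> open_val U" "0 < \<epsilon> \<Longrightarrow> \<exists>f\<in>subunit X U. norm (open_val U - \<phi> f) < \<epsilon>"
    by (auto simp: open_val_def)
qed

lemma open_val_least:
  assumes "\<And>f. f \<in> subunit X U \<Longrightarrow> \<phi> f \<le> b"
  shows "open_val U \<le> b"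
proof (rule le_if_small_perturbation)
  fix \<epsilon> :: real assume "0 < \<epsilon>"
  then obtain f where f: "f \<in> subunit X U" "norm (open_val U - \<phi> f) < \<epsilon>" using open_val_approx by blast
  then show "\<exists>r. open_val U \<le> b + r \<and> norm r < \<epsilon>"
    using assms[OF f(1)] by (intro exI[of _ "open_val U - \<phi> f"]) (simp add: algebra_simps)
qed

lemma open_val_nonneg: "0 \<le> open_val U"
  using phi_le_open_val[OF subunit_zero] phi_nonneg[OF C0_zero] by (rule order_trans[rotated]) simp

lemma open_val_mono: "U \<subseteq> V \<Longrightarrow> open_val U \<le> open_val V"
  using subunit_mono by (intro open_val_least phi_le_open_val) blast

text \<open>Truncating \<open>f\<close> to the positive part of \<open>f - \<delta>\<close> makes the support compact.\<close>

lemma open_val_approx_compact: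
  assumes "0 < \<epsilon>"
  obtains f K where "compactin X K" "K \<subseteq> U" "f \<in> subunit X K" "norm (open_val U - \<phi> f) < \<epsilon>"
proof -
  obtain f where f: "f \<in> subunit X U" "norm (open_val U - \<phi> f) < \<epsilon> / 2"
    using open_val_approx[of "\<epsilon> / 2"] assms by auto
  note fD = subunitD[OF f(1)]
  \<comment> \<open>The discarded part \<open>\<delta> * h\<close> costs at most
    \<open>\<delta> * C\<close> in norm; the \<open>+ 1\<close> covers \<open>C = 0\<close>.\<close>
  define \<delta> where "\<delta> = \<epsilon> / (2 * (C + 1))"
  have \<delta>: "0 < \<delta>" "\<delta> * C < \<epsilon> / 2" using assms bound_nonneg by (auto simp: \<delta>_def field_simps)
  define g where "g x = max (f x - \<delta>) 0" for x
  define h where "h x = min (f x / \<delta>) 1" for x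
  have gC: "g \<in> C0 X"
    unfolding g_def using \<delta> by (intro C0_compose[OF fD(1), where F = "\<lambda>y. max (y - \<delta>) 0"]) (auto intro!: continuous_intros)
  have hC: "h \<in> C0 X"
    unfolding h_def using \<delta> by (intro C0_compose[OF fD(1), where F = "\<lambda>y. min (y / \<delta>) 1"]) (auto intro!: continuous_intros)
  have h: "h \<in> subunit X (topspace X)"
    using hC fD \<delta> by (intro subunit_topspace) (auto simp: h_def)
  have "f = (\<lambda>x. g x + \<delta> * h x)" using \<delta> by (auto simp: g_def h_def fun_eq_iff field_simps min_def max_def)
  then have "\<phi> f = \<phi> g + \<delta> *\<^sub>R \<phi> h" using phi_add[OF gC C0_scale[OF hC]] phi_scale[OF hC] by metis
  then have "norm (\<phi> f - \<phi> g) = \<delta> * norm (\<phi> h)" using \<delta> by simp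
  also have "\<dots> \<le> \<delta> * C" using \<delta> subunit_bound[OF h] by (intro mult_left_mono) auto
  finally have "norm (open_val U - \<phi> g) < \<epsilon>"
    using f(2) \<delta>(2) norm_triangle_ineq[of "open_val U - \<phi> f" "\<phi> f - \<phi> g"] by simp
  moreover have "g \<in> subunit X {x \<in> topspace X. \<delta> \<le> f x}"
    using gC fD(2,3) \<delta> C0_D(2)[OF fD(1)] by (intro subunitI) (auto simp: g_def max_def add_increasing2 diff_le_eq)
  moreover have "{x \<in> topspace X. \<delta> \<le> f x} \<subseteq> U" using fD(4) \<delta> by force
  ultimately show thesis using that C0_level_compactin[OF fD(1) \<delta>(1)] by blast
qed

lemma open_val_least_compact:
  assumes "\<And>f K. compactin X K \<Longrightarrow> K \<subseteq> U \<Longrightarrow> f \<in> subunit X K \<Longrightarrow> \<phi> f \<le> b"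
  shows "open_val U \<le> b"
proof (rule le_if_small_perturbation)
  fix \<epsilon> :: real assume e: "0 < \<epsilon>"
  obtain f K where f: "compactin X K" "K \<subseteq> U" "f \<in> subunit X K" "norm (open_val U - \<phi> f) < \<epsilon>"
    by (rule open_val_approx_compact[OF e])
  then show "\<exists>r. open_val U \<le> b + r \<and> norm r < \<epsilon>"
    using assms[OF f(1-3)] by (intro exI[of _ "open_val U - \<phi> f"]) (simp add: algebra_simps)
qed

text \<open>\<open>K\<close> splits into a compact piece in \<open>U\<close> and one in
  \<open>V\<close>, and the sum of their Urysohn functions dominates every \<open>f \<le> 1\<close>
  that vanishes off \<open>K\<close>.\<close>

lemma open_val_Un_le:
  assumes U: "openin X U" and V: "openin X V"
  shows "open_val (U \<union> V) \<le> open_val U + open_val V"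
proof (rule open_val_least_compact)
  fix f K assume K: "compactin X K" "K \<subseteq> U \<union> V" and f: "f \<in> subunit X K"
  obtain A B where AB: "compactin X A" "compactin X B" "A \<subseteq> U" "B \<subseteq> V" "K = A \<union> B"
    using compactin_Un_split[OF haus K U V] by blast
  obtain g h where g: "g \<in> subunit X U" "\<And>x. x \<in> A \<Longrightarrow> g x = 1" and h: "h \<in> subunit X V" "\<And>x. x \<in> B \<Longrightarrow> h x = 1"
    using urysohn_subunit[OF AB(1,3) U] urysohn_subunit[OF AB(2,4) V] by metis
  have "f x \<le> g x + h x" for x
    using subunitD(2-4)[OF f, of x] subunitD(2-4)[OF g(1), of x] subunitD(2-4)[OF h(1), of x] g(2)[of x] h(2)[of x] AB(5)
    by (cases "x \<in> A"; cases "x \<in> B") auto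
  then have "\<phi> f \<le> \<phi> (\<lambda>x. g x + h x)"
    using f g(1) h(1) by (intro phi_mono C0_add) (auto dest: subunitD)
  also have "\<dots> = \<phi> g + \<phi> h" using g(1) h(1) by (intro phi_add) (auto dest: subunitD)
  also have "\<dots> \<le> open_val U + open_val V" by (intro add_mono phi_le_open_val g h)
  finally show "\<phi> f \<le> open_val U + open_val V" .
qed

lemma open_val_UN_le:
  assumes "finite I" "\<And>i. i \<in> I \<Longrightarrow> openin X (U i)"
  shows "open_val (\<Union>i\<in>I. U i) \<le> (\<Sum>i\<in>I. open_val (U i))"
  using assms
proof (induction I rule: finite_induct)
  case empty
  have "\<phi> f \<le> 0" if "f \<in> subunit X {}" for f
  proof -
    have "f = (\<lambda>x. 0 * f x)" using subunitD(4)[OF that] by auto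
    then have "\<phi> f = 0 *\<^sub>R \<phi> f" using phi_scale[OF subunitD(1)[OF that], of 0] by metis
    then show ?thesis by simp
  qed
  then show ?case by (simp add: open_val_least)
next
  case (insert i I)
  have "open_val (U i \<union> (\<Union>i\<in>I. U i)) \<le> open_val (U i) + open_val (\<Union>i\<in>I. U i)"
    using insert.prems by (intro open_val_Un_le) auto
  also have "\<dots> \<le> open_val (U i) + (\<Sum>i\<in>I. open_val (U i))"
    using insert by (intro add_left_mono insert.IH) auto
  finally show ?case using insert by simp
qed

text \<open>Functions carried by disjoint sets add up without exceeding \<open>1\<close>. The
  suprema are removed in turn: over \<open>g\<close> for fixed \<open>f\<close>, then over
  \<open>f\<close>.\<close>

lemma open_val_add_disjoint_le:
  assumes "U \<inter> V = {}"
  shows "open_val U + open_val V \<le> open_val (U \<union> V)"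
proof -
  have *: "\<phi> f + \<phi> g \<le> open_val (U \<union> V)" if "f \<in> subunit X U" "g \<in> subunit X V" for f g
    using phi_le_open_val[OF subunit_add_disjoint[OF that assms]] phi_add[OF subunitD(1)[OF that(1)] subunitD(1)[OF that(2)]] by simp
  have "open_val V \<le> open_val (U \<union> V) - \<phi> f" if "f \<in> subunit X U" for f
    using *[OF that] by (intro open_val_least) (simp add: algebra_simps)
  then have "open_val U \<le> open_val (U \<union> V) - open_val V"
    by (intro open_val_least) (simp add: algebra_simps)
  then show ?thesis by (simp add: algebra_simps)
qed

text \<open>If \<open>f\<close> is carried by a compact \<open>K\<close> and nearly attains the
  value of \<open>U\<close>, then \<open>\<phi> f \<le> open_val K\<close>, and superadditivity
  leaves at most \<open>open_val U - \<phi> f\<close> for \<open>U - K\<close>.\<close>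

lemma open_val_inner_regular:
  assumes "openin X U" "0 < \<epsilon>"
  obtains K where "compactin X K" "K \<subseteq> U" "norm (open_val (U - K)) < \<epsilon>"
proof -
  obtain f K where f: "compactin X K" "K \<subseteq> U" "f \<in> subunit X K" "norm (open_val U - \<phi> f) < \<epsilon>"
    by (rule open_val_approx_compact[OF \<open>0 < \<epsilon>\<close>])
  have "\<phi> f + open_val (U - K) \<le> open_val K + open_val (U - K)" by (intro add_right_mono phi_le_open_val f)
  also have "\<dots> \<le> open_val U"
    using open_val_add_disjoint_le[of K "U - K"] f(2) by (simp add: Un_absorb1)
  finally have "open_val (U - K) \<le> open_val U - \<phi> f" by (simp add: algebra_simps)
  then have "norm (open_val (U - K)) \<le> norm (open_val U - \<phi> f)"
    by (intro norm_mono_nonneg open_val_nonneg)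
  then show thesis using f that by force
qed

text \<open>The error is measured on \<open>U - K\<close>, which is open as \<open>X\<close> is
  Hausdorff. So \<open>open_val\<close> suffices, and no value on Borel sets is presupposed.\<close>

definition tight :: "'a set \<Rightarrow> bool" where
  "tight A \<longleftrightarrow> (\<forall>\<epsilon>>0. \<exists>K U. compactin X K \<and> openin X U \<and> K \<subseteq> A \<and> A \<subseteq> U \<and> norm (open_val (U - K)) < \<epsilon>)"

lemma tightE:
  assumes "tight A" "0 < \<epsilon>"
  obtains K U where "compactin X K" "openin X U" "K \<subseteq> A" "A \<subseteq> U" "norm (open_val (U - K)) < \<epsilon>"
  using assms unfolding tight_def by meson

lemma openin_diff_compactin: "openin X U \<Longrightarrow> compactin X K \<Longrightarrow> openin X (U - K)"
  by (intro openin_diff compactin_imp_closedin haus)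

lemma tight_openin: "openin X U \<Longrightarrow> tight U"
  unfolding tight_def using open_val_inner_regular[of U] by (metis order_refl)

text \<open>Complementing swaps the roles of \<open>K\<close> and \<open>U\<close>, but the
  complement of \<open>U\<close> need not be compact. It is cut down to a compact \<open>L\<close>
  that nearly exhausts the space, at the cost of a second small error.\<close>

lemma tight_compl:
  assumes "tight A"
  shows "tight (topspace X - A)"
  unfolding tight_def
proof (intro allI impI)
  fix \<epsilon> :: real assume "0 < \<epsilon>"
  then have \<epsilon>: "0 < \<epsilon> / 2" by simp
  obtain K U where KU: "compactin X K" "openin X U" "K \<subseteq> A" "A \<subseteq> U" "norm (open_val (U - K)) < \<epsilon> / 2"
    by (rule tightE[OF assms \<epsilon>])
  obtain L where L: "compactin X L" "L \<subseteq> topspace X" "norm (open_val (topspace X - L)) < \<epsilon> / 2"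
    by (rule open_val_inner_regular[OF openin_topspace \<epsilon>])
  let ?U = "topspace X - K" and ?K = "(topspace X - U) \<inter> L"
  have "open_val (?U - ?K) \<le> open_val ((U - K) \<union> (topspace X - L))" by (rule open_val_mono) auto
  also have "\<dots> \<le> open_val (U - K) + open_val (topspace X - L)"
    by (intro open_val_Un_le openin_diff_compactin KU L openin_topspace)
  finally have "norm (open_val (?U - ?K)) \<le> norm (open_val (U - K) + open_val (topspace X - L))"
    by (intro norm_mono_nonneg open_val_nonneg)
  then have "norm (open_val (?U - ?K)) < \<epsilon>" using KU(5) L(3) norm_triangle_ineq[of "open_val (U - K)"] 
    by (smt (verit) field_sum_of_halves)
  moreover have "compactin X ?K" using KU(2) by (intro closed_Int_compactin L) blast
  moreover have "openin X ?U" by (intro openin_diff_compactin KU openin_topspace)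
  ultimately show "\<exists>K U. compactin X K \<and> openin X U \<and> K \<subseteq> topspace X - A \<and> topspace X - A \<subseteq> U \<and> norm (open_val (U - K)) < \<epsilon>"
    using KU(3,4) by (intro exI[of _ ?K] exI[of _ ?U]) auto
qed

text \<open>Only finitely many compact sets may be united, so a tail has to be dropped: a compact
  \<open>L\<close> that nearly exhausts the union of the \<open>U n\<close> is covered by the first
  \<open>N\<close> of them. The result serves both for closure of tightness under countable unions
  and for countable additivity.\<close>

lemma tight_countable_cover:
  fixes A :: "nat \<Rightarrow> 'a set"
  assumes A: "\<And>n. tight (A n)" and "0 < \<epsilon>"
  obtains K U N where "\<And>n. compactin X (K n)" "\<And>n. openin X (U n)" "\<And>n. K n \<subseteq> A n" "\<And>n. A n \<subseteq> U n"
    "norm (open_val ((\<Union>n. U n) - (\<Union>n<N. K n))) < \<epsilon>"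
proof -
  \<comment> \<open>These errors sum to at most \<open>\<epsilon> / 2\<close>; the other half is for
    the part outside \<open>L\<close>.\<close>
  have "\<exists>K U. compactin X K \<and> openin X U \<and> K \<subseteq> A n \<and> A n \<subseteq> U \<and> norm (open_val (U - K)) < \<epsilon> / 2 * (1/2) ^ Suc n" for n
    by (rule A[of n, unfolded tight_def, rule_format]) (simp add: \<open>0 < \<epsilon>\<close>)
  then obtain K U where KU: "\<And>n. compactin X (K n)" "\<And>n. openin X (U n)" "\<And>n. K n \<subseteq> A n" "\<And>n. A n \<subseteq> U n"
      "\<And>n. norm (open_val (U n - K n)) < \<epsilon> / 2 * (1/2) ^ Suc n"
    by metis
  let ?W = "\<Union>n. U n"
  have W: "openin X ?W" using KU(2) by blast
  obtain L where L: "compactin X L" "L \<subseteq> ?W" "norm (open_val (?W - L)) < \<epsilon> / 2"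
    using open_val_inner_regular[OF W, of "\<epsilon> / 2"] \<open>0 < \<epsilon>\<close> by auto
  obtain \<F> where \<F>: "finite \<F>" "\<F> \<subseteq> range U" "L \<subseteq> \<Union>\<F>"
    using L(1,2) KU(2) unfolding compactin_def by (metis (no_types, lifting) rangeE)
  obtain I where I: "finite I" "\<F> = U ` I" using finite_subset_image[OF \<F>(1,2)] by blast
  obtain N where N: "I \<subseteq> {..<N}" using finite_nat_iff_bounded I(1) by blast
  have cover: "L \<subseteq> (\<Union>n<N. U n)" using \<F>(3) I N by blast
  have op: "openin X (\<Union>n<N. U n - K n)" using KU by (blast intro: openin_diff_compactin)
  \<comment> \<open>A point of \<open>?W\<close> outside the first \<open>N\<close> sets
    \<open>K n\<close> lies outside \<open>L\<close> or in some \<open>U n - K n\<close> with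
    \<open>n < N\<close>.\<close>
  have "open_val (?W - (\<Union>n<N. K n)) \<le> open_val ((?W - L) \<union> (\<Union>n<N. U n - K n))"
    using cover by (intro open_val_mono) auto
  also have "\<dots> \<le> open_val (?W - L) + open_val (\<Union>n<N. U n - K n)"
    by (intro open_val_Un_le openin_diff_compactin W L op)
  also have "\<dots> \<le> open_val (?W - L) + (\<Sum>n<N. open_val (U n - K n))"
    by (intro add_left_mono open_val_UN_le openin_diff_compactin KU) auto
  finally have "norm (open_val (?W - (\<Union>n<N. K n))) \<le> norm (open_val (?W - L) + (\<Sum>n<N. open_val (U n - K n)))"
    by (intro norm_mono_nonneg open_val_nonneg)
  also have "\<dots> \<le> norm (open_val (?W - L)) + (\<Sum>n<N. norm (open_val (U n - K n)))"
    by (intro norm_triangle_mono order_refl norm_sum)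
  also have "\<dots> \<le> norm (open_val (?W - L)) + (\<Sum>n<N. \<epsilon> / 2 * (1/2) ^ Suc n)"
    by (intro add_left_mono sum_mono less_imp_le KU)
  also have "(\<Sum>n<N. \<epsilon> / 2 * (1/2) ^ Suc n) = \<epsilon> / 2 * (\<Sum>n<N. (1/2) ^ Suc n)" by (simp only: sum_distrib_left)
  also have "\<dots> \<le> \<epsilon> / 2 * 1" using \<open>0 < \<epsilon>\<close> by (intro mult_left_mono sum_half_powers_le_1) simp
  finally have "norm (open_val (?W - (\<Union>n<N. K n))) < \<epsilon>" using L(3) by simp
  then show thesis using that KU by blast
qed

lemma tight_UN:
  fixes A :: "nat \<Rightarrow> 'a set"
  assumes "\<And>n. tight (A n)"
  shows "tight (\<Union>n. A n)"
  unfolding tight_def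
proof (intro allI impI)
  fix \<epsilon> :: real assume e: "0 < \<epsilon>"
  obtain K U N where KU: "\<And>n. compactin X (K n)" "\<And>n. openin X (U n)" "\<And>n. K n \<subseteq> A n" "\<And>n. A n \<subseteq> U n"
      "norm (open_val ((\<Union>n. U n) - (\<Union>n<N::nat. K n))) < \<epsilon>"
    by (rule tight_countable_cover[of A, OF assms e]) blast
  then have "compactin X (\<Union>n<N. K n)" by (intro compactin_Union) auto
  moreover have "openin X (\<Union>n. U n)" using KU(2) by blast
  moreover note KU(3-5)
  ultimately show "\<exists>K U. compactin X K \<and> openin X U \<and> K \<subseteq> (\<Union>n. A n) \<and> (\<Union>n. A n) \<subseteq> U \<and> norm (open_val (U - K)) < \<epsilon>"
    by (intro exI[of _ "\<Union>n<N. K n"] exI[of _ "\<Union>n. U n"] conjI UN_mono subset_UNIV)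
qed

lemma tight_borel:
  assumes "A \<in> sets (borel_of X)"
  shows "tight A"
  using assms unfolding sets_borel_of
  by (induction rule: sigma_sets.induct) (auto intro: tight_openin tight_compl tight_UN)

section \<open>The vector measure on Borel sets\<close>

definition riesz_measure :: "'a set \<Rightarrow> 'e" where
  "riesz_measure A = (SOME s. (\<forall>U. openin X U \<longrightarrow> A \<subseteq> U \<longrightarrow> s \<le> open_val U) \<and>
     (\<forall>\<epsilon>>0. \<exists>U. openin X U \<and> A \<subseteq> U \<and> norm (open_val U - s) < \<epsilon>))"

lemma riesz_measure:
  assumes "A \<subseteq> topspace X"
  shows riesz_measure_le: "openin X U \<Longrightarrow> A \<subseteq> U \<Longrightarrow> riesz_measure A \<le> open_val U"
    and riesz_measure_approx: "0 < \<epsilon> \<Longrightarrow> \<exists>U. openin X U \<and> A \<subseteq> U \<and> norm (open_val U - riesz_measure A) < \<epsilon>"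
proof -
  let ?S = "open_val ` {U. openin X U \<and> A \<subseteq> U}"
  obtain s where "\<And>y. y \<in> ?S \<Longrightarrow> s \<le> y" "\<And>\<epsilon>. 0 < \<epsilon> \<Longrightarrow> \<exists>y\<in>?S. norm (y - s) < \<epsilon>"
  proof (rule kb_directed_glb)
    show "?S \<noteq> {}" using assms by auto
    show "\<exists>z\<in>?S. z \<le> x \<and> z \<le> y" if xy: "x \<in> ?S" "y \<in> ?S" for x y
    proof -
      obtain U V where "x = open_val U" "openin X U" "A \<subseteq> U" "y = open_val V" "openin X V" "A \<subseteq> V"
        using xy by blast
      then show ?thesis by (intro bexI[of _ "open_val (U \<inter> V)"]) (auto intro!: open_val_mono)
    qed
    show "0 \<le> x" if "x \<in> ?S" for x using that open_val_nonneg by auto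
  qed blast
  then have "\<exists>s. (\<forall>U. openin X U \<longrightarrow> A \<subseteq> U \<longrightarrow> s \<le> open_val U) \<and>
     (\<forall>\<epsilon>>0. \<exists>U. openin X U \<and> A \<subseteq> U \<and> norm (open_val U - s) < \<epsilon>)" by (intro exI[of _ s]) auto
  from someI_ex[OF this]
  show "openin X U \<Longrightarrow> A \<subseteq> U \<Longrightarrow> riesz_measure A \<le> open_val U"
    "0 < \<epsilon> \<Longrightarrow> \<exists>U. openin X U \<and> A \<subseteq> U \<and> norm (open_val U - riesz_measure A) < \<epsilon>"
    by (auto simp: riesz_measure_def)
qed

lemma riesz_measure_greatest:
  assumes "A \<subseteq> topspace X" "\<And>U. openin X U \<Longrightarrow> A \<subseteq> U \<Longrightarrow> b \<le> open_val U"
  shows "b \<le> riesz_measure A"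
proof (rule le_if_small_perturbation)
  fix \<epsilon> :: real assume "0 < \<epsilon>"
  then obtain U where "openin X U" "A \<subseteq> U" "norm (open_val U - riesz_measure A) < \<epsilon>"
    using riesz_measure_approx[OF assms(1)] by blast
  then show "\<exists>r. b \<le> riesz_measure A + r \<and> norm r < \<epsilon>"
    using assms(2)[of U] by (intro exI[of _ "open_val U - riesz_measure A"]) simp
qed

lemma riesz_measure_openin: "openin X U \<Longrightarrow> riesz_measure U = open_val U"
  by (intro antisym riesz_measure_le riesz_measure_greatest open_val_mono) (auto dest: openin_subset)

lemma riesz_measure_mono: "A \<subseteq> B \<Longrightarrow> B \<subseteq> topspace X \<Longrightarrow> riesz_measure A \<le> riesz_measure B"
  by (intro riesz_measure_greatest riesz_measure_le) auto

lemma riesz_measure_nonneg: "A \<subseteq> topspace X \<Longrightarrow> 0 \<le> riesz_measure A"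
  by (intro riesz_measure_greatest open_val_nonneg)

lemma riesz_measure_Un_le:
  assumes A: "A \<subseteq> topspace X" and B: "B \<subseteq> topspace X"
  shows "riesz_measure (A \<union> B) \<le> riesz_measure A + riesz_measure B"
proof -
  have *: "riesz_measure (A \<union> B) \<le> open_val U + open_val V"
    if "openin X U" "A \<subseteq> U" "openin X V" "B \<subseteq> V" for U V
  proof -
    have "riesz_measure (A \<union> B) \<le> open_val (U \<union> V)" using that A B by (intro riesz_measure_le) auto
    also have "\<dots> \<le> open_val U + open_val V" using that by (intro open_val_Un_le)
    finally show ?thesis .
  qed
  have "riesz_measure (A \<union> B) - open_val U \<le> riesz_measure B" if "openin X U" "A \<subseteq> U" for U
    using *[OF that] by (intro riesz_measure_greatest[OF B]) (simp add: algebra_simps)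
  then have "riesz_measure (A \<union> B) - riesz_measure B \<le> riesz_measure A"
    by (intro riesz_measure_greatest[OF A]) (simp add: algebra_simps)
  then show ?thesis by (simp add: algebra_simps)
qed

text \<open>The remainder is \<open>open_val (U - K)\<close>, chosen before \<open>G\<close>. It
  allows a compact set to replace \<open>A\<close> where neighbourhoods must be separated.\<close>

lemma riesz_measure_le_compact:
  assumes "tight A" "0 < \<epsilon>"
  obtains K r where "compactin X K" "K \<subseteq> A" "norm r < \<epsilon>"
    "\<forall>G. openin X G \<longrightarrow> K \<subseteq> G \<longrightarrow> riesz_measure A \<le> open_val G + r"
proof -
  obtain K U where KU: "compactin X K" "openin X U" "K \<subseteq> A" "A \<subseteq> U" "norm (open_val (U - K)) < \<epsilon>"
    by (rule tightE[OF assms])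
  have "riesz_measure A \<le> open_val G + open_val (U - K)" if "openin X G" "K \<subseteq> G" for G
  proof -
    have op: "openin X (U - K)" using KU by (intro openin_diff_compactin)
    have "riesz_measure A \<le> open_val (G \<union> (U - K))"
      using that KU op openin_subset[OF KU(2)] by (intro riesz_measure_le) auto
    also have "\<dots> \<le> open_val G + open_val (U - K)" by (intro open_val_Un_le that op)
    finally show ?thesis .
  qed
  then show thesis using that KU by blast
qed

text \<open>Disjoint Borel sets need not have disjoint open neighbourhoods, but compact sets
  \<open>K \<subseteq> A\<close> and \<open>L \<subseteq> B\<close> do. Superadditivity for these
  neighbourhoods, cut down to \<open>W\<close>, gives the harder inequality up to two small
  remainders.\<close>

lemma riesz_measure_Un_disjoint:
  assumes A: "A \<in> sets (borel_of X)" and B: "B \<in> sets (borel_of X)" and AB: "A \<inter> B = {}"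
  shows "riesz_measure (A \<union> B) = riesz_measure A + riesz_measure B"
proof (rule antisym)
  note top = borel_of_subset_topspace[OF A] borel_of_subset_topspace[OF B]
  show "riesz_measure (A \<union> B) \<le> riesz_measure A + riesz_measure B" by (rule riesz_measure_Un_le[OF top])
  show "riesz_measure A + riesz_measure B \<le> riesz_measure (A \<union> B)"
  proof (rule riesz_measure_greatest)
    fix W assume W: "openin X W" "A \<union> B \<subseteq> W"
    show "riesz_measure A + riesz_measure B \<le> open_val W"
    proof (rule le_if_small_perturbation)
      fix \<epsilon> :: real assume "0 < \<epsilon>"
      then have e: "0 < \<epsilon> / 2" by simp
      obtain K r where K: "compactin X K" "K \<subseteq> A" "norm r < \<epsilon> / 2"
          "\<forall>G. openin X G \<longrightarrow> K \<subseteq> G \<longrightarrow> riesz_measure A \<le> open_val G + r"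
        by (rule riesz_measure_le_compact[OF tight_borel[OF A] e])
      obtain L s where L: "compactin X L" "L \<subseteq> B" "norm s < \<epsilon> / 2"
          "\<forall>G. openin X G \<longrightarrow> L \<subseteq> G \<longrightarrow> riesz_measure B \<le> open_val G + s"
        by (rule riesz_measure_le_compact[OF tight_borel[OF B] e])
      have "disjnt K L" using AB K(2) L(2) by (auto simp: disjnt_def)
      then obtain S T where ST: "openin X S" "openin X T" "K \<subseteq> S" "L \<subseteq> T" "disjnt S T"
        by (rule Hausdorff_space_compact_separation[OF haus K(1) L(1)])
      have "riesz_measure A + riesz_measure B \<le> (open_val (S \<inter> W) + r) + (open_val (T \<inter> W) + s)"
        using ST W K L by (intro add_mono K(4)[rule_format] L(4)[rule_format]) auto
      also have "\<dots> = (open_val (S \<inter> W) + open_val (T \<inter> W)) + (r + s)" by (simp add: algebra_simps)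
      also have "\<dots> \<le> open_val (S \<inter> W \<union> T \<inter> W) + (r + s)"
        using ST(5) by (intro add_right_mono open_val_add_disjoint_le) (auto simp: disjnt_def)
      also have "\<dots> \<le> open_val W + (r + s)" by (intro add_right_mono open_val_mono) auto
      finally show "\<exists>r. riesz_measure A + riesz_measure B \<le> open_val W + r \<and> norm r < \<epsilon>"
        using K(3) L(3) norm_triangle_ineq[of r s] by (intro exI[of _ "r + s"]) auto
    qed
  qed (use top in auto)
qed

lemma riesz_measure_diff:
  assumes "A \<in> sets (borel_of X)" "B \<in> sets (borel_of X)" "B \<subseteq> A"
  shows "riesz_measure (A - B) = riesz_measure A - riesz_measure B"
  using riesz_measure_Un_disjoint[of "A - B" B] assms by (simp add: Un_absorb2 Diff_disjoint Int_commute)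

lemma riesz_measure_empty: "riesz_measure {} = 0"
  using riesz_measure_Un_disjoint[of "{}" "{}"] by simp

lemma riesz_measure_finite_UN:
  assumes "\<And>n. A n \<in> sets (borel_of X)" "disjoint_family A"
  shows "riesz_measure (\<Union>n<N::nat. A n) = (\<Sum>n<N. riesz_measure (A n))"
proof (induction N)
  case 0
  show ?case by (simp add: riesz_measure_empty)
next
  case (Suc N)
  have "A N \<inter> A n = {}" if "n < N" for n using disjoint_family_onD[OF assms(2), of N n] that by simp
  then have "A N \<inter> (\<Union>n<N. A n) = {}" by blast
  then show ?case
    using riesz_measure_Un_disjoint[of "A N" "\<Union>n<N. A n"] assms(1) Suc.IH by (simp add: lessThan_Suc add.commute)
qed

text \<open>What remains after \<open>N\<close> or more terms lies in the open set of small value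
  from \<open>tight_countable_cover\<close>, and the lattice norm bounds it.\<close>

lemma riesz_measure_sums:
  assumes A: "\<And>n. A n \<in> sets (borel_of X)" and disj: "disjoint_family A"
  shows "(\<lambda>n. riesz_measure (A n)) sums riesz_measure (\<Union>n. A n)"
  unfolding sums_def
proof (rule LIMSEQ_I)
  fix \<epsilon> :: real assume e: "0 < \<epsilon>"
  obtain K U N where KU: "\<And>n. compactin X (K n)" "\<And>n. openin X (U n)" "\<And>n. K n \<subseteq> A n" "\<And>n. A n \<subseteq> U n"
      "norm (open_val ((\<Union>n. U n) - (\<Union>n<N::nat. K n))) < \<epsilon>"
    by (rule tight_countable_cover[of A, OF tight_borel[OF A] e]) blast
  have op: "openin X ((\<Union>n. U n) - (\<Union>n<N. K n))"
    using KU(1,2) by (intro openin_diff_compactin compactin_Union) auto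
  have "norm ((\<Sum>n<M. riesz_measure (A n)) - riesz_measure (\<Union>n. A n)) < \<epsilon>" if "N \<le> M" for M
  proof -
    have sub: "(\<Union>n. A n) - (\<Union>n<M. A n) \<subseteq> (\<Union>n. U n) - (\<Union>n<N. K n)"
    proof -
      have "(\<Union>n<N. K n) \<subseteq> (\<Union>n<M. A n)" using KU(3) that by fastforce
      then show ?thesis using KU(4) by blast
    qed
    have "norm ((\<Sum>n<M. riesz_measure (A n)) - riesz_measure (\<Union>n. A n)) = norm (riesz_measure (\<Union>n. A n) - riesz_measure (\<Union>n<M. A n))"
      by (simp add: riesz_measure_finite_UN[OF A disj] norm_minus_commute)
    also have "riesz_measure (\<Union>n. A n) - riesz_measure (\<Union>n<M. A n) = riesz_measure ((\<Union>n. A n) - (\<Union>n<M. A n))"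
      using A by (intro riesz_measure_diff[symmetric]) auto
    also have "norm \<dots> \<le> norm (open_val ((\<Union>n. U n) - (\<Union>n<N. K n)))"
      using sub op openin_subset[OF op] by (intro norm_mono_nonneg riesz_measure_nonneg riesz_measure_le) auto
    finally show ?thesis using KU(5) by simp
  qed
  then show "\<exists>N. \<forall>M\<ge>N. norm ((\<Sum>n<M. riesz_measure (A n)) - riesz_measure (\<Union>n. A n)) < \<epsilon>" by blast
qed

lemma riesz_measure_regular:
  assumes "A \<in> sets (borel_of X)" "0 < \<epsilon>"
  obtains K U where "compactin X K" "openin X U" "K \<subseteq> A" "A \<subseteq> U" "norm (riesz_measure (U - K)) < \<epsilon>"
  using tightE[OF tight_borel[OF assms(1)] assms(2)] by (metis openin_diff_compactin riesz_measure_openin)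

end

section \<open>The representation generated by a spectral measure\<close>

lemma positive_operatorD:
  assumes "positive_operator T"
  shows "0 \<le> x \<Longrightarrow> 0 \<le> T x" "linear T"
  using assms by (auto simp: positive_operator_def)

lemma positive_operator_mono:
  assumes "positive_operator T" "x \<le> y"
  shows "T x \<le> T y"
  using positive_operatorD(1)[OF assms(1), of "y - x"] assms(2)
  by (simp add: linear_diff[OF positive_operatorD(2)[OF assms(1)]])

lemma positive_operator_blinfunI:
  fixes T :: "'e::banach_lattice \<Rightarrow>\<^sub>L 'e"
  shows "(\<And>x. 0 \<le> x \<Longrightarrow> 0 \<le> blinfun_apply T x) \<Longrightarrow> positive_operator (blinfun_apply T)"
  by (simp add: positive_operator_def bounded_linear.linear[OF blinfun.bounded_linear_right])

lemma abs_positive_operator_le: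
  assumes "positive_operator T"
  shows "\<bar>T x\<bar> \<le> T \<bar>x\<bar>"
proof (rule abs_leI)
  show "T x \<le> T \<bar>x\<bar>" by (intro positive_operator_mono[OF assms] abs_ge_self)
  have "T (- x) \<le> T \<bar>x\<bar>" by (intro positive_operator_mono[OF assms] abs_ge_minus_self)
  then show "- T x \<le> T \<bar>x\<bar>" by (simp add: linear_neg[OF positive_operatorD(2)[OF assms]])
qed

lemma linear_map_onD:
  assumes "linear_map_on A \<rho>"
  shows "f \<in> A \<Longrightarrow> g \<in> A \<Longrightarrow> \<rho> (\<lambda>x. f x + g x) = \<rho> f + \<rho> g"
    and "f \<in> A \<Longrightarrow> \<rho> (\<lambda>x. c * f x) = c *\<^sub>R \<rho> f"
  using assms by (auto simp: linear_map_on_def)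

lemma linear_map_on_sum:
  assumes lin: "linear_map_on A \<rho>" and zero: "(\<lambda>x. 0) \<in> A"
    and add: "\<And>f g. f \<in> A \<Longrightarrow> g \<in> A \<Longrightarrow> (\<lambda>x. f x + g x) \<in> A"
    and f: "\<And>i. i \<in> I \<Longrightarrow> f i \<in> A"
  shows "\<rho> (\<lambda>x. \<Sum>i\<in>I. f i x) = (\<Sum>i\<in>I. \<rho> (f i))"
proof -
  have z: "\<rho> (\<lambda>x. 0) = 0"
    using linear_map_onD(2)[OF lin zero, of 0] by simp
  have "(\<lambda>x. \<Sum>i\<in>I. f i x) \<in> A \<and> \<rho> (\<lambda>x. \<Sum>i\<in>I. f i x) = (\<Sum>i\<in>I. \<rho> (f i))"
    using f
  proof (induction I rule: infinite_finite_induct)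
    case (insert i I)
    then show ?case
      using linear_map_onD(1)[OF lin, of "f i" "\<lambda>x. \<Sum>i\<in>I. f i x"] add[of "f i" "\<lambda>x. \<Sum>i\<in>I. f i x"] by simp
  qed (auto simp: z zero)
  then show ?thesis ..
qed

locale spectral =
  fixes X :: "'a topology" and P :: "'a set \<Rightarrow> ('e::banach_lattice \<Rightarrow>\<^sub>L 'e)"
  assumes psm: "positive_spectral_measure X P"
begin

abbreviation \<B> where "\<B> \<equiv> sets (borel_of X)"

lemma P_pos: "A \<in> \<B> \<Longrightarrow> positive_operator (blinfun_apply (P A))"
  and P_empty: "P {} = 0"
  and P_sums: "range D \<subseteq> \<B> \<Longrightarrow> disjoint_family D \<Longrightarrow>
    (\<lambda>n. blinfun_apply (P (D n)) x) sums blinfun_apply (P (\<Union>n::nat. D n)) x"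
  using psm by (auto simp: positive_spectral_measure_def)

lemma P_Un:
  assumes "A \<in> \<B>" "B \<in> \<B>" "A \<inter> B = {}"
  shows "P (A \<union> B) = P A + P B"
proof (rule blinfun_eqI)
  fix x
  have "range (binaryset A B) \<subseteq> \<B>" using assms by (simp add: range_binaryset_eq)
  moreover have "disjoint_family (binaryset A B)"
    using assms(3) by (auto simp: disjoint_family_on_def binaryset_def)
  ultimately have "(\<lambda>n. blinfun_apply (P (binaryset A B n)) x) sums blinfun_apply (P (A \<union> B)) x"
    using P_sums[of "binaryset A B" x] by (simp add: UN_binaryset_eq)
  moreover have "(\<lambda>n. blinfun_apply (P (binaryset A B n)) x) sums (blinfun_apply (P A) x + blinfun_apply (P B) x)"
    by (rule binaryset_sums[where f = "\<lambda>A. blinfun_apply (P A) x"]) (simp add: P_empty)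
  ultimately show "blinfun_apply (P (A \<union> B)) x = blinfun_apply (P A + P B) x"
    by (simp add: sums_unique2 blinfun.add_left)
qed

lemma P_finite_UN:
  "finite I \<Longrightarrow> (\<And>i. i \<in> I \<Longrightarrow> A i \<in> \<B>) \<Longrightarrow> disjoint_family_on A I \<Longrightarrow> P (\<Union>i\<in>I. A i) = (\<Sum>i\<in>I. P (A i))"
proof (induction I rule: finite_induct)
  case empty
  show ?case by (simp add: P_empty)
next
  case (insert i I)
  have "A i \<inter> (\<Union>i\<in>I. A i) = {}" using insert by (fastforce simp: disjoint_family_on_def)
  moreover have "(\<Union>i\<in>I. A i) \<in> \<B>" using insert by (intro sets.finite_UN) auto
  moreover have "P (\<Union>i\<in>I. A i) = (\<Sum>i\<in>I. P (A i))"
    using insert by (intro insert.IH) (auto simp: disjoint_family_on_def)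
  ultimately show ?case using P_Un[of "A i" "\<Union>i\<in>I. A i"] insert by simp
qed

section \<open>Integrals of simple functions and of their uniform limits\<close>

definition simple_fun :: "('a \<Rightarrow> real) \<Rightarrow> bool" where
  "simple_fun f \<longleftrightarrow> f \<in> bounded_borel X \<and> finite (f ` topspace X)"

text \<open>The index type is arbitrary, so that the level sets of the pair
  \<open>(f x, g x)\<close> give the common refinement of two partitions.\<close>

definition level :: "('a \<Rightarrow> 'i) \<Rightarrow> 'i \<Rightarrow> 'a set" where
  "level h i = {x \<in> topspace X. h x = i}"

definition simple_int :: "('a \<Rightarrow> real) \<Rightarrow> ('e \<Rightarrow>\<^sub>L 'e)" where
  "simple_int f = (\<Sum>c\<in>f ` topspace X. c *\<^sub>R P (level f c))"

lemma level_borel: "f \<in> bounded_borel X \<Longrightarrow> level f c \<in> \<B>"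
  using measurable_sets[OF bounded_borelD(1), of f X "{c}"]
  by (simp add: level_def vimage_def Int_def conj_commute)

lemma level_disjoint: "disjoint_family_on (level h) I"
  by (auto simp: disjoint_family_on_def level_def)

text \<open>Each level set of \<open>f\<close> is a union of level sets of \<open>h\<close>, so
  finite additivity regroups the sum; values that are not attained contribute empty level sets. In
  this way integrals of different functions are computed on one partition.\<close>

lemma simple_int_partition:
  assumes I: "finite I" "h ` topspace X \<subseteq> I" and lev: "\<And>i. i \<in> I \<Longrightarrow> level h i \<in> \<B>"
    and f: "\<And>x. x \<in> topspace X \<Longrightarrow> f x = F (h x)"
  shows "simple_int f = (\<Sum>i\<in>I. F i *\<^sub>R P (level h i))"
proof -
  have sub: "f ` topspace X \<subseteq> F ` I" using I(2) f by auto
  have lev_f: "level f c = (\<Union>i\<in>{i\<in>I. F i = c}. level h i)" for c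
    using I(2) f by (auto simp: level_def)
  have "simple_int f = (\<Sum>c\<in>F ` I. c *\<^sub>R P (level f c))"
    unfolding simple_int_def
  proof (rule sum.mono_neutral_left)
    show "\<forall>c\<in>F ` I - f ` topspace X. c *\<^sub>R P (level f c) = 0"
    proof
      fix c assume "c \<in> F ` I - f ` topspace X"
      then have "level f c = {}" unfolding level_def by blast
      then show "c *\<^sub>R P (level f c) = 0" by (simp add: P_empty)
    qed
  qed (use I sub in auto)
  also have "\<dots> = (\<Sum>c\<in>F ` I. \<Sum>i\<in>{i\<in>I. F i = c}. F i *\<^sub>R P (level h i))"
  proof (rule sum.cong[OF refl])
    fix c
    have "P (level f c) = (\<Sum>i\<in>{i\<in>I. F i = c}. P (level h i))"
      unfolding lev_f using I lev by (intro P_finite_UN level_disjoint) auto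
    then show "c *\<^sub>R P (level f c) = (\<Sum>i\<in>{i\<in>I. F i = c}. F i *\<^sub>R P (level h i))"
      by (simp add: scaleR_sum_right)
  qed
  also have "\<dots> = (\<Sum>i\<in>I. F i *\<^sub>R P (level h i))" using I by (intro sum.group) auto
  finally show ?thesis .
qed

lemma simple_int_joint:
  assumes f: "simple_fun f" and g: "simple_fun g" and h: "\<And>x. x \<in> topspace X \<Longrightarrow> h x = F (f x, g x)"
  shows "simple_int h = (\<Sum>p\<in>f ` topspace X \<times> g ` topspace X. F p *\<^sub>R P (level f (fst p) \<inter> level g (snd p)))"
proof -
  have eq: "level (\<lambda>x. (f x, g x)) p = level f (fst p) \<inter> level g (snd p)" for p
    by (auto simp: level_def)
  show ?thesis unfolding eq[symmetric]
    by (rule simple_int_partition) (use f g h in \<open>auto simp: simple_fun_def eq level_borel\<close>)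
qed

lemma simple_int_add:
  assumes f: "simple_fun f" and g: "simple_fun g"
  shows "simple_int (\<lambda>x. f x + g x) = simple_int f + simple_int g"
  using simple_int_joint[OF f g, of "\<lambda>x. f x + g x" "\<lambda>p. fst p + snd p"]
    simple_int_joint[OF f g, of f fst] simple_int_joint[OF f g, of g snd]
  by (simp add: scaleR_left_distrib sum.distrib)

lemma simple_int_scale:
  assumes f: "simple_fun f"
  shows "simple_int (\<lambda>x. c * f x) = c *\<^sub>R simple_int f"
proof -
  have "simple_int (\<lambda>x. c * f x) = (\<Sum>i\<in>f ` topspace X. (c * i) *\<^sub>R P (level f i))"
    by (rule simple_int_partition) (use f in \<open>auto simp: simple_fun_def level_borel\<close>)
  then show ?thesis by (simp add: simple_int_def scaleR_sum_right)
qed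

lemma simple_fun_add: "simple_fun f \<Longrightarrow> simple_fun g \<Longrightarrow> simple_fun (\<lambda>x. f x + g x)"
  unfolding simple_fun_def
  by (auto intro: bounded_borel_add finite_subset[of _ "(\<lambda>(a, b). a + b) ` (f ` topspace X \<times> g ` topspace X)"])

lemma simple_fun_scale: "simple_fun f \<Longrightarrow> simple_fun (\<lambda>x. c * f x)"
  unfolding simple_fun_def
  by (auto intro: bounded_borel_scale finite_subset[of _ "(\<lambda>a. c * a) ` f ` topspace X"])

lemma simple_fun_indicator: "A \<in> \<B> \<Longrightarrow> simple_fun (indicator A)"
  unfolding simple_fun_def
  by (auto intro: bounded_borel_indicator finite_subset[of _ "{0, 1}"] simp: indicator_def)

lemma simple_int_indicator:
  assumes "A \<in> \<B>"
  shows "simple_int (indicator A) = P A"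
proof -
  \<comment> \<open>Partitioning by truth value avoids a case split on whether \<open>A\<close> or
    its complement is empty.\<close>
  have lev: "level (\<lambda>x. x \<in> A) i = (if i then A else topspace X - A)" for i
    using borel_of_subset_topspace[OF assms] by (auto simp: level_def)
  have "simple_int (indicator A) = (\<Sum>i\<in>UNIV. of_bool i *\<^sub>R P (level (\<lambda>x. x \<in> A) i))"
    using assms sets.Diff[OF sets.top[of "borel_of X"] assms]
    by (intro simple_int_partition) (auto simp: lev indicator_def)
  then show ?thesis by (simp add: UNIV_bool lev)
qed

lemma simple_int_nonneg:
  assumes "simple_fun f" "\<And>x. 0 \<le> f x" "0 \<le> y"
  shows "0 \<le> blinfun_apply (simple_int f) y"
  unfolding simple_int_def blinfun.sum_left blinfun.scaleR_left
  using assms by (intro sum_nonneg scaleR_nonneg_nonneg positive_operatorD(1)[OF P_pos[OF level_borel]])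
    (auto simp: simple_fun_def)

text \<open>A triangle inequality for the norms would count the level sets. Taking the modulus in
  the lattice first bounds the sum by \<open>s *\<^sub>R P (topspace X) \<bar>y\<bar>\<close>,
  because the positive operators at the levels add up to \<open>P (topspace X)\<close>.\<close>

lemma norm_simple_int_le:
  assumes f: "simple_fun f" and s: "\<And>x. \<bar>f x\<bar> \<le> s"
  shows "norm (simple_int f) \<le> s * norm (P (topspace X))"
proof (rule norm_blinfun_bound)
  have "0 \<le> s" using s[of undefined] by linarith
  then show "0 \<le> s * norm (P (topspace X))" by simp
  fix y
  have fin: "finite (f ` topspace X)" and lev: "level f c \<in> \<B>" for c
    using f by (auto simp: simple_fun_def level_borel)
  have top: "P (topspace X) = (\<Sum>c\<in>f ` topspace X. P (level f c))"
  proof -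
    have "(\<Union>c\<in>f ` topspace X. level f c) = topspace X" by (auto simp: level_def)
    then show ?thesis using P_finite_UN[OF fin lev level_disjoint] by simp
  qed
  have "\<bar>blinfun_apply (simple_int f) y\<bar> \<le> (\<Sum>c\<in>f ` topspace X. \<bar>c *\<^sub>R blinfun_apply (P (level f c)) y\<bar>)"
    unfolding simple_int_def blinfun.sum_left blinfun.scaleR_left by (rule sum_abs)
  also have "\<dots> \<le> (\<Sum>c\<in>f ` topspace X. s *\<^sub>R blinfun_apply (P (level f c)) \<bar>y\<bar>)"
  proof (rule sum_mono)
    fix c assume c: "c \<in> f ` topspace X"
    let ?z = "blinfun_apply (P (level f c)) \<bar>y\<bar>"
    have z: "\<bar>blinfun_apply (P (level f c)) y\<bar> \<le> ?z" by (rule abs_positive_operator_le[OF P_pos[OF lev]])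
    have nz: "0 \<le> ?z" by (rule positive_operatorD(1)[OF P_pos[OF lev]]) simp
    have "\<bar>c\<bar> \<le> s" using c s by auto
    have *: "d *\<^sub>R blinfun_apply (P (level f c)) w \<le> s *\<^sub>R ?z"
      if "0 \<le> d" "d \<le> s" "blinfun_apply (P (level f c)) w \<le> ?z" for d w
      by (rule order_trans[OF scaleR_left_mono[OF that(3,1)] scaleR_right_mono[OF that(2) nz]])
    have le: "blinfun_apply (P (level f c)) y \<le> ?z" "blinfun_apply (P (level f c)) (- y) \<le> ?z"
      using z by (auto simp: abs_le_iff blinfun.minus_right)
    show "\<bar>c *\<^sub>R blinfun_apply (P (level f c)) y\<bar> \<le> s *\<^sub>R ?z"
      using *[of "\<bar>c\<bar>" y] *[of "\<bar>c\<bar>" "- y"] le \<open>\<bar>c\<bar> \<le> s\<close>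
      by (intro abs_leI) (cases "0 \<le> c"; simp add: blinfun.minus_right)+
  qed
  also have "\<dots> = s *\<^sub>R blinfun_apply (P (topspace X)) \<bar>y\<bar>"
    by (simp add: top blinfun.sum_left scaleR_sum_right)
  finally have "norm (blinfun_apply (simple_int f) y) \<le> norm (s *\<^sub>R blinfun_apply (P (topspace X)) \<bar>y\<bar>)"
    by (intro norm_lattice_mono) (meson abs_ge_self order_trans)
  also have "\<dots> \<le> s * (norm (P (topspace X)) * norm y)"
    using norm_blinfun[of "P (topspace X)" "\<bar>y\<bar>"] \<open>0 \<le> s\<close> by (simp add: mult_left_mono)
  finally show "norm (blinfun_apply (simple_int f) y) \<le> s * norm (P (topspace X)) * norm y" by (simp add: mult.assoc)
qed

lemma simple_int_dist:
  assumes f: "simple_fun f" and g: "simple_fun g" and s: "\<And>x. \<bar>f x - g x\<bar> \<le> s"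
  shows "norm (simple_int f - simple_int g) \<le> s * norm (P (topspace X))"
proof -
  have "simple_int (\<lambda>x. f x + - 1 * g x) = simple_int f - simple_int g"
    using simple_int_add[OF f simple_fun_scale[OF g, of "- 1"]] simple_int_scale[OF g, of "- 1"] by simp
  then show ?thesis
    using norm_simple_int_le[OF simple_fun_add[OF f simple_fun_scale[OF g, of "- 1"]], of s] s by simp
qed

text \<open>Rounding down to multiples of \<open>1 / (n + 1)\<close>: the error is uniform, a
  bounded function takes finitely many values, and both nonnegativity and the value \<open>0\<close>
  off the carrier survive.\<close>

definition step_approx :: "nat \<Rightarrow> ('a \<Rightarrow> real) \<Rightarrow> 'a \<Rightarrow> real" where
  "step_approx n f x = of_int \<lfloor>real (Suc n) * f x\<rfloor> / real (Suc n)"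

lemma step_approx_dist: "\<bar>f x - step_approx n f x\<bar> \<le> 1 / real (Suc n)"
proof -
  have "f x - step_approx n f x = frac (real (Suc n) * f x) / real (Suc n)"
    by (simp add: step_approx_def frac_def diff_divide_distrib del: of_nat_Suc)
  moreover have "\<bar>frac (real (Suc n) * f x) / real (Suc n)\<bar> \<le> 1 / real (Suc n)"
    using frac_lt_1[of "real (Suc n) * f x"] frac_ge_0[of "real (Suc n) * f x"]
    by (simp add: divide_le_cancel del: of_nat_Suc)
  ultimately show ?thesis by simp
qed

lemma simple_fun_step_approx:
  assumes f: "f \<in> bounded_borel X"
  shows "simple_fun (step_approx n f)"
  unfolding simple_fun_def
proof
  obtain B where B: "\<And>x. \<bar>f x\<bar> \<le> B" using bounded_borel_bound[OF f] by blast
  show "step_approx n f \<in> bounded_borel X"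
  proof (rule bounded_borelI)
    show "step_approx n f \<in> borel_measurable (borel_of X)"
      using bounded_borelD(1)[OF f] unfolding step_approx_def by measurable
    show "step_approx n f x = 0" if "x \<notin> topspace X" for x
      using bounded_borelD(2)[OF f that] by (simp add: step_approx_def)
    show "\<bar>step_approx n f x\<bar> \<le> B + 1 / real (Suc n)" for x
      using B[of x] step_approx_dist[of f x n] by linarith
  qed
  have "step_approx n f x \<in> (\<lambda>k. of_int k / real (Suc n)) ` {\<lfloor>real (Suc n) * - B\<rfloor>..\<lfloor>real (Suc n) * B\<rfloor>}" for x
  proof -
    have "real (Suc n) * - B \<le> real (Suc n) * f x" "real (Suc n) * f x \<le> real (Suc n) * B"
      using B[of x] by (intro mult_left_mono; simp add: abs_le_iff)+
    then show ?thesis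
      unfolding step_approx_def by (intro imageI) (auto intro: floor_mono)
  qed
  then have "step_approx n f ` topspace X \<subseteq> (\<lambda>k. of_int k / real (Suc n)) ` {\<lfloor>real (Suc n) * - B\<rfloor>..\<lfloor>real (Suc n) * B\<rfloor>}"
    by blast
  then show "finite (step_approx n f ` topspace X)"
    by (rule finite_subset) (intro finite_imageI finite_atLeastAtMost_int)
qed

text \<open>The value \<open>undefined\<close> off \<open>bounded_borel X\<close> makes the map
  extensional, as \<open>generated_representation\<close> demands.\<close>

definition spectral_int :: "('a \<Rightarrow> real) \<Rightarrow> ('e \<Rightarrow>\<^sub>L 'e)" where
  "spectral_int f = (if f \<in> bounded_borel X then lim (\<lambda>n. simple_int (step_approx n f)) else undefined)"

lemma simple_int_step_approx_tendsto:
  assumes f: "f \<in> bounded_borel X"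
  shows "(\<lambda>n. simple_int (step_approx n f)) \<longlonglongrightarrow> spectral_int f"
proof -
  let ?c = "norm (P (topspace X))"
  have bnd: "norm (simple_int (step_approx m f) - simple_int (step_approx n f)) \<le> (1 / real (Suc m) + 1 / real (Suc n)) * ?c" for m n
  proof (rule simple_int_dist[OF simple_fun_step_approx[OF f] simple_fun_step_approx[OF f]])
    show "\<bar>step_approx m f x - step_approx n f x\<bar> \<le> 1 / real (Suc m) + 1 / real (Suc n)" for x
      using step_approx_dist[of f x m] step_approx_dist[of f x n] by linarith
  qed
  have "Cauchy (\<lambda>n. simple_int (step_approx n f))"
  proof (rule CauchyI)
    fix e :: real assume "0 < e"
    then have "0 < e / (2 * (?c + 1))" by (simp add: add_nonneg_pos)
    then obtain N where N: "inverse (real (Suc N)) < e / (2 * (?c + 1))" using reals_Archimedean by blast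
    have "norm (simple_int (step_approx m f) - simple_int (step_approx n f)) < e" if "N \<le> m" "N \<le> n" for m n
    proof -
      have "1 / real (Suc m) \<le> inverse (real (Suc N))" "1 / real (Suc n) \<le> inverse (real (Suc N))"
        using that by (auto simp: inverse_eq_divide frac_le)
      then have "1 / real (Suc m) + 1 / real (Suc n) \<le> e / (2 * (?c + 1)) + e / (2 * (?c + 1))"
        using less_imp_le[OF N] by (intro add_mono) (blast intro: order_trans)+
      also have "e / (2 * k) + e / (2 * k) = e / k" for k :: real by (cases "k = 0") (auto simp: field_simps)
      finally have "1 / real (Suc m) + 1 / real (Suc n) \<le> e / (?c + 1)" .
      then have "(1 / real (Suc m) + 1 / real (Suc n)) * ?c \<le> e / (?c + 1) * ?c" by (intro mult_right_mono) auto
      also have "e / (k + 1) * k < e" if "0 \<le> k" for k :: real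
        using \<open>0 < e\<close> that by (simp add: pos_divide_less_eq algebra_simps)
      finally show ?thesis using bnd[of m n] by fastforce
    qed
    then show "\<exists>M. \<forall>m\<ge>M. \<forall>n\<ge>M. norm (simple_int (step_approx m f) - simple_int (step_approx n f)) < e" by blast
  qed
  then show ?thesis using f by (simp add: spectral_int_def Cauchy_convergent_iff convergent_LIMSEQ_iff)
qed

lemma spectral_int_dist:
  assumes f: "f \<in> bounded_borel X" and g: "simple_fun g" and s: "\<And>x. \<bar>f x - g x\<bar> \<le> s"
  shows "norm (spectral_int f - simple_int g) \<le> s * norm (P (topspace X))"
proof (rule LIMSEQ_le)
  show "(\<lambda>n. norm (simple_int (step_approx n f) - simple_int g)) \<longlonglongrightarrow> norm (spectral_int f - simple_int g)"
    by (intro tendsto_intros simple_int_step_approx_tendsto f)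
  have "(\<lambda>n. (s + 1 / real (Suc n)) * norm (P (topspace X))) \<longlonglongrightarrow> (s + 0) * norm (P (topspace X))"
    by (intro tendsto_intros LIMSEQ_Suc[OF lim_1_over_n])
  then show "(\<lambda>n. (s + 1 / real (Suc n)) * norm (P (topspace X))) \<longlonglongrightarrow> s * norm (P (topspace X))" by simp
  have "norm (simple_int (step_approx n f) - simple_int g) \<le> (s + 1 / real (Suc n)) * norm (P (topspace X))" for n
  proof (rule simple_int_dist[OF simple_fun_step_approx[OF f] g])
    show "\<bar>step_approx n f x - g x\<bar> \<le> s + 1 / real (Suc n)" for x
      using step_approx_dist[of f x n] s[of x] by linarith
  qed
  then show "\<exists>N. \<forall>n\<ge>N. norm (simple_int (step_approx n f) - simple_int g) \<le> (s + 1 / real (Suc n)) * norm (P (topspace X))"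
    by blast
qed

text \<open>The step approximation of a sum is not the sum of the step approximations. Linearity
  therefore needs the integral as a limit along other simple functions with uniform error of order
  \<open>1 / n\<close>.\<close>

lemma spectral_int_eqI:
  assumes f: "f \<in> bounded_borel X" and g: "\<And>n. simple_fun (g n)"
    and d: "\<And>n x. \<bar>f x - g n x\<bar> \<le> c / real (Suc n)" and lim: "(\<lambda>n. simple_int (g n)) \<longlonglongrightarrow> T"
  shows "spectral_int f = T"
proof -
  have "(\<lambda>n. c / real (Suc n) * norm (P (topspace X))) \<longlonglongrightarrow> 0"
    using tendsto_mult[OF tendsto_mult[OF tendsto_const[of c] LIMSEQ_Suc[OF lim_1_over_n]] tendsto_const] by simp
  then have "(\<lambda>n. spectral_int f - simple_int (g n)) \<longlonglongrightarrow> 0"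
    by (rule Lim_null_comparison[rotated]) (intro always_eventually allI spectral_int_dist[OF f g d])
  moreover have "(\<lambda>n. spectral_int f - simple_int (g n)) \<longlonglongrightarrow> spectral_int f - T"
    by (intro tendsto_intros lim)
  ultimately have "0 = spectral_int f - T" by (rule LIMSEQ_unique)
  then show ?thesis by simp
qed

lemma spectral_int_linear: "linear_map_on (bounded_borel X) spectral_int"
  unfolding linear_map_on_def
proof (intro conjI allI ballI)
  fix f g assume f: "f \<in> bounded_borel X" and g: "g \<in> bounded_borel X"
  note sf = simple_fun_step_approx[OF f] and sg = simple_fun_step_approx[OF g]
  show "spectral_int (\<lambda>x. f x + g x) = spectral_int f + spectral_int g"
  proof (rule spectral_int_eqI[OF bounded_borel_add[OF f g] simple_fun_add[OF sf sg]])
    show "\<bar>f x + g x - (step_approx n f x + step_approx n g x)\<bar> \<le> 2 / real (Suc n)" for n x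
      using step_approx_dist[of f x n] step_approx_dist[of g x n] by linarith
    show "(\<lambda>n. simple_int (\<lambda>x. step_approx n f x + step_approx n g x)) \<longlonglongrightarrow> spectral_int f + spectral_int g"
      unfolding simple_int_add[OF sf sg] by (intro tendsto_add simple_int_step_approx_tendsto f g)
  qed
next
  fix c f assume f: "f \<in> bounded_borel X"
  note sf = simple_fun_step_approx[OF f]
  show "spectral_int (\<lambda>x. c * f x) = c *\<^sub>R spectral_int f"
  proof (rule spectral_int_eqI[OF bounded_borel_scale[OF f] simple_fun_scale[OF sf]])
    show "\<bar>c * f x - c * step_approx n f x\<bar> \<le> \<bar>c\<bar> / real (Suc n)" for n x
      using mult_left_mono[OF step_approx_dist[of f x n], of "\<bar>c\<bar>"] by (simp add: abs_mult flip: right_diff_distrib)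
    show "(\<lambda>n. simple_int (\<lambda>x. c * step_approx n f x)) \<longlonglongrightarrow> c *\<^sub>R spectral_int f"
      unfolding simple_int_scale[OF sf] by (intro tendsto_scaleR tendsto_const simple_int_step_approx_tendsto f)
  qed
qed

lemma spectral_int_simple:
  assumes "simple_fun f"
  shows "spectral_int f = simple_int f"
  using assms by (intro spectral_int_eqI[where c = 0 and g = "\<lambda>_. f"]) (auto simp: simple_fun_def)

lemma spectral_int_nonneg:
  assumes f: "f \<in> bounded_borel X" "\<And>x. 0 \<le> f x"
  shows "positive_operator (blinfun_apply (spectral_int f))"
proof (rule positive_operator_blinfunI)
  fix y :: 'e assume y: "0 \<le> y"
  have "(\<lambda>n. blinfun_apply (simple_int (step_approx n f)) y) \<longlonglongrightarrow> blinfun_apply (spectral_int f) y"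
    by (intro blinfun.tendsto simple_int_step_approx_tendsto f tendsto_const)
  then show "0 \<le> blinfun_apply (spectral_int f) y"
  proof (rule tendsto_nonneg_lattice)
    show "0 \<le> blinfun_apply (simple_int (step_approx n f)) y" for n
      using f(2) y by (intro simple_int_nonneg simple_fun_step_approx f) (auto simp: step_approx_def)
  qed
qed

lemma abs_le_sup_norm:
  assumes "f \<in> bounded_borel X"
  shows "\<bar>f x\<bar> \<le> sup_norm f"
proof -
  obtain B where "\<And>x. \<bar>f x\<bar> \<le> B" using bounded_borel_bound[OF assms] by blast
  then show ?thesis unfolding sup_norm_def by (intro cSUP_upper) (auto intro!: bdd_aboveI)
qed

lemma norm_spectral_int_le:
  assumes "f \<in> bounded_borel X"
  shows "norm (spectral_int f) \<le> norm (P (topspace X)) * sup_norm f"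
proof -
  have sets: "{} \<in> \<B>" by simp
  have "simple_int (indicator {}) = 0" using simple_int_indicator[OF sets] P_empty by simp
  then show ?thesis
    using spectral_int_dist[OF assms simple_fun_indicator[OF sets], of "sup_norm f"] abs_le_sup_norm[OF assms]
    by (simp add: mult.commute)
qed

text \<open>Linearity and the values on indicators fix \<open>\<rho>\<close> on simple functions;
  the norm bound carries this over to their uniform limits.\<close>

lemma spectral_int_unique:
  assumes lin: "linear_map_on (bounded_borel X) \<rho>"
    and bd: "\<And>f. f \<in> bounded_borel X \<Longrightarrow> norm (\<rho> f) \<le> C * sup_norm f"
    and ind: "\<And>A. A \<in> \<B> \<Longrightarrow> \<rho> (indicator A) = P A"
    and f: "f \<in> bounded_borel X"
  shows "\<rho> f = spectral_int f"
proof -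
  have simple: "\<rho> g = simple_int g" if g: "simple_fun g" for g
  proof -
    have gB: "g \<in> bounded_borel X" and fin: "finite (g ` topspace X)" using g by (auto simp: simple_fun_def)
    have "g x = (\<Sum>c\<in>g ` topspace X. c * indicator (level g c) x)" for x
    proof (cases "x \<in> topspace X")
      case True
      then have "(\<Sum>c\<in>g ` topspace X. c * indicator (level g c) x) = (\<Sum>c\<in>{g x}. c * indicator (level g c) x)"
        using fin by (intro sum.mono_neutral_right) (auto simp: level_def indicator_def)
      then show ?thesis using True by (simp add: level_def)
    next
      case False
      then show ?thesis using bounded_borelD(2)[OF gB] by (simp add: level_def)
    qed
    then have "g = (\<lambda>x. \<Sum>c\<in>g ` topspace X. c * indicator (level g c) x)" by (rule ext)
    then have "\<rho> g = \<rho> (\<lambda>x. \<Sum>c\<in>g ` topspace X. c * indicator (level g c) x)" by (rule arg_cong)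
    also have "\<dots> = (\<Sum>c\<in>g ` topspace X. \<rho> (\<lambda>x. c * indicator (level g c) x))"
      by (intro linear_map_on_sum[OF lin bounded_borel_zero] bounded_borel_add bounded_borel_scale bounded_borel_indicator level_borel gB)
    also have "\<dots> = simple_int g"
      unfolding simple_int_def
      by (intro sum.cong refl) (simp add: linear_map_onD(2)[OF lin] bounded_borel_indicator level_borel gB ind)
    finally show ?thesis .
  qed
  have "(\<lambda>n. \<rho> f - \<rho> (step_approx n f)) \<longlonglongrightarrow> 0"
  proof (rule Lim_null_comparison)
    have "norm (\<rho> f - \<rho> (step_approx n f)) \<le> \<bar>C\<bar> / real (Suc n)" for n
    proof -
      have sB: "step_approx n f \<in> bounded_borel X" using simple_fun_step_approx[OF f] by (simp add: simple_fun_def)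
      let ?d = "\<lambda>x. f x - step_approx n f x"
      have d: "?d \<in> bounded_borel X" by (intro bounded_borel_diff f sB)
      have "\<rho> f = \<rho> ?d + \<rho> (step_approx n f)" using linear_map_onD(1)[OF lin d sB] by simp
      then have "norm (\<rho> f - \<rho> (step_approx n f)) \<le> C * sup_norm ?d" using bd[OF d] by simp
      \<comment> \<open>The sign of \<open>C\<close> is unknown, and the next estimate multiplies by
        it.\<close>
      also have "\<dots> \<le> \<bar>C\<bar> * sup_norm ?d"
        using abs_le_sup_norm[OF d, of undefined] by (intro mult_right_mono) linarith+
      also have "sup_norm ?d \<le> 1 / real (Suc n)"
        unfolding sup_norm_def using step_approx_dist by (intro cSUP_least) auto
      finally show ?thesis by (simp add: mult_left_mono)
    qed
    then show "\<forall>\<^sub>F n in sequentially. norm (\<rho> f - \<rho> (step_approx n f)) \<le> \<bar>C\<bar> / real (Suc n)" by simp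
    show "(\<lambda>n. \<bar>C\<bar> / real (Suc n)) \<longlonglongrightarrow> 0"
      using tendsto_mult[OF tendsto_const[of "\<bar>C\<bar>"] LIMSEQ_Suc[OF lim_1_over_n]] by simp
  qed
  moreover have "(\<lambda>n. \<rho> f - \<rho> (step_approx n f)) \<longlonglongrightarrow> \<rho> f - spectral_int f"
    unfolding simple[OF simple_fun_step_approx[OF f]]
    by (intro tendsto_intros simple_int_step_approx_tendsto f)
  ultimately have "0 = \<rho> f - spectral_int f" by (rule LIMSEQ_unique)
  then show ?thesis by simp
qed

lemma generated_representation_eq: "generated_representation X P = spectral_int"
  unfolding generated_representation_def
proof (rule the_equality)
  have "spectral_int \<in> extensional (bounded_borel X)" by (simp add: extensional_def spectral_int_def)
  moreover have "\<exists>C. \<forall>f\<in>bounded_borel X. norm (spectral_int f) \<le> C * sup_norm f"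
    using norm_spectral_int_le by blast
  moreover have "\<forall>A\<in>\<B>. spectral_int (indicator A) = P A"
    using spectral_int_simple[OF simple_fun_indicator] simple_int_indicator by simp
  ultimately show "spectral_int \<in> extensional (bounded_borel X) \<and> linear_map_on (bounded_borel X) spectral_int \<and>
      (\<exists>C. \<forall>f\<in>bounded_borel X. norm (spectral_int f) \<le> C * sup_norm f) \<and>
      (\<forall>A\<in>\<B>. spectral_int (indicator A) = P A)"
    using spectral_int_linear by blast
next
  fix \<rho> assume \<rho>: "\<rho> \<in> extensional (bounded_borel X) \<and> linear_map_on (bounded_borel X) \<rho> \<and>
      (\<exists>C. \<forall>f\<in>bounded_borel X. norm (\<rho> f) \<le> C * sup_norm f) \<and> (\<forall>A\<in>\<B>. \<rho> (indicator A) = P A)"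
  then obtain C where C: "\<And>f. f \<in> bounded_borel X \<Longrightarrow> norm (\<rho> f) \<le> C * sup_norm f" by blast
  show "\<rho> = spectral_int"
  proof (rule extensionalityI[of _ "bounded_borel X"])
    show "spectral_int \<in> extensional (bounded_borel X)" by (simp add: extensional_def spectral_int_def)
    show "\<rho> f = spectral_int f" if "f \<in> bounded_borel X" for f
      by (rule spectral_int_unique[OF _ C]) (use \<rho> that in auto)
  qed (use \<rho> in blast)
qed

lemma generated_representation_linear: "linear_map_on (bounded_borel X) (generated_representation X P)"
  by (simp add: generated_representation_eq spectral_int_linear)

lemma generated_representation_indicator:
  "A \<in> \<B> \<Longrightarrow> generated_representation X P (indicator A) = P A"
  by (simp add: generated_representation_eq spectral_int_simple simple_fun_indicator simple_int_indicator)

lemma generated_representation_mono: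
  assumes f: "f \<in> bounded_borel X" and g: "g \<in> bounded_borel X" and "\<And>x. f x \<le> g x" and "0 \<le> y"
  shows "blinfun_apply (generated_representation X P f) y \<le> blinfun_apply (generated_representation X P g) y"
proof -
  let ?d = "\<lambda>x. g x - f x"
  have d: "?d \<in> bounded_borel X" by (rule bounded_borel_diff[OF g f])
  have "spectral_int g = spectral_int ?d + spectral_int f"
    using linear_map_onD(1)[OF spectral_int_linear d f] by simp
  moreover have "0 \<le> blinfun_apply (spectral_int ?d) y"
    using assms by (intro positive_operatorD(1)[OF spectral_int_nonneg[OF d]]) auto
  ultimately show ?thesis by (simp add: generated_representation_eq blinfun.add_left)
qed

end

section \<open>Operators and representations\<close>

lemma pprt_uminus_cancel:
  fixes u v :: "'e::lattice_ab_group_add_abs"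
  shows "pprt (u - v) + v = pprt (- (u - v)) + u"
  using pprt_diff_pprt_uminus[of "u - v"] by (simp add: algebra_simps)

text \<open>Kantorovich extension: \<open>h (u - v) = g u - g v\<close> holds for every
  decomposition into positive elements, and this makes \<open>h\<close> linear. Both parts of
  \<open>x\<close> enter the estimate, whence \<open>2 * \<bar>K\<bar>\<close>.\<close>

lemma positive_cone_extension:
  fixes g :: "'e::banach_lattice \<Rightarrow> 'e"
  assumes add: "\<And>x y. 0 \<le> x \<Longrightarrow> 0 \<le> y \<Longrightarrow> g (x + y) = g x + g y"
    and scale: "\<And>c x. 0 \<le> c \<Longrightarrow> 0 \<le> x \<Longrightarrow> g (c *\<^sub>R x) = c *\<^sub>R g x"
    and bound: "\<And>x. 0 \<le> x \<Longrightarrow> norm (g x) \<le> K * norm x"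
  obtains T :: "'e \<Rightarrow>\<^sub>L 'e" where "\<And>x. 0 \<le> x \<Longrightarrow> blinfun_apply T x = g x"
proof -
  define h where "h x = g (pprt x) - g (pprt (- x))" for x
  have h: "h (u - v) = g u - g v" if "0 \<le> u" "0 \<le> v" for u v
  proof -
    have "g (pprt (u - v)) + g v = g (pprt (- (u - v))) + g u"
      using pprt_uminus_cancel[of u v] add[of "pprt (u - v)" v] add[of "pprt (- (u - v))" u] that by (metis zero_le_pprt)
    then show ?thesis unfolding h_def by (metis add.commute add_diff_cancel_left' diff_diff_eq2 diff_add_eq)
  qed
  have dec: "x = pprt x - pprt (- x)" for x :: 'e by (simp add: pprt_diff_pprt_uminus)
  have "bounded_linear h"
  proof (rule bounded_linear_intro)
    show "h (x + y) = h x + h y" for x y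
    proof -
      have "x + y = (pprt x + pprt y) - (pprt (- x) + pprt (- y))"
        using dec[of x] dec[of y] by (metis add_diff_add)
      then show ?thesis
        using h[of "pprt x + pprt y" "pprt (- x) + pprt (- y)"] by (simp add: add h_def)
    qed
    show "h (c *\<^sub>R x) = c *\<^sub>R h x" for c x
    proof (cases "0 \<le> c")
      case True
      have "c *\<^sub>R x = c *\<^sub>R pprt x - c *\<^sub>R pprt (- x)" using dec[of x] by (metis scaleR_diff_right)
      then show ?thesis
        using h[of "c *\<^sub>R pprt x" "c *\<^sub>R pprt (- x)"] True by (simp add: scale h_def scaleR_nonneg_nonneg scaleR_diff_right)
    next
      case False
      have "c *\<^sub>R x = (- c) *\<^sub>R pprt (- x) - (- c) *\<^sub>R pprt x"
        using dec[of x] by (metis minus_diff_eq scaleR_diff_right scaleR_minus_left scaleR_minus_right)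
      then show ?thesis
        using h[of "(- c) *\<^sub>R pprt (- x)" "(- c) *\<^sub>R pprt x"] scale[of "- c"] False
        by (simp add: h_def scaleR_nonneg_nonneg scaleR_diff_right del: scaleR_minus_left) (simp add: scaleR_diff_right)
    qed
    show "norm (h x) \<le> norm x * (2 * \<bar>K\<bar>)" for x
    proof -
      have b: "norm (g (pprt y)) \<le> \<bar>K\<bar> * norm y" for y
        using order_trans[OF bound[of "pprt y"] mult_mono[OF abs_ge_self[of K] norm_pprt_le[of y]]] by simp
      have "norm (h x) \<le> norm (g (pprt x)) + norm (g (pprt (- x)))" unfolding h_def by (rule norm_triangle_ineq4)
      also have "\<dots> \<le> \<bar>K\<bar> * norm x + \<bar>K\<bar> * norm x" using b[of x] b[of "- x"] by (intro add_mono) auto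
      finally show ?thesis by (simp add: algebra_simps)
    qed
  qed
  moreover have "h x = g x" if "0 \<le> x" for x
    using h[of x 0] add[of 0 0] that by simp
  ultimately show thesis by (intro that[of "Blinfun h"]) (simp add: bounded_linear_Blinfun_apply)
qed

lemma blinfun_eq_coneI:
  fixes S T :: "'e::banach_lattice \<Rightarrow>\<^sub>L 'b::real_normed_vector"
  assumes "\<And>x. 0 \<le> x \<Longrightarrow> blinfun_apply S x = blinfun_apply T x"
  shows "S = T"
proof (rule blinfun_eqI)
  fix x :: 'e
  have "blinfun_apply S (pprt x - pprt (- x)) = blinfun_apply T (pprt x - pprt (- x))"
    using assms by (simp only: blinfun.diff_right zero_le_pprt)
  then show "blinfun_apply S x = blinfun_apply T x" by (simp add: pprt_diff_pprt_uminus)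
qed

lemma norm_positive_blinfun_mono:
  fixes S T :: "'e::banach_lattice \<Rightarrow>\<^sub>L 'e"
  assumes S: "positive_operator (blinfun_apply S)"
    and le: "\<And>x. 0 \<le> x \<Longrightarrow> blinfun_apply S x \<le> blinfun_apply T x"
  shows "norm S \<le> norm T"
proof (rule norm_blinfun_bound)
  fix x :: 'e
  have "norm (blinfun_apply S x) \<le> norm (blinfun_apply T \<bar>x\<bar>)"
    using abs_positive_operator_le[OF S, of x] le[of "\<bar>x\<bar>"]
    by (intro norm_lattice_mono) (meson abs_ge_self abs_ge_zero order_trans)
  also have "\<dots> \<le> norm T * norm x" using norm_blinfun[of T "\<bar>x\<bar>"] by simp
  finally show "norm (blinfun_apply S x) \<le> norm T * norm x" .
qed simp

text \<open>If \<open>\<pi>\<close> were unbounded on the unit interval, a geometrically weighted sum \<open>F\<close> of suitable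
  functions would dominate each summand and force \<open>norm (\<pi> F)\<close> to be infinite.\<close>

lemma positive_representation_bounded:
  fixes \<pi> :: "('a \<Rightarrow> real) \<Rightarrow> ('e::banach_lattice \<Rightarrow>\<^sub>L 'e)"
  assumes lin: "linear_map_on (C0 X) \<pi>"
    and pos: "\<And>f. f \<in> C0 X \<Longrightarrow> (\<And>x. 0 \<le> f x) \<Longrightarrow> positive_operator (blinfun_apply (\<pi> f))"
  obtains C where "\<And>f. f \<in> subunit X (topspace X) \<Longrightarrow> norm (\<pi> f) \<le> C"
proof (rule ccontr)
  assume neg: "\<not> thesis"
  \<comment> \<open>Growth \<open>4 ^ n\<close> against the weights \<open>(1/2) ^ n\<close> of
    \<open>F\<close> still leaves \<open>2 ^ n\<close>, which no finite norm dominates.\<close>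
  have "\<exists>f. f \<in> subunit X (topspace X) \<and> 4 ^ n < norm (\<pi> f)" for n :: nat
    using neg that[of "4 ^ n"] by (meson not_less)
  then obtain f where f: "\<And>n::nat. f n \<in> subunit X (topspace X)" "\<And>n. 4 ^ n < norm (\<pi> (f n))" by metis
  note fD = subunitD[OF f(1)]
  define F where "F x = (\<Sum>n. (1/2) ^ n * f n x)" for x
  have bnd: "norm ((1/2) ^ n * f n x) \<le> (1/2) ^ n" for n x
    using fD(2,3)[of n x] by (simp add: abs_mult mult_left_le)
  have "uniform_limit UNIV (\<lambda>N x. \<Sum>n<N. (1/2) ^ n * f n x) F sequentially"
    unfolding F_def by (rule Weierstrass_m_test[OF bnd]) simp
  then have F: "F \<in> C0 X"
    by (rule C0_uniform_limit[rotated]) (intro C0_sum C0_scale fD)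
  have le_F: "(1/2) ^ n * f n x \<le> F x" for n x
  proof -
    have sm: "summable (\<lambda>n. (1/2) ^ n * f n x)"
      by (rule summable_comparison_test'[where g = "\<lambda>n. (1/2) ^ n"]) (use bnd in auto)
    show ?thesis
      using sum_le_suminf[OF sm, of "{n}"] fD(2) by (simp add: F_def)
  qed
  have "2 ^ n < norm (\<pi> F)" for n
  proof -
    let ?g = "\<lambda>x. (1/2) ^ n * f n x"
    have g: "?g \<in> C0 X" by (intro C0_scale fD)
    have d: "(\<lambda>x. F x - ?g x) \<in> C0 X" by (rule C0_diff[OF F g])
    have "\<pi> F = \<pi> ?g + \<pi> (\<lambda>x. F x - ?g x)" using linear_map_onD(1)[OF lin g d] by simp
    then have "norm (\<pi> ?g) \<le> norm (\<pi> F)"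
      using le_F fD(2) by (intro norm_positive_blinfun_mono pos[OF g])
        (auto simp: blinfun.add_left intro!: positive_operatorD(1)[OF pos[OF d]])
    also have "norm (\<pi> ?g) = (1/2) ^ n * norm (\<pi> (f n))"
      by (simp add: linear_map_onD(2)[OF lin fD(1)])
    finally have *: "(1/2) ^ n * norm (\<pi> (f n)) \<le> norm (\<pi> F)" .
    have "(2::real) ^ n = (1/2) ^ n * 4 ^ n" by (simp flip: power_mult_distrib)
    also have "\<dots> < (1/2) ^ n * norm (\<pi> (f n))" using f(2)[of n] by (intro mult_strict_left_mono) auto
    finally show ?thesis using * by linarith
  qed
  moreover obtain n where "norm (\<pi> F) < 2 ^ n" using real_arch_pow[of 2 "norm (\<pi> F)"] by auto
  ultimately show False by (meson less_asym)
qed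

section \<open>Uniqueness and regularity of measures\<close>

definition sums_additive :: "'a topology \<Rightarrow> ('a set \<Rightarrow> 'b::real_normed_vector) \<Rightarrow> bool" where
  "sums_additive X m \<longleftrightarrow> (\<forall>A :: nat \<Rightarrow> 'a set. range A \<subseteq> sets (borel_of X) \<longrightarrow> disjoint_family A \<longrightarrow>
     (\<lambda>n. m (A n)) sums m (\<Union>n. A n))"

lemma sums_additiveD:
  "sums_additive X m \<Longrightarrow> range A \<subseteq> sets (borel_of X) \<Longrightarrow> disjoint_family A \<Longrightarrow>
    (\<lambda>n::nat. m (A n)) sums m (\<Union>n. A n)"
  by (simp add: sums_additive_def)

text \<open>The series with all terms \<open>m {}\<close> converges, so its terms tend to
  \<open>0\<close>.\<close>

lemma sums_additive_empty:
  assumes "sums_additive X m"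
  shows "m {} = 0"
proof -
  have "(\<lambda>n::nat. m {}) sums m (\<Union>n::nat. {})"
    by (rule sums_additiveD[OF assms, of "\<lambda>_. {}"]) (auto simp: disjoint_family_on_def)
  then have "(\<lambda>n::nat. m {}) \<longlonglongrightarrow> 0" by (intro summable_LIMSEQ_zero sums_summable)
  then show ?thesis by (simp add: LIMSEQ_const_iff)
qed

lemma sums_additive_Un:
  assumes m: "sums_additive X m" and "A \<in> sets (borel_of X)" "B \<in> sets (borel_of X)" "A \<inter> B = {}"
  shows "m (A \<union> B) = m A + m B"
proof -
  have "(\<lambda>n. m (binaryset A B n)) sums m (\<Union>n. binaryset A B n)"
    using assms by (intro sums_additiveD[OF m]) (auto simp: range_binaryset_eq disjoint_family_on_def binaryset_def)
  moreover have "(\<lambda>n. m (binaryset A B n)) sums (m A + m B)"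
    by (rule binaryset_sums[where f = m]) (rule sums_additive_empty[OF m])
  ultimately show ?thesis by (simp add: UN_binaryset_eq sums_unique2)
qed

text \<open>Dynkin's argument: the open sets are stable under intersection and generate the Borel
  sets. The whole space is open, so complements follow by subtraction from a common total.\<close>

lemma sums_additive_eqI:
  assumes m: "sums_additive X m" and m': "sums_additive X m'"
    and eq: "\<And>U. openin X U \<Longrightarrow> m U = m' U" and A: "A \<in> sets (borel_of X)"
  shows "m A = m' A"
proof -
  have stable: "Int_stable {U. openin X U}" by (auto simp: Int_stable_def)
  have sub: "{U. openin X U} \<subseteq> Pow (topspace X)" by (auto dest: openin_subset)
  have A': "A \<in> sigma_sets (topspace X) {U. openin X U}" using A by (simp add: sets_borel_of)
  show ?thesis
    using stable sub A'
  proof (induction rule: sigma_sets_induct_disjoint)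
    case (basic A)
    then show ?case by (simp add: eq)
  next
    case empty
    show ?case by (simp add: eq)
  next
    case (compl A)
    have A: "A \<in> sets (borel_of X)" "topspace X - A \<in> sets (borel_of X)"
      using compl(1) sets.Diff[OF sets.top[of "borel_of X"]] by (auto simp: sets_borel_of)
    have "topspace X = A \<union> (topspace X - A)" using borel_of_subset_topspace[OF A(1)] by blast
    then have "m (topspace X) = m A + m (topspace X - A)" "m' (topspace X) = m' A + m' (topspace X - A)"
      using sums_additive_Un[OF m A] sums_additive_Un[OF m' A] by (metis Diff_disjoint)+
    moreover have "m (topspace X) = m' (topspace X)" by (rule eq) simp
    ultimately show ?case using compl(2) by simp
  next
    case (union A)
    then have "range A \<subseteq> sets (borel_of X)" by (simp add: sets_borel_of)
    then have "(\<lambda>n. m (A n)) sums m (\<Union>n. A n)" "(\<lambda>n. m' (A n)) sums m' (\<Union>n. A n)"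
      using union(1) by (auto intro!: sums_additiveD[OF m] sums_additiveD[OF m'])
    then show ?case using union(3) by (auto dest: sums_unique2)
  qed
qed

lemma sums_additive_restrict:
  assumes "sums_additive X m" "B \<in> sets (borel_of X)"
  shows "sums_additive X (\<lambda>A. m (A \<inter> B))"
  unfolding sums_additive_def
proof (intro allI impI)
  fix A :: "nat \<Rightarrow> 'a set" assume A: "range A \<subseteq> sets (borel_of X)" "disjoint_family A"
  have "(\<lambda>n. m (A n \<inter> B)) sums m (\<Union>n. A n \<inter> B)"
    using A assms(2) by (intro sums_additiveD[OF assms(1)]) (auto simp: disjoint_family_on_def)
  then show "(\<lambda>n. m (A n \<inter> B)) sums m ((\<Union>n. A n) \<inter> B)" by simp
qed

text \<open>The functional need only be additive on the positive cone; additivity and the norm bound on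
  the tail replace continuity.\<close>

lemma additive_functional_sums:
  fixes u :: "nat \<Rightarrow> 'e::banach_lattice" and g :: "'e \<Rightarrow> real"
  assumes add: "\<And>x y. 0 \<le> x \<Longrightarrow> 0 \<le> y \<Longrightarrow> g (x + y) = g x + g y"
    and nonneg: "\<And>x. 0 \<le> x \<Longrightarrow> 0 \<le> g x" and bound: "\<And>x. 0 \<le> x \<Longrightarrow> g x \<le> c * norm x"
    and u: "\<And>n. 0 \<le> u n" "u sums s"
  shows "(\<lambda>n. g (u n)) sums g s"
proof -
  have g0: "g 0 = 0" using add[of 0 0] by simp
  have sum: "g (\<Sum>n<N. u n) = (\<Sum>n<N. g (u n))" for N
    by (induction N) (auto simp: g0 add sum_nonneg u)
  have tail: "0 \<le> s - (\<Sum>n<N. u n)" for N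
  proof (rule tendsto_nonneg_lattice)
    show "(\<lambda>M. (\<Sum>n<M. u n) - (\<Sum>n<N. u n)) \<longlonglongrightarrow> s - (\<Sum>n<N. u n)"
      using u(2) unfolding sums_def by (intro tendsto_diff tendsto_const)
    show "0 \<le> (\<Sum>n<M. u n) - (\<Sum>n<N. u n)" if "N \<le> M" for M
      using that u(1) by (simp add: sum_mono2)
  qed
  have eq: "g s = (\<Sum>n<N. g (u n)) + g (s - (\<Sum>n<N. u n))" for N
    using add[of "\<Sum>n<N. u n" "s - (\<Sum>n<N. u n)"] tail[of N] u(1) by (simp add: sum sum_nonneg)
  have "(\<lambda>N. c * norm (s - (\<Sum>n<N. u n))) \<longlonglongrightarrow> c * norm (s - s)"
    by (rule tendsto_mult[OF tendsto_const tendsto_norm[OF tendsto_diff[OF tendsto_const u(2)[unfolded sums_def]]]])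
  then have lim: "(\<lambda>N. c * norm (s - (\<Sum>n<N. u n))) \<longlonglongrightarrow> 0" by simp
  have "(\<lambda>N. g (s - (\<Sum>n<N. u n))) \<longlonglongrightarrow> 0"
  proof (rule Lim_null_comparison[OF always_eventually lim], rule allI)
    show "norm (g (s - (\<Sum>n<N. u n))) \<le> c * norm (s - (\<Sum>n<N. u n))" for N
      using nonneg[OF tail] bound[OF tail] by simp
  qed
  have eq': "g s - g (s - (\<Sum>n<N. u n)) = (\<Sum>n<N. g (u n))" for N using eq[of N] by linarith
  from tendsto_diff[OF tendsto_const[of "g s"] \<open>(\<lambda>N. g (s - (\<Sum>n<N. u n))) \<longlonglongrightarrow> 0\<close>] show ?thesis
    unfolding sums_def by (simp add: eq')
qed

text \<open>Both regularity conditions come from the pairs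
  \<open>K \<subseteq> A \<subseteq> U\<close> with \<open>\<mu> (U - K)\<close> small:
  \<open>U\<close> approximates \<open>A\<close> from outside, and for open \<open>A\<close> the set
  \<open>K\<close> does so from inside.\<close>

lemma finite_regular_measure_exists:
  assumes haus: "Hausdorff_space X" and sums: "sums_additive X \<mu>"
    and nonneg: "\<And>A. A \<in> sets (borel_of X) \<Longrightarrow> (0::real) \<le> \<mu> A"
    and tight: "\<And>A \<epsilon>. A \<in> sets (borel_of X) \<Longrightarrow> 0 < \<epsilon> \<Longrightarrow>
      \<exists>K U. compactin X K \<and> openin X U \<and> K \<subseteq> A \<and> A \<subseteq> U \<and> \<mu> (U - K) < \<epsilon>"
  obtains M where "finite_regular_measure X M" "\<And>A. A \<in> sets (borel_of X) \<Longrightarrow> measure M A = \<mu> A"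
proof -
  define M where "M = measure_of (topspace X) (sets (borel_of X)) (\<lambda>A. ennreal (\<mu> A))"
  have sigma: "sigma_algebra (topspace X) (sets (borel_of X))"
    using sets.sigma_algebra_axioms[of "borel_of X"] by simp
  have sets_M: "sets M = sets (borel_of X)"
    unfolding M_def using sets.sigma_sets_eq[of "borel_of X"] sets.space_closed[of "borel_of X"] by simp
  have em: "emeasure M A = ennreal (\<mu> A)" if "A \<in> sets (borel_of X)" for A
  proof (rule emeasure_measure_of_sigma[OF sigma, of "\<lambda>A. ennreal (\<mu> A)" A, folded M_def])
    show "positive (sets (borel_of X)) (\<lambda>A. ennreal (\<mu> A))"
      by (simp add: positive_def sums_additive_empty[OF sums])
    show "countably_additive (sets (borel_of X)) (\<lambda>A. ennreal (\<mu> A))"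
    proof (rule countably_additiveI)
      fix A :: "nat \<Rightarrow> 'a set" assume A: "range A \<subseteq> sets (borel_of X)" "disjoint_family A"
      note s = sums_additiveD[OF sums A]
      have "(\<Sum>n. ennreal (\<mu> (A n))) = ennreal (\<Sum>n. \<mu> (A n))"
        using A(1) nonneg s by (intro suminf_ennreal2) (auto simp: sums_summable)
      then show "(\<Sum>n. ennreal (\<mu> (A n))) = ennreal (\<mu> (\<Union> (range A)))" using s by (simp add: sums_iff)
    qed
  qed (rule that)
  have me: "measure M A = \<mu> A" if "A \<in> sets (borel_of X)" for A
    using em[OF that] nonneg[OF that] by (simp add: measure_def)
  have split: "emeasure M B \<le> emeasure M A + ennreal \<epsilon>"
    if A: "A \<in> sets (borel_of X)" and B: "B \<in> sets (borel_of X)" and D: "D \<in> sets (borel_of X)"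
      and sub: "B \<subseteq> A \<union> D" and less: "\<mu> D < \<epsilon>" for A B D \<epsilon>
  proof -
    have "emeasure M B \<le> emeasure M (A \<union> D)" using A D sub by (intro emeasure_mono) (auto simp: sets_M)
    also have "\<dots> \<le> emeasure M A + emeasure M D" using A D by (intro emeasure_subadditive) (auto simp: sets_M)
    also have "\<dots> \<le> emeasure M A + ennreal \<epsilon>" using less by (intro add_left_mono) (simp add: em[OF D] ennreal_leI)
    finally show ?thesis .
  qed
  note bor = openin_borel_of compactin_borel_of[OF haus]
  have "finite_regular_measure X M"
    unfolding finite_regular_measure_def
  proof (intro conjI ballI allI impI)
    show "sets M = sets (borel_of X)" by (rule sets_M)
    have "space M = topspace X" using sets_eq_imp_space_eq[OF sets_M] by simp
    then show "finite_measure M" using em[OF openin_borel_of[OF openin_topspace]] by (intro finite_measureI) simp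
    fix A assume "A \<in> sets M"
    then have A: "A \<in> sets (borel_of X)" by (simp add: sets_M)
    show "emeasure M A = (INF U\<in>{U. openin X U \<and> A \<subseteq> U}. emeasure M U)"
    proof (rule antisym)
      show "emeasure M A \<le> (INF U\<in>{U. openin X U \<and> A \<subseteq> U}. emeasure M U)"
        by (rule INF_greatest) (auto intro!: emeasure_mono openin_borel_of simp: sets_M)
      show "(INF U\<in>{U. openin X U \<and> A \<subseteq> U}. emeasure M U) \<le> emeasure M A"
      proof (rule ennreal_le_epsilon)
        fix \<epsilon> :: real assume "0 < \<epsilon>"
        then obtain K U where KU: "compactin X K" "openin X U" "K \<subseteq> A" "A \<subseteq> U" "\<mu> (U - K) < \<epsilon>"
          using tight[OF A] by meson
        have "(INF U\<in>{U. openin X U \<and> A \<subseteq> U}. emeasure M U) \<le> emeasure M U" using KU by (intro INF_lower) auto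
        also have "\<dots> \<le> emeasure M A + ennreal \<epsilon>"
          using KU by (intro split[OF A _ _ _ KU(5)] sets.Diff bor) auto
        finally show "(INF U\<in>{U. openin X U \<and> A \<subseteq> U}. emeasure M U) \<le> emeasure M A + ennreal \<epsilon>" .
      qed
    qed
  next
    fix U assume U: "openin X U"
    show "emeasure M U = (SUP K\<in>{K. compactin X K \<and> K \<subseteq> U}. emeasure M K)"
    proof (rule antisym)
      show "(SUP K\<in>{K. compactin X K \<and> K \<subseteq> U}. emeasure M K) \<le> emeasure M U"
        using U by (intro SUP_least) (auto intro!: emeasure_mono openin_borel_of simp: sets_M)
      show "emeasure M U \<le> (SUP K\<in>{K. compactin X K \<and> K \<subseteq> U}. emeasure M K)"
      proof (rule ennreal_le_epsilon)
        fix \<epsilon> :: real assume "0 < \<epsilon>"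
        then obtain K V where KV: "compactin X K" "openin X V" "K \<subseteq> U" "U \<subseteq> V" "\<mu> (V - K) < \<epsilon>"
          using tight[OF openin_borel_of[OF U]] by meson
        have "emeasure M U \<le> emeasure M K + ennreal \<epsilon>"
          using KV by (intro split[OF _ _ _ _ KV(5)] sets.Diff bor U) auto
        also have "emeasure M K \<le> (SUP K\<in>{K. compactin X K \<and> K \<subseteq> U}. emeasure M K)"
          using KV by (intro SUP_upper) auto
        finally show "emeasure M U \<le> (SUP K\<in>{K. compactin X K \<and> K \<subseteq> U}. emeasure M K) + ennreal \<epsilon>"
          by (simp add: add_right_mono)
      qed
    qed
  qed
  then show thesis using me by (rule that)
qed

section \<open>The spectral measure of a positive representation\<close>

lemma sums_additive_add:
  "sums_additive X m \<Longrightarrow> sums_additive X m' \<Longrightarrow> sums_additive X (\<lambda>A. m A + m' A)"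
  unfolding sums_additive_def by (intro allI impI sums_add) simp_all

lemma sums_additive_bounded_linear:
  "bounded_linear T \<Longrightarrow> sums_additive X m \<Longrightarrow> sums_additive X (\<lambda>A. T (m A))"
  unfolding sums_additive_def by (intro allI impI bounded_linear.sums[of T]) simp_all

locale positive_rep = lc_hausdorff X for X :: "'a topology" +
  fixes \<pi> :: "('a \<Rightarrow> real) \<Rightarrow> ('e::kb_space \<Rightarrow>\<^sub>L 'e)" and C :: real
  assumes rep: "positive_representation (C0 X) \<pi>"
    and rep_bound: "f \<in> subunit X (topspace X) \<Longrightarrow> norm (\<pi> f) \<le> C"
begin

lemma rep_linear: "linear_map_on (C0 X) \<pi>"
  and rep_mult: "f \<in> C0 X \<Longrightarrow> g \<in> C0 X \<Longrightarrow> \<pi> (\<lambda>x. f x * g x) = \<pi> f o\<^sub>L \<pi> g"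
  and rep_pos: "f \<in> C0 X \<Longrightarrow> (\<And>x. 0 \<le> f x) \<Longrightarrow> positive_operator (blinfun_apply (\<pi> f))"
  using rep by (auto simp: positive_representation_def)

section \<open>The vector measures and their dependence on the vector\<close>

lemma riesz_at:
  assumes "0 \<le> x"
  shows "kb_riesz X (\<lambda>f. blinfun_apply (\<pi> f) x) (C * norm x)"
proof unfold_locales
  show "norm (blinfun_apply (\<pi> f) x) \<le> C * norm x" if "f \<in> subunit X (topspace X)" for f
    using norm_blinfun[of "\<pi> f" x] mult_right_mono[OF rep_bound[OF that] norm_ge_zero[of x]] by linarith
qed (use assms in \<open>auto simp: linear_map_onD[OF rep_linear] blinfun.add_left blinfun.scaleR_left
  intro: positive_operatorD(1)[OF rep_pos]\<close>)

abbreviation vec_measure :: "'e \<Rightarrow> 'a set \<Rightarrow> 'e" where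
  "vec_measure x \<equiv> kb_riesz.riesz_measure X (\<lambda>f. blinfun_apply (\<pi> f) x)"

lemma vec_measure_nonneg: "0 \<le> x \<Longrightarrow> A \<in> sets (borel_of X) \<Longrightarrow> 0 \<le> vec_measure x A"
  by (rule kb_riesz.riesz_measure_nonneg[OF riesz_at borel_of_subset_topspace])

lemma vec_measure_sums_additive: "0 \<le> x \<Longrightarrow> sums_additive X (vec_measure x)"
  unfolding sums_additive_def by (auto intro!: kb_riesz.riesz_measure_sums[OF riesz_at])

lemma le_vec_measure: "0 \<le> x \<Longrightarrow> openin X U \<Longrightarrow> f \<in> subunit X U \<Longrightarrow> blinfun_apply (\<pi> f) x \<le> vec_measure x U"
  using kb_riesz.phi_le_open_val[OF riesz_at] by (simp add: kb_riesz.riesz_measure_openin[OF riesz_at])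

lemma vec_measure_approx:
  assumes "0 \<le> x" "openin X U" "0 < \<epsilon>"
  obtains f where "f \<in> subunit X U" "norm (vec_measure x U - blinfun_apply (\<pi> f) x) < \<epsilon>"
  using kb_riesz.open_val_approx[OF riesz_at[OF assms(1)] assms(3), of U]
  by (auto simp: kb_riesz.riesz_measure_openin[OF riesz_at[OF assms(1)] assms(2)])

lemma vec_measure_least:
  assumes "0 \<le> x" "openin X U" "\<And>f. f \<in> subunit X U \<Longrightarrow> blinfun_apply (\<pi> f) x \<le> b"
  shows "vec_measure x U \<le> b"
  unfolding kb_riesz.riesz_measure_openin[OF riesz_at[OF assms(1)] assms(2)]
  by (rule kb_riesz.open_val_least[OF riesz_at[OF assms(1)] assms(3)])

lemma vec_measure_regular:
  assumes "0 \<le> x" "A \<in> sets (borel_of X)" "0 < \<epsilon>"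
  obtains K U where "compactin X K" "openin X U" "K \<subseteq> A" "A \<subseteq> U" "norm (vec_measure x (U - K)) < \<epsilon>"
  by (rule kb_riesz.riesz_measure_regular[OF riesz_at[OF assms(1)] assms(2,3)])

lemma rep_mono:
  assumes "f \<in> C0 X" "g \<in> C0 X" "\<And>z. f z \<le> g z" "0 \<le> x"
  shows "blinfun_apply (\<pi> f) x \<le> blinfun_apply (\<pi> g) x"
  by (rule kb_riesz.phi_mono[OF riesz_at[OF assms(4)] assms(1-3)])

text \<open>On open sets, superadditivity needs one function for both vectors: the maximum of two
  nearly optimal ones. Borel sets follow since both sides are countably additive.\<close>

lemma vec_measure_add:
  assumes x: "0 \<le> x" and y: "0 \<le> y" and A: "A \<in> sets (borel_of X)"
  shows "vec_measure (x + y) A = vec_measure x A + vec_measure y A"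
proof (rule sums_additive_eqI[OF _ _ _ A])
  have xy: "0 \<le> x + y" using x y by simp
  show "sums_additive X (vec_measure (x + y))" by (rule vec_measure_sums_additive[OF xy])
  show "sums_additive X (\<lambda>A. vec_measure x A + vec_measure y A)"
    by (intro sums_additive_add vec_measure_sums_additive x y)
  fix U assume U: "openin X U"
  show "vec_measure (x + y) U = vec_measure x U + vec_measure y U"
  proof (rule antisym)
    show "vec_measure (x + y) U \<le> vec_measure x U + vec_measure y U"
      using le_vec_measure[OF x U] le_vec_measure[OF y U]
      by (intro vec_measure_least[OF xy U]) (simp add: blinfun.add_right add_mono)
    show "vec_measure x U + vec_measure y U \<le> vec_measure (x + y) U"
    proof (rule le_if_small_perturbation)
      fix \<epsilon> :: real assume "0 < \<epsilon>"
      then have e: "0 < \<epsilon> / 2" by simp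
      obtain f where f: "f \<in> subunit X U" "norm (vec_measure x U - blinfun_apply (\<pi> f) x) < \<epsilon> / 2"
        by (rule vec_measure_approx[OF x U e])
      obtain g where g: "g \<in> subunit X U" "norm (vec_measure y U - blinfun_apply (\<pi> g) y) < \<epsilon> / 2"
        by (rule vec_measure_approx[OF y U e])
      define h where "h z = max (f z) (g z)" for z
      have h: "h \<in> subunit X U" unfolding h_def by (rule subunit_max[OF f(1) g(1)])
      let ?r = "vec_measure x U - blinfun_apply (\<pi> f) x" and ?s = "vec_measure y U - blinfun_apply (\<pi> g) y"
      have "blinfun_apply (\<pi> f) x + blinfun_apply (\<pi> g) y \<le> blinfun_apply (\<pi> h) x + blinfun_apply (\<pi> h) y"
        by (intro add_mono rep_mono subunitD(1)[OF f(1)] subunitD(1)[OF g(1)] subunitD(1)[OF h] x y)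
          (auto simp: h_def)
      also have "\<dots> \<le> vec_measure (x + y) U" using le_vec_measure[OF xy U h] by (simp add: blinfun.add_right)
      finally have "blinfun_apply (\<pi> f) x + blinfun_apply (\<pi> g) y + (?r + ?s) \<le> vec_measure (x + y) U + (?r + ?s)"
        by (rule add_right_mono)
      then have "vec_measure x U + vec_measure y U \<le> vec_measure (x + y) U + (?r + ?s)"
        by (simp add: algebra_simps)
      moreover have "norm (?r + ?s) < \<epsilon>" using f(2) g(2) norm_triangle_ineq[of ?r ?s] by simp
      ultimately show "\<exists>r. vec_measure x U + vec_measure y U \<le> vec_measure (x + y) U + r \<and> norm r < \<epsilon>" by blast
    qed
  qed
qed

lemma vec_measure_scale:
  assumes c: "0 \<le> c" and x: "0 \<le> x" and A: "A \<in> sets (borel_of X)"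
  shows "vec_measure (c *\<^sub>R x) A = c *\<^sub>R vec_measure x A"
proof (rule sums_additive_eqI[OF _ _ _ A])
  have cx: "0 \<le> c *\<^sub>R x" using c x by (rule scaleR_nonneg_nonneg)
  show "sums_additive X (vec_measure (c *\<^sub>R x))" by (rule vec_measure_sums_additive[OF cx])
  show "sums_additive X (\<lambda>A. c *\<^sub>R vec_measure x A)"
    by (intro sums_additive_bounded_linear[OF bounded_linear_scaleR_right] vec_measure_sums_additive x)
  fix U assume U: "openin X U"
  \<comment> \<open>Applied to \<open>inverse c\<close> as well, this gives the reverse inequality;
    hence \<open>c = 0\<close> is treated separately.\<close>
  have le: "vec_measure (d *\<^sub>R w) U \<le> d *\<^sub>R vec_measure w U" if "0 \<le> d" "0 \<le> w" for d w
    using that le_vec_measure[OF that(2) U]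
    by (intro vec_measure_least[OF _ U] scaleR_nonneg_nonneg) (auto simp: blinfun.scaleR_right intro: scaleR_left_mono)
  show "vec_measure (c *\<^sub>R x) U = c *\<^sub>R vec_measure x U"
  proof (cases "c = 0")
    case True
    have "vec_measure (0 *\<^sub>R x) U \<le> 0" using le[of 0 x] x by simp
    moreover have "0 \<le> vec_measure (0 *\<^sub>R x) U" by (intro vec_measure_nonneg openin_borel_of U) simp
    ultimately show ?thesis using True by simp
  next
    case False
    have "c *\<^sub>R vec_measure (inverse c *\<^sub>R c *\<^sub>R x) U \<le> c *\<^sub>R inverse c *\<^sub>R vec_measure (c *\<^sub>R x) U"
      using c cx by (intro scaleR_left_mono le) auto
    then show ?thesis using le[OF c x] False by (intro antisym) auto
  qed
qed

lemma norm_vec_measure_le: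
  assumes x: "0 \<le> x" and A: "A \<in> sets (borel_of X)"
  shows "norm (vec_measure x A) \<le> C * norm x"
proof (rule field_le_epsilon)
  fix \<epsilon> :: real assume e: "0 < \<epsilon>"
  obtain f where f: "f \<in> subunit X (topspace X)"
      "norm (vec_measure x (topspace X) - blinfun_apply (\<pi> f) x) < \<epsilon>"
    by (rule vec_measure_approx[OF x openin_topspace e])
  have "norm (vec_measure x A) \<le> norm (vec_measure x (topspace X))"
    using kb_riesz.riesz_measure_mono[OF riesz_at[OF x] borel_of_subset_topspace[OF A]]
    by (intro norm_mono_nonneg vec_measure_nonneg x A) auto
  also have "\<dots> \<le> norm (blinfun_apply (\<pi> f) x) + norm (vec_measure x (topspace X) - blinfun_apply (\<pi> f) x)"
    using norm_triangle_ineq[of "blinfun_apply (\<pi> f) x" "vec_measure x (topspace X) - blinfun_apply (\<pi> f) x"] by simp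
  also have "\<dots> \<le> C * norm x + \<epsilon>"
    using kb_riesz.phi_bound[OF riesz_at[OF x] f(1)] f(2) by simp
  finally show "norm (vec_measure x A) \<le> C * norm x + \<epsilon>" .
qed

section \<open>Multiplicativity and regularity of the operator-valued measure\<close>

definition spectral_measure :: "'a set \<Rightarrow> ('e \<Rightarrow>\<^sub>L 'e)" where
  "spectral_measure = restrict (\<lambda>A. SOME T. \<forall>x\<ge>0. blinfun_apply T x = vec_measure x A) (sets (borel_of X))"

lemma spectral_measure_apply:
  assumes "A \<in> sets (borel_of X)" "0 \<le> x"
  shows "blinfun_apply (spectral_measure A) x = vec_measure x A"
proof -
  obtain T where "\<And>x. 0 \<le> x \<Longrightarrow> blinfun_apply T x = vec_measure x A"
    using positive_cone_extension[of "\<lambda>x. vec_measure x A" C] vec_measure_add vec_measure_scale norm_vec_measure_le assms(1)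
    by metis
  then have "\<exists>T. \<forall>x\<ge>0. blinfun_apply T x = vec_measure x A" by blast
  from someI_ex[OF this] show ?thesis using assms by (simp add: spectral_measure_def)
qed

lemma spectral_measure_nonneg:
  "A \<in> sets (borel_of X) \<Longrightarrow> positive_operator (blinfun_apply (spectral_measure A))"
  by (rule positive_operator_blinfunI) (simp add: spectral_measure_apply vec_measure_nonneg)

lemma spectral_measure_sums_additive: "sums_additive X (\<lambda>A. blinfun_apply (spectral_measure A) x)"
  unfolding sums_additive_def
proof (intro allI impI)
  fix A :: "nat \<Rightarrow> 'a set" assume A: "range A \<subseteq> sets (borel_of X)" "disjoint_family A"
  have U: "(\<Union>n. A n) \<in> sets (borel_of X)" using A(1) by blast
  have pos: "(\<lambda>n. blinfun_apply (spectral_measure (A n)) y) sums blinfun_apply (spectral_measure (\<Union>n. A n)) y"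
    if "0 \<le> y" for y
  proof -
    have "A n \<in> sets (borel_of X)" for n using A(1) by blast
    then show ?thesis
      using sums_additiveD[OF vec_measure_sums_additive[OF that] A] that U by (simp add: spectral_measure_apply)
  qed
  have dec: "blinfun_apply T x = blinfun_apply T (pprt x) - blinfun_apply T (pprt (- x))" for T :: "'e \<Rightarrow>\<^sub>L 'e"
    by (simp add: pprt_diff_pprt_uminus flip: blinfun.diff_right)
  show "(\<lambda>n. blinfun_apply (spectral_measure (A n)) x) sums blinfun_apply (spectral_measure (\<Union>n. A n)) x"
    unfolding dec by (intro sums_diff pos zero_le_pprt)
qed

lemma spectral_measure_Int_openin:
  assumes U: "openin X U" and V: "openin X V" and x: "0 \<le> x"
  shows "blinfun_apply (spectral_measure (U \<inter> V)) x = blinfun_apply (spectral_measure U) (blinfun_apply (spectral_measure V) x)"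
proof -
  define y where "y = vec_measure x V"
  have y: "0 \<le> y" unfolding y_def by (intro vec_measure_nonneg x openin_borel_of V)
  have UV: "openin X (U \<inter> V)" using U V by blast
  have "vec_measure x (U \<inter> V) = vec_measure y U"
  proof (rule antisym)
    show "vec_measure x (U \<inter> V) \<le> vec_measure y U"
    proof (rule vec_measure_least[OF x UV])
      fix h assume h: "h \<in> subunit X (U \<inter> V)"
      define s where "s z = sqrt (h z)" for z
      have sC: "s \<in> C0 X"
        unfolding s_def by (rule C0_compose[OF subunitD(1)[OF h], where F = sqrt]) (auto intro!: continuous_intros)
      have s: "s \<in> subunit X U" "s \<in> subunit X V"
        using subunitD(2-4)[OF h] by (auto intro!: subunitI[OF sC] simp: s_def)
      have "h = (\<lambda>z. s z * s z)" using subunitD(2)[OF h] by (auto simp: s_def)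
      then have "blinfun_apply (\<pi> h) x = blinfun_apply (\<pi> s) (blinfun_apply (\<pi> s) x)"
        using rep_mult[OF sC sC] by simp
      also have "\<dots> \<le> blinfun_apply (\<pi> s) y"
        unfolding y_def by (intro positive_operator_mono[OF rep_pos[OF sC]] le_vec_measure x V s subunitD(2)[OF s(1)])
      also have "\<dots> \<le> vec_measure y U" by (intro le_vec_measure y U s)
      finally show "blinfun_apply (\<pi> h) x \<le> vec_measure y U" .
    qed
    \<comment> \<open>Here the product \<open>f * g\<close> is admissible for
      \<open>U \<inter> V\<close>, and the bounded operator \<open>\<pi> f\<close> keeps the error
      of approximating \<open>y\<close> by \<open>\<pi> g x\<close> small in norm.\<close>
    show "vec_measure y U \<le> vec_measure x (U \<inter> V)"
    proof (rule vec_measure_least[OF y U], rule le_if_small_perturbation)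
      fix f and \<epsilon> :: real assume f: "f \<in> subunit X U" and "0 < \<epsilon>"
      then have e: "0 < \<epsilon> / (norm (\<pi> f) + 1)" by (simp add: add_nonneg_pos)
      obtain g where g: "g \<in> subunit X V" "norm (y - blinfun_apply (\<pi> g) x) < \<epsilon> / (norm (\<pi> f) + 1)"
        unfolding y_def by (rule vec_measure_approx[OF x V e])
      let ?r = "blinfun_apply (\<pi> f) (y - blinfun_apply (\<pi> g) x)"
      have fg: "(\<lambda>z. f z * g z) \<in> subunit X (U \<inter> V)"
        using subunitD[OF f] subunitD[OF g(1)] by (intro subunitI C0_mult mult_le_one) auto
      have "blinfun_apply (\<pi> f) y = blinfun_apply (\<pi> (\<lambda>z. f z * g z)) x + ?r"
        by (simp add: rep_mult[OF subunitD(1)[OF f] subunitD(1)[OF g(1)]] blinfun.diff_right)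
      then have "blinfun_apply (\<pi> f) y \<le> vec_measure x (U \<inter> V) + ?r"
        using le_vec_measure[OF x UV fg] by simp
      moreover have "norm ?r < \<epsilon>"
      proof -
        have "norm ?r \<le> norm (\<pi> f) * (\<epsilon> / (norm (\<pi> f) + 1))"
          using g(2) by (intro order_trans[OF norm_blinfun] mult_left_mono) auto
        also have "k * (\<epsilon> / (k + 1)) < \<epsilon>" if "0 \<le> k" for k :: real
          using \<open>0 < \<epsilon>\<close> that by (simp add: pos_divide_less_eq algebra_simps)
        finally show ?thesis by simp
      qed
      ultimately show "\<exists>r. blinfun_apply (\<pi> f) y \<le> vec_measure x (U \<inter> V) + r \<and> norm r < \<epsilon>" by blast
    qed
  qed
  then show ?thesis
    using U V UV x y by (simp add: spectral_measure_apply openin_borel_of y_def)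
qed

text \<open>Two extensions from open to Borel sets: in \<open>A\<close> with an open second set
  fixed, then in \<open>B\<close> with the Borel set \<open>A\<close> fixed.\<close>

lemma spectral_measure_Int:
  assumes A: "A \<in> sets (borel_of X)" and B: "B \<in> sets (borel_of X)"
  shows "spectral_measure (A \<inter> B) = spectral_measure A o\<^sub>L spectral_measure B"
proof (rule blinfun_eq_coneI)
  fix x :: 'e assume x: "0 \<le> x"
  have openin_right: "blinfun_apply (spectral_measure (A \<inter> V)) x = blinfun_apply (spectral_measure A) (blinfun_apply (spectral_measure V) x)"
    if V: "openin X V" for V
    by (rule sums_additive_eqI[OF sums_additive_restrict[OF spectral_measure_sums_additive openin_borel_of[OF V]]
      spectral_measure_sums_additive spectral_measure_Int_openin[OF _ V x] A])
  have swap: "sums_additive X (\<lambda>B. blinfun_apply (spectral_measure (A \<inter> B)) x)"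
    using sums_additive_restrict[OF spectral_measure_sums_additive A] by (simp add: Int_commute)
  have comp: "sums_additive X (\<lambda>B. blinfun_apply (spectral_measure A) (blinfun_apply (spectral_measure B) x))"
    by (intro sums_additive_bounded_linear[OF blinfun.bounded_linear_right] spectral_measure_sums_additive)
  show "blinfun_apply (spectral_measure (A \<inter> B)) x = blinfun_apply (spectral_measure A o\<^sub>L spectral_measure B) x"
    using sums_additive_eqI[OF swap comp openin_right B] by simp
qed

lemma positive_spectral_measure: "positive_spectral_measure X spectral_measure"
  unfolding positive_spectral_measure_def
proof (intro conjI ballI allI impI)
  have "spectral_measure A \<in> regular_operators" if "A \<in> sets (borel_of X)" for A
  proof -
    have "positive_operator (\<lambda>x::'e. 0::'e)" by (simp add: positive_operator_def linear_zero)
    then show ?thesis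
      unfolding regular_operators_def using spectral_measure_nonneg[OF that]
      by (intro CollectI exI[of _ "blinfun_apply (spectral_measure A)"] exI[of _ "\<lambda>x. 0"]) simp
  qed
  then show "spectral_measure \<in> sets (borel_of X) \<rightarrow>\<^sub>E regular_operators"
    by (auto simp: PiE_def extensional_def spectral_measure_def)
  fix A assume A: "A \<in> sets (borel_of X)"
  show "positive_operator (blinfun_apply (spectral_measure A))" by (rule spectral_measure_nonneg[OF A])
  show "spectral_measure A o\<^sub>L spectral_measure A = spectral_measure A" using spectral_measure_Int[OF A A] by simp
next
  show "spectral_measure {} = 0"
    by (rule blinfun_eqI) (simp add: sums_additive_empty[OF spectral_measure_sums_additive])
qed (auto intro: spectral_measure_Int sums_additiveD[OF spectral_measure_sums_additive])

text \<open>The positive part of \<open>x'\<close> is only needed as an additive function on the positive cone.\<close>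

lemma regular_spectral_measure: "regular_spectral_measure X spectral_measure"
  unfolding regular_spectral_measure_def
proof (intro allI)
  fix x :: 'e and x' :: "'e \<Rightarrow>\<^sub>L real"
  let ?B = "sets (borel_of X)"
  obtain g where g: "\<And>x. 0 \<le> x \<Longrightarrow> 0 \<le> g x" "\<And>x. 0 \<le> x \<Longrightarrow> blinfun_apply x' x \<le> g x"
    "\<And>x y. 0 \<le> x \<Longrightarrow> 0 \<le> y \<Longrightarrow> g (x + y) = g x + g y" "\<And>x. 0 \<le> x \<Longrightarrow> g x \<le> norm x' * norm x"
    by (rule functional_positive_part[of x']) blast
  \<comment> \<open>\<open>h\<close> is the negative part of \<open>x'\<close> on the cone, so
    \<open>x' = g - h\<close> there.\<close>
  define h where "h x = g x - blinfun_apply x' x" for x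
  have h: "0 \<le> h x" "h x \<le> (2 * norm x') * norm x" if "0 \<le> x" for x
    using g(2,4)[OF that] norm_blinfun[of x' x] by (auto simp: h_def abs_le_iff)
  have h_add: "h (x + y) = h x + h y" if "0 \<le> x" "0 \<le> y" for x y
    using g(3)[OF that] by (simp add: h_def blinfun.add_right)
  \<comment> \<open>Stated for two functions and two vectors, since each of the measures below mixes
    the parts of \<open>x'\<close> with the parts of \<open>x\<close>.\<close>
  have measure: "\<exists>M. finite_regular_measure X M \<and> (\<forall>A\<in>?B. measure M A = \<phi> (vec_measure u A) + \<psi> (vec_measure v A))"
    if u: "0 \<le> u" and v: "0 \<le> v"
      and \<phi>: "\<And>x y. 0 \<le> x \<Longrightarrow> 0 \<le> y \<Longrightarrow> \<phi> (x + y) = \<phi> x + \<phi> y" "\<And>x. 0 \<le> x \<Longrightarrow> 0 \<le> \<phi> x" "\<And>x. 0 \<le> x \<Longrightarrow> \<phi> x \<le> (2 * norm x') * norm x"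
      and \<psi>: "\<And>x y. 0 \<le> x \<Longrightarrow> 0 \<le> y \<Longrightarrow> \<psi> (x + y) = \<psi> x + \<psi> y" "\<And>x. 0 \<le> x \<Longrightarrow> 0 \<le> \<psi> x" "\<And>x. 0 \<le> x \<Longrightarrow> \<psi> x \<le> (2 * norm x') * norm x"
    for u v :: 'e and \<phi> \<psi> :: "'e \<Rightarrow> real"
  proof -
    let ?\<mu> = "\<lambda>A. \<phi> (vec_measure u A) + \<psi> (vec_measure v A)"
    have "sums_additive X ?\<mu>"
      unfolding sums_additive_def
    proof (intro allI impI)
      fix A :: "nat \<Rightarrow> 'a set" assume A: "range A \<subseteq> ?B" "disjoint_family A"
      then have An: "A n \<in> ?B" for n by blast
      show "(\<lambda>n. ?\<mu> (A n)) sums ?\<mu> (\<Union>n. A n)"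
        by (intro sums_add additive_functional_sums[OF \<phi>] additive_functional_sums[OF \<psi>] vec_measure_nonneg u v An
          sums_additiveD[OF vec_measure_sums_additive A])
    qed
    moreover have "0 \<le> ?\<mu> A" if "A \<in> ?B" for A
      by (intro add_nonneg_nonneg \<phi>(2) \<psi>(2) vec_measure_nonneg u v that)
    moreover have "\<exists>K U. compactin X K \<and> openin X U \<and> K \<subseteq> A \<and> A \<subseteq> U \<and> ?\<mu> (U - K) < \<epsilon>"
      if A: "A \<in> ?B" and \<epsilon>: "0 < \<epsilon>" for A \<epsilon>
    proof -
      \<comment> \<open>Each of the two summands is at most \<open>2 * norm x' * \<delta>\<close>;
        the \<open>+ 1\<close> makes the total strictly less than \<open>\<epsilon>\<close>, also
        for \<open>x' = 0\<close>.\<close>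
      define \<delta> where "\<delta> = \<epsilon> / (4 * (norm x' + 1))"
      have \<delta>: "0 < \<delta>" using \<epsilon> by (simp add: \<delta>_def add_nonneg_pos)
      obtain K U where KU: "compactin X K" "openin X U" "K \<subseteq> A" "A \<subseteq> U" "norm (vec_measure u (U - K)) < \<delta>"
        by (rule vec_measure_regular[OF u A \<delta>])
      obtain L V where LV: "compactin X L" "openin X V" "L \<subseteq> A" "A \<subseteq> V" "norm (vec_measure v (V - L)) < \<delta>"
        by (rule vec_measure_regular[OF v A \<delta>])
      \<comment> \<open>One pair has to serve both vectors: the outer sets are intersected and the
        inner sets united.\<close>
      have op: "openin X (U \<inter> V)" using KU LV by blast
      have comp: "compactin X (K \<union> L)" by (rule compactin_Un[OF KU(1) LV(1)])
      have D: "U \<inter> V - (K \<union> L) \<in> ?B" by (intro sets.Diff openin_borel_of op compactin_borel_of haus comp)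
      have small: "norm (vec_measure w (U \<inter> V - (K \<union> L))) \<le> norm (vec_measure w (W - M))"
        if "0 \<le> w" "U \<inter> V - (K \<union> L) \<subseteq> W - M" "openin X W" for w W M
        using kb_riesz.riesz_measure_mono[OF riesz_at[OF that(1)] that(2)] openin_subset[OF that(3)]
        by (intro norm_mono_nonneg vec_measure_nonneg that D) auto
      have "norm (vec_measure u (U \<inter> V - (K \<union> L))) \<le> norm (vec_measure u (U - K))"
        by (rule small[OF u _ KU(2)]) blast
      moreover have "norm (vec_measure v (U \<inter> V - (K \<union> L))) \<le> norm (vec_measure v (V - L))"
        by (rule small[OF v _ LV(2)]) blast
      ultimately have uv: "norm (vec_measure u (U \<inter> V - (K \<union> L))) \<le> \<delta>" "norm (vec_measure v (U \<inter> V - (K \<union> L))) \<le> \<delta>"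
        using KU(5) LV(5) by linarith+
      have "0 < norm x' + 1" by (intro add_nonneg_pos) simp_all
      then have cancel: "4 * (norm x' + 1) * (\<epsilon> / (4 * (norm x' + 1))) = \<epsilon>" by simp
      have "?\<mu> (U \<inter> V - (K \<union> L)) \<le> (2 * norm x') * \<delta> + (2 * norm x') * \<delta>"
        using uv by (intro add_mono order_trans[OF \<phi>(3)] order_trans[OF \<psi>(3)] vec_measure_nonneg u v D mult_left_mono) auto
      also have "\<dots> = 4 * norm x' * \<delta>" by simp
      also have "\<dots> < 4 * (norm x' + 1) * \<delta>" using \<delta> by (intro mult_strict_right_mono) auto
      also have "\<dots> = \<epsilon>" by (simp only: \<delta>_def cancel)
      finally have "?\<mu> (U \<inter> V - (K \<union> L)) < \<epsilon>" .
      then show ?thesis using op comp KU(3,4) LV(3,4) by (intro exI[of _ "K \<union> L"] exI[of _ "U \<inter> V"]) auto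
    qed
    ultimately obtain M where "finite_regular_measure X M" "\<And>A. A \<in> ?B \<Longrightarrow> measure M A = ?\<mu> A"
      using finite_regular_measure_exists[OF haus, of ?\<mu>] by blast
    then show ?thesis by blast
  qed
  have g': "g x \<le> (2 * norm x') * norm x" if "0 \<le> x" for x using g(4)[OF that] by (smt (verit) mult_right_mono norm_ge_zero)
  \<comment> \<open>Let \<open>a\<close> and \<open>b\<close> be the vector measures of the positive
    and the negative part of \<open>x\<close>. In the expansion of \<open>(g - h) (a - b)\<close>,
    the terms \<open>g a + h b\<close> form \<open>M\<close> and the terms \<open>h a + g b\<close>
    form \<open>N\<close>.\<close>
  obtain M where M: "finite_regular_measure X M"
      "\<And>A. A \<in> ?B \<Longrightarrow> measure M A = g (vec_measure (pprt x) A) + h (vec_measure (pprt (- x)) A)"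
    using measure[OF zero_le_pprt zero_le_pprt g(3) g(1) g' h_add h] by blast
  obtain N where N: "finite_regular_measure X N"
      "\<And>A. A \<in> ?B \<Longrightarrow> measure N A = h (vec_measure (pprt x) A) + g (vec_measure (pprt (- x)) A)"
    using measure[OF zero_le_pprt zero_le_pprt h_add h g(3) g(1) g'] by blast
  have "blinfun_apply x' (blinfun_apply (spectral_measure A) x) = measure M A - measure N A" if A: "A \<in> ?B" for A
  proof -
    have "blinfun_apply (spectral_measure A) x = blinfun_apply (spectral_measure A) (pprt x) - blinfun_apply (spectral_measure A) (pprt (- x))"
      by (simp add: pprt_diff_pprt_uminus flip: blinfun.diff_right)
    also have "\<dots> = vec_measure (pprt x) A - vec_measure (pprt (- x)) A" by (simp add: spectral_measure_apply[OF A])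
    finally show ?thesis by (simp add: M(2)[OF A] N(2)[OF A] h_def blinfun.diff_right)
  qed
  then show "regular_signed_measure X (\<lambda>A. blinfun_apply x' (blinfun_apply (spectral_measure A) x))"
    unfolding regular_signed_measure_def using M(1) N(1) by blast
qed

end

section \<open>Agreement on continuous functions, and uniqueness\<close>

lemma slice_sum:
  fixes y :: real
  assumes "0 \<le> y" "y \<le> 1"
  shows "(\<Sum>k<Suc n. min y (real (Suc k) / Suc n) - min y (real k / Suc n)) = y"
  using sum_lessThan_telescope[of "\<lambda>k. min y (real k / Suc n)" "Suc n"] assms by simp

text \<open>A function with values in the unit interval is the average of the slices
  \<open>s k\<close>, and \<open>s k\<close> lies between the indicators of its level sets at \<open>(k + 1) / n\<close> and \<open>k / n\<close>.\<close>

lemma slice_bounds: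
  fixes \<theta> :: "('a \<Rightarrow> real) \<Rightarrow> 'e::banach_lattice"
  assumes lin: "linear_map_on (C0 X) \<theta>"
    and upper: "\<And>U f. openin X U \<Longrightarrow> f \<in> subunit X U \<Longrightarrow> \<theta> f \<le> p U"
    and lower: "\<And>U f. openin X U \<Longrightarrow> f \<in> C0 X \<Longrightarrow> (\<And>x. indicator U x \<le> f x) \<Longrightarrow> p U \<le> \<theta> f"
    and f: "f \<in> subunit X (topspace X)"
  defines "V n k \<equiv> {x \<in> topspace X. real k / Suc n < f x}"
  shows "(\<Sum>k<Suc n. p (V n (Suc k))) \<le> real (Suc n) *\<^sub>R \<theta> f"
    and "real (Suc n) *\<^sub>R \<theta> f \<le> (\<Sum>k<Suc n. p (V n k))"
proof -
  note fD = subunitD[OF f]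
  \<comment> \<open>A slice of \<open>f\<close> has height \<open>1 / (n + 1)\<close>; the factor
    \<open>n + 1\<close> stretches it to the unit interval.\<close>
  define s where "s k x = real (Suc n) * (min (f x) (real (Suc k) / Suc n) - min (f x) (real k / Suc n))" for k x
  have op: "openin X (V n k)" for k unfolding V_def by (rule C0_level_openin[OF fD(1)])
  have sC: "s k \<in> C0 X" for k
    unfolding s_def
    by (rule C0_compose[OF fD(1), where F = "\<lambda>y. real (Suc n) * (min y (real (Suc k) / Suc n) - min y (real k / Suc n))"])
      (auto intro!: continuous_intros)
  have kk: "real (Suc k) / Suc n = real k / Suc n + 1 / Suc n" for k by (simp add: add_divide_distrib)
  have s_values: "0 \<le> s k x" "s k x \<le> 1" "f x \<le> real k / Suc n \<Longrightarrow> s k x = 0" "real (Suc k) / Suc n < f x \<Longrightarrow> s k x = 1" for k x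
  proof -
    define d where "d = min (f x) (real (Suc k) / Suc n) - min (f x) (real k / Suc n)"
    have n: "0 < 1 / real (Suc n)" by simp
    have "0 \<le> d" "d \<le> 1 / Suc n" "f x \<le> real k / Suc n \<Longrightarrow> d = 0" "real (Suc k) / Suc n < f x \<Longrightarrow> d = 1 / Suc n"
      unfolding d_def kk using n by linarith+
    moreover have "s k x = real (Suc n) * d" by (simp add: s_def d_def)
    ultimately show "0 \<le> s k x" "s k x \<le> 1" "f x \<le> real k / Suc n \<Longrightarrow> s k x = 0" "real (Suc k) / Suc n < f x \<Longrightarrow> s k x = 1"
      by (auto simp: field_simps)
  qed
  have "\<theta> (\<lambda>x. real (Suc n) * f x) = \<theta> (\<lambda>x. \<Sum>k<Suc n. s k x)"
    unfolding s_def sum_distrib_left[symmetric] slice_sum[OF fD(2,3)] ..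
  also have "\<dots> = (\<Sum>k<Suc n. \<theta> (s k))"
    by (rule linear_map_on_sum[OF lin C0_zero C0_add sC])
  finally have eq: "real (Suc n) *\<^sub>R \<theta> f = (\<Sum>k<Suc n. \<theta> (s k))"
    by (simp only: linear_map_onD(2)[OF lin fD(1)])
  show "real (Suc n) *\<^sub>R \<theta> f \<le> (\<Sum>k<Suc n. p (V n k))"
    unfolding eq
  proof (intro sum_mono upper op subunitI sC s_values(1,2))
    show "s k x = 0" if "x \<notin> V n k" for k x
      using that C0_D(2)[OF sC, of x k] s_values(3)[of x k] by (auto simp: V_def not_less)
  qed
  show "(\<Sum>k<Suc n. p (V n (Suc k))) \<le> real (Suc n) *\<^sub>R \<theta> f"
    unfolding eq
  proof (intro sum_mono lower op sC)
    show "indicator (V n (Suc k)) x \<le> s k x" for k x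
      using s_values(1,4)[of k x] by (cases "x \<in> V n (Suc k)") (auto simp: V_def simp del: of_nat_Suc)
  qed
qed

text \<open>The upper sum for one map and the lower sum for the other use the same values of
  \<open>p\<close>, shifted by one index, so they differ by at most \<open>w = p (W 0 0)\<close>.
  Division by \<open>n + 1\<close> makes this vanish. A general \<open>f\<close> is
  \<open>B * u - B * v\<close> with unit functions \<open>u\<close> and \<open>v\<close>.\<close>

lemma C0_linear_eqI:
  fixes \<theta> \<theta>' :: "('a \<Rightarrow> real) \<Rightarrow> 'e::banach_lattice"
  assumes lin: "linear_map_on (C0 X) \<theta>" and lin': "linear_map_on (C0 X) \<theta>'"
    and upper: "\<And>U f. openin X U \<Longrightarrow> f \<in> subunit X U \<Longrightarrow> \<theta> f \<le> p U"
    and upper': "\<And>U f. openin X U \<Longrightarrow> f \<in> subunit X U \<Longrightarrow> \<theta>' f \<le> p U"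
    and lower: "\<And>U f. openin X U \<Longrightarrow> f \<in> C0 X \<Longrightarrow> (\<And>x. indicator U x \<le> f x) \<Longrightarrow> p U \<le> \<theta> f"
    and lower': "\<And>U f. openin X U \<Longrightarrow> f \<in> C0 X \<Longrightarrow> (\<And>x. indicator U x \<le> f x) \<Longrightarrow> p U \<le> \<theta>' f"
    and f: "f \<in> C0 X"
  shows "\<theta> f = \<theta>' f"
proof -
  have p_nonneg: "0 \<le> p U" if "openin X U" for U
    using upper[OF that subunit_zero] linear_map_onD(2)[OF lin C0_zero, of 0] by simp
  have le: "\<eta> g \<le> \<eta>' g"
    if lin: "linear_map_on (C0 X) \<eta>" and lin': "linear_map_on (C0 X) \<eta>'"
    and upper: "\<And>U f. openin X U \<Longrightarrow> f \<in> subunit X U \<Longrightarrow> \<eta> f \<le> p U"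
    and lower: "\<And>U f. openin X U \<Longrightarrow> f \<in> C0 X \<Longrightarrow> (\<And>x. indicator U x \<le> f x) \<Longrightarrow> p U \<le> \<eta> f"
    and upper': "\<And>U f. openin X U \<Longrightarrow> f \<in> subunit X U \<Longrightarrow> \<eta>' f \<le> p U"
    and lower': "\<And>U f. openin X U \<Longrightarrow> f \<in> C0 X \<Longrightarrow> (\<And>x. indicator U x \<le> f x) \<Longrightarrow> p U \<le> \<eta>' f"
    and g: "g \<in> subunit X (topspace X)" for \<eta> \<eta>' :: "('a \<Rightarrow> real) \<Rightarrow> 'e" and g
  proof (rule le_if_small_perturbation)
    fix \<epsilon> :: real assume "0 < \<epsilon>"
    define W where "W n k = {x \<in> topspace X. real k / Suc n < g x}" for n k
    define w where "w = p (W 0 0)"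
    have W0: "W n 0 = W 0 0" for n by (simp add: W_def)
    have "0 < \<epsilon> / (norm w + 1)" using \<open>0 < \<epsilon>\<close> by (simp add: add_nonneg_pos)
    then obtain n where n: "inverse (real (Suc n)) < \<epsilon> / (norm w + 1)" using reals_Archimedean by blast
    have shift: "(\<Sum>k<m. q k) = (\<Sum>k<m. q (Suc k)) + (q 0 - q m)" for q :: "nat \<Rightarrow> 'e" and m
      by (induction m) (simp_all add: algebra_simps)
    have "real (Suc n) *\<^sub>R \<eta> g \<le> (\<Sum>k<Suc n. p (W n k))"
      unfolding W_def by (rule slice_bounds(2)[OF lin upper lower g])
    also have "\<dots> = (\<Sum>k<Suc n. p (W n (Suc k))) + (w - p (W n (Suc n)))"
      using shift[of "\<lambda>k. p (W n k)" "Suc n"] by (simp only: w_def W0[of n])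
    also have "\<dots> \<le> real (Suc n) *\<^sub>R \<eta>' g + w"
    proof (rule add_mono)
      show "(\<Sum>k<Suc n. p (W n (Suc k))) \<le> real (Suc n) *\<^sub>R \<eta>' g"
        unfolding W_def by (rule slice_bounds(1)[OF lin' upper' lower' g])
      have "0 \<le> p (W n (Suc n))"
        unfolding W_def by (intro p_nonneg C0_level_openin subunitD(1)[OF g])
      then show "w - p (W n (Suc n)) \<le> w" by simp
    qed
    finally have "inverse (real (Suc n)) *\<^sub>R (real (Suc n) *\<^sub>R \<eta> g) \<le> inverse (real (Suc n)) *\<^sub>R (real (Suc n) *\<^sub>R \<eta>' g + w)"
      by (rule scaleR_left_mono) simp
    then have "\<eta> g \<le> \<eta>' g + inverse (real (Suc n)) *\<^sub>R w" by (simp add: scaleR_add_right del: of_nat_Suc)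
    moreover have "norm (inverse (real (Suc n)) *\<^sub>R w) < \<epsilon>"
    proof -
      have "norm (inverse (real (Suc n)) *\<^sub>R w) \<le> \<epsilon> / (norm w + 1) * norm w"
        using mult_right_mono[OF less_imp_le[OF n] norm_ge_zero[of w]] by simp
      also have "\<dots> = \<epsilon> * norm w / (norm w + 1)" by simp
      also have "\<dots> < \<epsilon>"
      proof -
        have "0 < norm w + 1" by (intro add_nonneg_pos) simp_all
        then show ?thesis using \<open>0 < \<epsilon>\<close> by (simp only: pos_divide_less_eq) (simp add: algebra_simps)
      qed
      finally show ?thesis .
    qed
    ultimately show "\<exists>r. \<eta> g \<le> \<eta>' g + r \<and> norm r < \<epsilon>" by blast
  qed
  have unit: "\<theta> g = \<theta>' g" if "g \<in> subunit X (topspace X)" for g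
    by (rule antisym[OF le[OF lin lin' upper lower upper' lower' that] le[OF lin' lin upper' lower' upper lower that]])
  obtain B where B: "0 < B" "\<And>x. \<bar>f x\<bar> \<le> B" using C0_bounded[OF f] by blast
  define u v where "u x = max (f x) 0 / B" and "v x = max (- f x) 0 / B" for x
  have uC: "u \<in> C0 X"
    unfolding u_def using B(1) by (intro C0_compose[OF f, where F = "\<lambda>y. max y 0 / B"]) (auto intro!: continuous_intros)
  have vC: "v \<in> C0 X"
    unfolding v_def using B(1) by (intro C0_compose[OF f, where F = "\<lambda>y. max (- y) 0 / B"]) (auto intro!: continuous_intros)
  have "u \<in> subunit X (topspace X)"
    using B by (intro subunit_topspace uC) (auto simp: u_def abs_le_iff)
  then have u: "\<theta> u = \<theta>' u" by (rule unit)
  have "v \<in> subunit X (topspace X)"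
    using B by (intro subunit_topspace vC) (auto simp: v_def abs_le_iff minus_le_iff)
  then have v: "\<theta> v = \<theta>' v" by (rule unit)
  have "f = (\<lambda>x. B * u x + (- B) * v x)" using B(1) by (auto simp: u_def v_def fun_eq_iff)
  then show ?thesis
    using linear_map_onD(1)[OF lin C0_scale[OF uC] C0_scale[OF vC], of B "- B"]
      linear_map_onD(1)[OF lin' C0_scale[OF uC] C0_scale[OF vC], of B "- B"]
      linear_map_onD(2)[OF lin uC, of B] linear_map_onD(2)[OF lin' uC, of B]
      linear_map_onD(2)[OF lin vC, of "- B"] linear_map_onD(2)[OF lin' vC, of "- B"] u v by metis
qed

lemma finite_regular_measure_inner:
  assumes M: "finite_regular_measure X M" and U: "openin X U" and "0 < \<epsilon>"
  obtains K where "compactin X K" "K \<subseteq> U" "measure M U < measure M K + \<epsilon>"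
proof (rule ccontr)
  assume neg: "\<not> thesis"
  interpret finite_measure M using M by (simp add: finite_regular_measure_def)
  have le: "measure M K \<le> measure M U - \<epsilon>" if "compactin X K" "K \<subseteq> U" for K
    using neg that(1,2) \<open>\<And>K. compactin X K \<Longrightarrow> K \<subseteq> U \<Longrightarrow> measure M U < measure M K + \<epsilon> \<Longrightarrow> thesis\<close>[OF that] by linarith
  have "emeasure M U = (SUP K\<in>{K. compactin X K \<and> K \<subseteq> U}. emeasure M K)"
    using M U by (simp add: finite_regular_measure_def)
  also have "\<dots> \<le> ennreal (measure M U - \<epsilon>)"
    using le by (intro SUP_least) (auto simp: emeasure_eq_measure intro: ennreal_leI)
  \<comment> \<open>The instance \<open>K = {}\<close> shows
    \<open>0 \<le> measure M U - \<epsilon>\<close>, so that \<open>ennreal\<close> does not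
    truncate the right-hand side.\<close>
  finally have "measure M U \<le> measure M U - \<epsilon>"
    using le[of "{}"] by (simp add: emeasure_eq_measure)
  then show False using \<open>0 < \<epsilon>\<close> by simp
qed

text \<open>One compact set must serve both parts: for \<open>K \<union> L\<close> both losses are
  nonnegative and less than \<open>\<epsilon>\<close>, hence their difference has modulus less than
  \<open>\<epsilon>\<close>.\<close>

lemma regular_signed_measure_inner:
  assumes \<mu>: "regular_signed_measure X \<mu>" and H: "Hausdorff_space X" and U: "openin X U" and \<epsilon>: "0 < \<epsilon>"
  obtains K where "compactin X K" "K \<subseteq> U" "\<bar>\<mu> U - \<mu> K\<bar> < \<epsilon>"
proof -
  obtain M N where M: "finite_regular_measure X M" and N: "finite_regular_measure X N"
      and eq: "\<And>A. A \<in> sets (borel_of X) \<Longrightarrow> \<mu> A = measure M A - measure N A"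
    using \<mu> by (auto simp: regular_signed_measure_def)
  obtain K where K: "compactin X K" "K \<subseteq> U" "measure M U < measure M K + \<epsilon>"
    by (rule finite_regular_measure_inner[OF M U \<epsilon>])
  obtain L where L: "compactin X L" "L \<subseteq> U" "measure N U < measure N L + \<epsilon>"
    by (rule finite_regular_measure_inner[OF N U \<epsilon>])
  have KL: "compactin X (K \<union> L)" by (rule compactin_Un[OF K(1) L(1)])
  have mono: "measure R A \<le> measure R B"
    if "finite_regular_measure X R" "A \<subseteq> B" "A \<in> sets (borel_of X)" "B \<in> sets (borel_of X)" for R A B
    using that by (auto simp: finite_regular_measure_def intro: finite_measure.finite_measure_mono)
  note bor = compactin_borel_of[OF H K(1)] compactin_borel_of[OF H L(1)] compactin_borel_of[OF H KL] openin_borel_of[OF U]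
  have "measure M K \<le> measure M (K \<union> L)" "measure M (K \<union> L) \<le> measure M U"
      "measure N L \<le> measure N (K \<union> L)" "measure N (K \<union> L) \<le> measure N U"
    using K L bor by (auto intro!: mono[OF M] mono[OF N])
  then have "\<bar>\<mu> U - \<mu> (K \<union> L)\<bar> < \<epsilon>" using K(3) L(3) by (simp add: eq bor)
  then show thesis using that[OF KL] K(2) L(2) by blast
qed

context lc_hausdorff
begin

text \<open>With \<open>indicator K \<le> f \<le> indicator U\<close>, monotonicity leads from
  \<open>P K\<close> to \<open>Q U\<close> through the common operator at \<open>f\<close>;
  regularity for \<open>P\<close> lets the compact \<open>K\<close> stand for \<open>U\<close> up to
  \<open>\<epsilon>\<close>.\<close>

lemma regular_spectral_measure_openin_le:
  fixes P Q :: "'a set \<Rightarrow> ('e::banach_lattice \<Rightarrow>\<^sub>L 'e)" and x' :: "'e \<Rightarrow>\<^sub>L real"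
  assumes P: "positive_spectral_measure X P" "regular_spectral_measure X P"
    and Q: "positive_spectral_measure X Q"
    and eq: "\<And>f. f \<in> C0 X \<Longrightarrow> generated_representation X P f = generated_representation X Q f"
    and U: "openin X U" and x: "0 \<le> x" and x': "\<And>y. 0 \<le> y \<Longrightarrow> 0 \<le> blinfun_apply x' y"
  shows "blinfun_apply x' (blinfun_apply (P U) x) \<le> blinfun_apply x' (blinfun_apply (Q U) x)"
proof (rule field_le_epsilon)
  interpret P: spectral X P by unfold_locales (rule P)
  interpret Q: spectral X Q by unfold_locales (rule Q)
  fix \<epsilon> :: real assume \<epsilon>: "0 < \<epsilon>"
  have "regular_signed_measure X (\<lambda>A. blinfun_apply x' (blinfun_apply (P A) x))"
    using P(2) by (simp add: regular_spectral_measure_def)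
  then obtain K where K: "compactin X K" "K \<subseteq> U"
      "\<bar>blinfun_apply x' (blinfun_apply (P U) x) - blinfun_apply x' (blinfun_apply (P K) x)\<bar> < \<epsilon>"
    using regular_signed_measure_inner[OF _ haus U \<epsilon>] by blast
  obtain f where f: "f \<in> subunit X U" "\<And>x. x \<in> K \<Longrightarrow> f x = 1" by (rule urysohn_subunit[OF K(1,2) U]) blast
  have fB: "f \<in> bounded_borel X" using C0_subset_bounded_borel subunitD(1)[OF f(1)] by blast
  note KB = compactin_borel_of[OF haus K(1)] and UB = openin_borel_of[OF U]
  have "blinfun_apply (P K) x = blinfun_apply (generated_representation X P (indicator K)) x"
    by (simp add: P.generated_representation_indicator[OF KB])
  also have "\<dots> \<le> blinfun_apply (generated_representation X P f) x"
    using f subunitD(2)[OF f(1)]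
    by (intro P.generated_representation_mono bounded_borel_indicator KB fB x) (simp add: indicator_def)
  also have "\<dots> = blinfun_apply (generated_representation X Q f) x" by (simp add: eq subunitD(1)[OF f(1)])
  also have "\<dots> \<le> blinfun_apply (generated_representation X Q (indicator U)) x"
    using subunitD(3,4)[OF f(1)]
    by (intro Q.generated_representation_mono bounded_borel_indicator UB fB x) (simp add: indicator_def)
  also have "\<dots> = blinfun_apply (Q U) x" by (simp add: Q.generated_representation_indicator[OF UB])
  finally have "blinfun_apply x' (blinfun_apply (P K) x) \<le> blinfun_apply x' (blinfun_apply (Q U) x)"
    using x'[of "blinfun_apply (Q U) x - blinfun_apply (P K) x"] by (simp add: blinfun.diff_right)
  then show "blinfun_apply x' (blinfun_apply (P U) x) \<le> blinfun_apply x' (blinfun_apply (Q U) x) + \<epsilon>"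
    using K(3) by linarith
qed

lemma regular_spectral_measure_unique:
  fixes P Q :: "'a set \<Rightarrow> ('e::banach_lattice \<Rightarrow>\<^sub>L 'e)"
  assumes P: "positive_spectral_measure X P" "regular_spectral_measure X P"
    and Q: "positive_spectral_measure X Q" "regular_spectral_measure X Q"
    and eq: "\<And>f. f \<in> C0 X \<Longrightarrow> generated_representation X P f = generated_representation X Q f"
  shows "P = Q"
proof (rule PiE_ext)
  show "P \<in> sets (borel_of X) \<rightarrow>\<^sub>E regular_operators" "Q \<in> sets (borel_of X) \<rightarrow>\<^sub>E regular_operators"
    using P Q by (simp_all add: positive_spectral_measure_def)
  have sums: "sums_additive X (\<lambda>A. blinfun_apply (R A) x)"
    if "positive_spectral_measure X R" for R :: "'a set \<Rightarrow> ('e \<Rightarrow>\<^sub>L 'e)" and x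
    using that by (auto simp: positive_spectral_measure_def sums_additive_def)
  fix A assume A: "A \<in> sets (borel_of X)"
  show "P A = Q A"
  proof (intro blinfun_eq_coneI positive_functionals_separate)
    fix x :: 'e and x' :: "'e \<Rightarrow>\<^sub>L real"
    assume x: "0 \<le> x" and x': "\<And>y. 0 \<le> y \<Longrightarrow> 0 \<le> blinfun_apply x' y"
    show "blinfun_apply x' (blinfun_apply (P A) x) = blinfun_apply x' (blinfun_apply (Q A) x)"
    proof (rule sums_additive_eqI[OF _ _ _ A])
      show "sums_additive X (\<lambda>A. blinfun_apply x' (blinfun_apply (P A) x))"
        by (intro sums_additive_bounded_linear[OF blinfun.bounded_linear_right] sums P)
      show "sums_additive X (\<lambda>A. blinfun_apply x' (blinfun_apply (Q A) x))"
        by (intro sums_additive_bounded_linear[OF blinfun.bounded_linear_right] sums Q)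
      show "blinfun_apply x' (blinfun_apply (P U) x) = blinfun_apply x' (blinfun_apply (Q U) x)" if "openin X U" for U
        using regular_spectral_measure_openin_le[OF P Q(1) eq that x x']
          regular_spectral_measure_openin_le[OF Q P(1) eq[symmetric] that x x'] by (intro antisym)
    qed
  qed
qed

end

text \<open>Both sides obey the bounds of \<open>C0_linear_eqI\<close> with
  \<open>p = vec_measure x\<close>: the integral by monotonicity, and \<open>\<pi>\<close> because
  \<open>vec_measure x U\<close> is the supremum of \<open>\<pi> f x\<close> over
  \<open>subunit X U\<close>.\<close>

lemma (in positive_rep) generated_representation_spectral_measure:
  assumes f: "f \<in> C0 X"
  shows "generated_representation X spectral_measure f = \<pi> f"
proof (rule blinfun_eq_coneI)
  interpret S: spectral X spectral_measure by unfold_locales (rule positive_spectral_measure)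
  fix x :: 'e assume x: "0 \<le> x"
  have BB: "g \<in> bounded_borel X" if "g \<in> C0 X" for g using that C0_subset_bounded_borel by blast
  show "blinfun_apply (generated_representation X spectral_measure f) x = blinfun_apply (\<pi> f) x"
  proof (rule C0_linear_eqI[where p = "vec_measure x", OF _ _ _ _ _ _ f])
    show "linear_map_on (C0 X) (\<lambda>f. blinfun_apply (generated_representation X spectral_measure f) x)"
      unfolding linear_map_on_def
      by (auto simp: linear_map_onD[OF S.generated_representation_linear] BB blinfun.add_left blinfun.scaleR_left)
    show "linear_map_on (C0 X) (\<lambda>f. blinfun_apply (\<pi> f) x)"
      unfolding linear_map_on_def by (auto simp: linear_map_onD[OF rep_linear] blinfun.add_left blinfun.scaleR_left)
    fix U assume U: "openin X U"
    note UB = openin_borel_of[OF U]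
    have p: "vec_measure x U = blinfun_apply (generated_representation X spectral_measure (indicator U)) x"
      by (simp add: S.generated_representation_indicator[OF UB] spectral_measure_apply[OF UB x])
    show "blinfun_apply (generated_representation X spectral_measure g) x \<le> vec_measure x U" if "g \<in> subunit X U" for g
      unfolding p using subunitD(3,4)[OF that]
      by (intro S.generated_representation_mono BB bounded_borel_indicator UB x subunitD(1)[OF that]) (simp add: indicator_def)
    show "blinfun_apply (\<pi> g) x \<le> vec_measure x U" if "g \<in> subunit X U" for g by (rule le_vec_measure[OF x U that])
    fix g assume g: "g \<in> C0 X" "\<And>z. indicator U z \<le> g z"
    show "vec_measure x U \<le> blinfun_apply (generated_representation X spectral_measure g) x"
      unfolding p by (intro S.generated_representation_mono BB bounded_borel_indicator UB x g)
    show "vec_measure x U \<le> blinfun_apply (\<pi> g) x"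
    proof (rule vec_measure_least[OF x U])
      fix h assume h: "h \<in> subunit X U"
      have "h z \<le> g z" for z using h g(2)[of z] by (auto simp: subunit_def intro: order_trans)
      then show "blinfun_apply (\<pi> h) x \<le> blinfun_apply (\<pi> g) x"
        by (intro rep_mono subunitD(1)[OF h] g x)
    qed
  qed
qed

theorem theorem5p6:
  fixes X :: "'a topology"
    and \<pi> :: "('a \<Rightarrow> real) \<Rightarrow> ('e::kb_space \<Rightarrow>\<^sub>L 'e)"
  assumes "locally_compact_space X" and "Hausdorff_space X"
    and "positive_representation (C0 X) \<pi>"
    and "\<And>f. f \<in> C0 X \<Longrightarrow> \<pi> f \<in> regular_operators"
  shows "\<exists>!P. positive_spectral_measure X P \<and> regular_spectral_measure X P \<and>
           (\<forall>f \<in> C0 X. generated_representation X P f = \<pi> f)"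
proof -
  obtain C where C: "\<And>f. f \<in> subunit X (topspace X) \<Longrightarrow> norm (\<pi> f) \<le> C"
    using positive_representation_bounded[of X \<pi>] assms(3) by (auto simp: positive_representation_def)
  interpret positive_rep X \<pi> C
    by unfold_locales (fact assms C)+
  show ?thesis
  proof (rule ex_ex1I)
    show "\<exists>P. positive_spectral_measure X P \<and> regular_spectral_measure X P \<and>
        (\<forall>f\<in>C0 X. generated_representation X P f = \<pi> f)"
      using positive_spectral_measure regular_spectral_measure generated_representation_spectral_measure by blast
    show "P = Q"
      if "positive_spectral_measure X P \<and> regular_spectral_measure X P \<and> (\<forall>f\<in>C0 X. generated_representation X P f = \<pi> f)"
        and "positive_spectral_measure X Q \<and> regular_spectral_measure X Q \<and> (\<forall>f\<in>C0 X. generated_representation X Q f = \<pi> f)"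
      for P Q
      using that by (intro regular_spectral_measure_unique) auto
  qed
qed

end
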